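(* Let $\mu$ be a $\sigma$-finite positive measure on a $\sigma$-algebra of subsets of a non-void set $X$, let $n\ge 1$, let $\Psi_1,\ldots,\Psi_n$ be bounded sets of positive kernel operators on $L^2(X,\mu)$, and let $\rho\in\{r,\hat r,r_{ess},\hat r_{ess},\|\cdot\|,\gamma,w\}$. Define $\rho_n:[0,1]\to[0,\infty)$ by $$\rho_n(\alpha)=\sqrt{\rho\big(S_\alpha(\Psi_1)S_\alpha(\Psi_2)\cdots S_\alpha(\Psi_n)\big)\,\rho\big(S_\alpha(\Psi_n)S_\alpha(\Psi_{n-1})\cdots S_\alpha(\Psi_1)\big)}.$$ Then $\rho_n$ is decreasing on $[0,\tfrac12]$ and increasing on $[\tfrac12,1]$. In particular, $\rho_n(\alpha)\ge\rho_n(\tfrac12)$ for each $\alpha\in[0,1]$.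
   Context: $L=L^2(X,\mu)$ is the space of complex square-integrable functions (mod a.e. equality). "Decreasing" and "increasing" are meant in the weak sense (non-increasing, non-decreasing). A kernel operator $K$ on $L$ is a linear operator for which there is a $\mu\times\mu$-measurable $k:X\times X\to\mathbb C$ such that for all $f\in L$ and almost all $x$, $\int_X|k(x,y)f(y)|\,d\mu(y)<\infty$ and $(Kf)(x)=\int_X k(x,y)f(y)\,d\mu(y)$. It is positive if it maps nonnegative functions to nonnegative functions, equivalently $k\ge 0$ a.e.; positive operators are automatically bounded. A set $\Psi$ of operators is bounded if $\sup_{A\in\Psi}\|A\|<\infty$. $A^*$ denotes the adjoint of $A$; if $A$ has a nonnegative kernel $a(x,y)$, then $A^*$ has kernel $a(y,x)$. For positive kernel operators $A,B$ with kernels $a,b$ and $\alpha\in[0,1]$, $A^{(\alpha)}\circ B^{(1-\alpha)}$ is the positive kernel operator on $L$ with kernel $a(x,y)^\alpha b(x,y)^{1-\alpha}$ (with $0^0=1$). For a bounded set $\Psi$ of positive kernel operators, $S_\alpha(\Psi)=\{A^{(\alpha)}\circ(B^* )^{(1-\alpha)}:A,B\in\Psi\}$ (with $A,B$ chosen independently), which is again a bounded set of positive kernel operators. For sets of operators, $\Psi\Sigma=\{AB:A\in\Psi,B\in\Sigma\}$ (similarly for several factors) and $\Sigma^m=\{A_1\cdots A_m:A_i\in\Sigma\}$. For a single bounded operator $A$ on $L$: $r(A)$ is the spectral radius; $\|A\|$ the operator norm; $w(A)=\sup\{|\langle Af,f\rangle|:\|f\|_2=1\}$ the numerical radius; $\gamma(A)=\inf\{\delta>0:\text{there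 is a finite }M\subset L\text{ with }A(D_L)\subset M+\delta D_L\}$, $D_L$ the closed unit ball of $L$, the Hausdorff measure of non-compactness; $r_{ess}(A)=\lim_{j\to\infty}\gamma(A^j)^{1/j}$ the essential spectral radius (the spectral radius of the image of $A$ in the Calkin algebra). For a bounded set $\Sigma$ of bounded operators: $\|\Sigma\|=\sup_{A\in\Sigma}\|A\|$, $\gamma(\Sigma)=\sup_{A\in\Sigma}\gamma(A)$, $w(\Sigma)=\sup_{A\in\Sigma}w(A)$; the generalized spectral radius is $r(\Sigma)=\limsup_{m\to\infty}[\sup_{A\in\Sigma^m}r(A)]^{1/m}$; the joint spectral radius is $\hat r(\Sigma)=\lim_{m\to\infty}[\sup_{A\in\Sigma^m}\|A\|]^{1/m}$; the generalized essential spectral radius is $r_{ess}(\Sigma)=\limsup_{m\to\infty}[\sup_{A\in\Sigma^m}r_{ess}(A)]^{1/m}$; the joint essential spectral radius is $\hat r_{ess}(\Sigma)=\lim_{m\to\infty}[\sup_{A\in\Sigma^m}\gamma(A)]^{1/m}$. (Suprema are taken in $[0,\infty)$, so $\sup\emptyset=0$.) *)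

theory Defs
  imports "HOL-Analysis.Analysis" "HOL-Library.Nonpos_Ints"
begin

text \<open>
  The space \<open>L\<^sup>2(M)\<close> is represented by its square-integrable functions. Elements are identified
  when they agree almost everywhere: operators are required to respect this relation, and every
  equation between elements of the space is an a.e. equation. An operator is a function on
  representatives; its values outside \<open>L2 M\<close> are irrelevant.
\<close>

type_synonym 'a l2op = "('a \<Rightarrow> complex) \<Rightarrow> ('a \<Rightarrow> complex)"

definition L2 :: "'a measure \<Rightarrow> ('a \<Rightarrow> complex) set" where
  "L2 M = {f \<in> borel_measurable M. integrable M (\<lambda>x. (cmod (f x))\<^sup>2)}"

definition l2_inner :: "'a measure \<Rightarrow> ('a \<Rightarrow> complex) \<Rightarrow> ('a \<Rightarrow> complex) \<Rightarrow> complex" where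
  "l2_inner M f g = (\<integral>x. f x * cnj (g x) \<partial>M)"

definition l2_norm :: "'a measure \<Rightarrow> ('a \<Rightarrow> complex) \<Rightarrow> real" where
  "l2_norm M f = sqrt (\<integral>x. (cmod (f x))\<^sup>2 \<partial>M)"

definition l2_ball :: "'a measure \<Rightarrow> ('a \<Rightarrow> complex) set" where
  "l2_ball M = {f \<in> L2 M. l2_norm M f \<le> 1}"

definition linear_op :: "'a measure \<Rightarrow> 'a l2op \<Rightarrow> bool" where
  "linear_op M A \<longleftrightarrow>
     (\<forall>f\<in>L2 M. A f \<in> L2 M) \<and>
     (\<forall>f\<in>L2 M. \<forall>g\<in>L2 M. (AE x in M. f x = g x) \<longrightarrow> (AE x in M. A f x = A g x)) \<and>
     (\<forall>f\<in>L2 M. \<forall>g\<in>L2 M. AE x in M. A (\<lambda>t. f t + g t) x = A f x + A g x) \<and>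
     (\<forall>c. \<forall>f\<in>L2 M. AE x in M. A (\<lambda>t. c * f t) x = c * A f x)"

definition bounded_op :: "'a measure \<Rightarrow> 'a l2op \<Rightarrow> bool" where
  "bounded_op M A \<longleftrightarrow>
     linear_op M A \<and> (\<exists>C. \<forall>f\<in>L2 M. l2_norm M (A f) \<le> C * l2_norm M f)"

definition adjoint_of :: "'a measure \<Rightarrow> 'a l2op \<Rightarrow> 'a l2op \<Rightarrow> bool" where
  "adjoint_of M A B \<longleftrightarrow>
     bounded_op M B \<and> (\<forall>f\<in>L2 M. \<forall>g\<in>L2 M. l2_inner M (A f) g = l2_inner M f (B g))"

text \<open>The choice is unique up to a.e. equality of the values.\<close>

definition adj :: "'a measure \<Rightarrow> 'a l2op \<Rightarrow> 'a l2op" where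
  "adj M A = (SOME B. adjoint_of M A B)"


subsection \<open>Kernel operators\<close>

definition kernel_integral :: "'a measure \<Rightarrow> ('a \<times> 'a \<Rightarrow> complex) \<Rightarrow> 'a l2op" where
  "kernel_integral M k f = (\<lambda>x. \<integral>y. k (x, y) * f y \<partial>M)"

definition has_kernel :: "'a measure \<Rightarrow> 'a l2op \<Rightarrow> ('a \<times> 'a \<Rightarrow> complex) \<Rightarrow> bool" where
  "has_kernel M A k \<longleftrightarrow>
     k \<in> borel_measurable (M \<Otimes>\<^sub>M M) \<and>
     (\<forall>f\<in>L2 M. AE x in M. integrable M (\<lambda>y. k (x, y) * f y) \<and> A f x = kernel_integral M k f x)"

definition positive_op :: "'a measure \<Rightarrow> 'a l2op \<Rightarrow> bool" where
  "positive_op M A \<longleftrightarrow>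
     (\<forall>f\<in>L2 M. (AE x in M. f x \<in> \<real>\<^sub>\<ge>\<^sub>0) \<longrightarrow> (AE x in M. A f x \<in> \<real>\<^sub>\<ge>\<^sub>0))"

definition positive_kernel_op :: "'a measure \<Rightarrow> 'a l2op \<Rightarrow> bool" where
  "positive_kernel_op M A \<longleftrightarrow>
     linear_op M A \<and> (\<exists>k. has_kernel M A k) \<and> positive_op M A"

text \<open>
  The kernel of a positive kernel operator is nonnegative a.e. and unique up to a null set of the
  product measure, so a version that is nonnegative everywhere may be chosen.
\<close>

definition nonneg_kernel :: "'a measure \<Rightarrow> 'a l2op \<Rightarrow> 'a \<times> 'a \<Rightarrow> real" where
  "nonneg_kernel M A =
     (SOME a. (\<forall>z. 0 \<le> a z) \<and> has_kernel M A (\<lambda>z. complex_of_real (a z)))"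

text \<open>Real powers of nonnegative numbers with \<open>0\<^sup>0 = 1\<close>; in the library, \<open>0 powr 0 = 0\<close>.\<close>

definition rpow :: "real \<Rightarrow> real \<Rightarrow> real" where
  "rpow x \<alpha> = (if x = 0 \<and> \<alpha> = 0 then 1 else x powr \<alpha>)"

text \<open>\<open>hadamard M \<alpha> A B\<close> is the weighted geometric mean \<open>A\<^sup>(\<^sup>\<alpha>\<^sup>) \<circ> B\<^sup>(\<^sup>1\<^sup>-\<^sup>\<alpha>\<^sup>)\<close>.\<close>

definition hadamard :: "'a measure \<Rightarrow> real \<Rightarrow> 'a l2op \<Rightarrow> 'a l2op \<Rightarrow> 'a l2op" where
  "hadamard M \<alpha> A B =
     kernel_integral M (\<lambda>z. complex_of_real
       (rpow (nonneg_kernel M A z) \<alpha> * rpow (nonneg_kernel M B z) (1 - \<alpha>)))"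

definition S_mean :: "'a measure \<Rightarrow> real \<Rightarrow> 'a l2op set \<Rightarrow> 'a l2op set" where
  "S_mean M \<alpha> \<Psi> = {hadamard M \<alpha> A (adj M B) | A B. A \<in> \<Psi> \<and> B \<in> \<Psi>}"


subsection \<open>Products of sets of operators\<close>

fun ops_prod :: "'a l2op set list \<Rightarrow> 'a l2op set" where
  "ops_prod [] = {id}"
| "ops_prod (\<Sigma> # \<Sigma>s) = {A \<circ> B | A B. A \<in> \<Sigma> \<and> B \<in> ops_prod \<Sigma>s}"

definition ops_power :: "'a l2op set \<Rightarrow> nat \<Rightarrow> 'a l2op set" where
  "ops_power \<Sigma> m = ops_prod (replicate m \<Sigma>)"


subsection \<open>Functionals of a single operator\<close>

text \<open>
  Suprema of sets of nonnegative reals, taken in \<open>[0,\<infinity>)\<close>, so that the supremum of the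
  empty set is \<open>0\<close>.
\<close>

definition sup0 :: "real set \<Rightarrow> real" where
  "sup0 S = Sup (insert 0 S)"

definition op_norm :: "'a measure \<Rightarrow> 'a l2op \<Rightarrow> real" where
  "op_norm M A = sup0 {l2_norm M (A f) | f. f \<in> l2_ball M}"

definition numerical_radius :: "'a measure \<Rightarrow> 'a l2op \<Rightarrow> real" where
  "numerical_radius M A = sup0 {cmod (l2_inner M (A f) f) | f. f \<in> L2 M \<and> l2_norm M f = 1}"

definition l2_spectrum :: "'a measure \<Rightarrow> 'a l2op \<Rightarrow> complex set" where
  "l2_spectrum M A = {z. \<not> (\<exists>R. bounded_op M R \<and>
     (\<forall>f\<in>L2 M. (AE x in M. R (\<lambda>t. z * f t - A f t) x = f x) \<and>
                (AE x in M. z * R f x - A (R f) x = f x)))}"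

definition spectral_rad :: "'a measure \<Rightarrow> 'a l2op \<Rightarrow> real" where
  "spectral_rad M A = sup0 (cmod ` l2_spectrum M A)"

definition hausdorff_mnc :: "'a measure \<Rightarrow> 'a l2op \<Rightarrow> real" where
  "hausdorff_mnc M A = Inf {\<delta>. \<delta> > 0 \<and>
     (\<exists>F. finite F \<and> F \<subseteq> L2 M \<and>
        (\<forall>f\<in>l2_ball M. \<exists>g\<in>F. \<exists>h\<in>l2_ball M. AE x in M. A f x = g x + complex_of_real \<delta> * h x))}"

definition ess_spectral_rad :: "'a measure \<Rightarrow> 'a l2op \<Rightarrow> real" where
  "ess_spectral_rad M A = lim (\<lambda>j. root j (hausdorff_mnc M (A ^^ j)))"

definition bounded_ops :: "'a measure \<Rightarrow> 'a l2op set \<Rightarrow> bool" where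
  "bounded_ops M \<Psi> \<longleftrightarrow> (\<forall>A\<in>\<Psi>. bounded_op M A) \<and> bdd_above (op_norm M ` \<Psi>)"


subsection \<open>Functionals of a set of operators\<close>

definition set_norm :: "'a measure \<Rightarrow> 'a l2op set \<Rightarrow> real" where
  "set_norm M \<Sigma> = sup0 (op_norm M ` \<Sigma>)"

definition set_mnc :: "'a measure \<Rightarrow> 'a l2op set \<Rightarrow> real" where
  "set_mnc M \<Sigma> = sup0 (hausdorff_mnc M ` \<Sigma>)"

definition set_numerical_radius :: "'a measure \<Rightarrow> 'a l2op set \<Rightarrow> real" where
  "set_numerical_radius M \<Sigma> = sup0 (numerical_radius M ` \<Sigma>)"

text \<open>
  \<open>limsup\<close> lives in complete lattices, hence the detour through \<open>ereal\<close>. The value of the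
  sequences below at \<open>m = 0\<close>, where \<open>root 0 x = 0\<close>, does not matter.
\<close>

definition gen_spectral_rad :: "'a measure \<Rightarrow> 'a l2op set \<Rightarrow> real" where
  "gen_spectral_rad M \<Sigma> =
     real_of_ereal (limsup (\<lambda>m. ereal (root m (sup0 (spectral_rad M ` ops_power \<Sigma> m)))))"

definition joint_spectral_rad :: "'a measure \<Rightarrow> 'a l2op set \<Rightarrow> real" where
  "joint_spectral_rad M \<Sigma> = lim (\<lambda>m. root m (sup0 (op_norm M ` ops_power \<Sigma> m)))"

definition gen_ess_spectral_rad :: "'a measure \<Rightarrow> 'a l2op set \<Rightarrow> real" where
  "gen_ess_spectral_rad M \<Sigma> =
     real_of_ereal (limsup (\<lambda>m. ereal (root m (sup0 (ess_spectral_rad M ` ops_power \<Sigma> m)))))"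

definition joint_ess_spectral_rad :: "'a measure \<Rightarrow> 'a l2op set \<Rightarrow> real" where
  "joint_ess_spectral_rad M \<Sigma> = lim (\<lambda>m. root m (sup0 (hausdorff_mnc M ` ops_power \<Sigma> m)))"

definition rho_n ::
  "'a measure \<Rightarrow> ('a l2op set \<Rightarrow> real) \<Rightarrow> (nat \<Rightarrow> 'a l2op set) \<Rightarrow> nat \<Rightarrow> real \<Rightarrow> real" where
  "rho_n M \<rho> \<Psi> n \<alpha> =
     sqrt (\<rho> (ops_prod (map (\<lambda>i. S_mean M \<alpha> (\<Psi> i)) [1..<n+1])) *
           \<rho> (ops_prod (map (\<lambda>i. S_mean M \<alpha> (\<Psi> i)) (rev [1..<n+1]))))"

end

theory Submission imports Defs begin

text \<open>
  Let \<open>\<beta>\<close> and \<open>\<alpha>\<close> lie on the same side of \<open>1/2\<close>, with \<open>\<alpha>\<close> closer to it; then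
  \<open>\<alpha> = \<theta> \<beta> + (1-\<theta>) (1-\<beta>)\<close> with \<open>0 < \<theta> < 1\<close>. With \<open>a\<close>, \<open>b*\<close> the kernels of \<open>A\<close>, \<open>B*\<close>, the kernel
  \<open>a\<^sup>\<alpha> (b*)\<^sup>1\<^sup>-\<^sup>\<alpha>\<close> is the weighted geometric mean of \<open>c = a\<^sup>\<beta> (b*)\<^sup>1\<^sup>-\<^sup>\<beta>\<close> and \<open>d* = a\<^sup>1\<^sup>-\<^sup>\<beta> (b*)\<^sup>\<beta>\<close>,
  where \<open>c\<close> and \<open>d\<close> belong to \<open>S\<^sub>\<beta>(\<Psi>)\<close>. Hence every operator \<open>T\<close> of \<open>S\<^sub>\<alpha>(\<Psi>)\<close> satisfies, for some \<open>C\<close>, \<open>D\<close>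
  in \<open>S\<^sub>\<beta>(\<Psi>)\<close> and all \<open>u, v \<ge> 0\<close>, the inequality \<open>T (u\<^sup>\<theta> v\<^sup>1\<^sup>-\<^sup>\<theta>) \<le> (C u)\<^sup>\<theta> (D* v)\<^sup>1\<^sup>-\<^sup>\<theta>\<close>.
  This inequality is stable under products, with the order of the operators \<open>D\<close> reversed, and it gives
  \<open>\<rho>(T) \<le> \<rho>(C)\<^sup>\<theta> \<rho>(D)\<^sup>1\<^sup>-\<^sup>\<theta>\<close> for each of the functionals; multiplying the estimates for the product and
  for the reversed product yields \<open>\<rho>\<^sub>n(\<alpha>) \<le> \<rho>\<^sub>n(\<beta>)\<close>.

  The norm and the numerical radius are treated by Hoelder's inequality. The measure of non-compactness
  of a positive kernel operator is the limit of the norms of its restrictions to small sets, because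
  kernel operators map order intervals to totally bounded sets. The spectral radius reduces to
  the norms of powers; the formula \<open>r(T) = lim \<bar>T\<^sup>k\<bar>\<^sup>1\<^sup>/\<^sup>k\<close> is proved for positive \<open>T\<close> by order
  arguments instead of complex analysis, since for real \<open>s > r(T)\<close> the resolvent is positive and
  dominates \<open>T\<^sup>k / s\<^sup>k\<^sup>+\<^sup>1\<close>.
\<close>

section \<open>Square-integrable functions\<close>

text \<open>The adjoint enters because exchanging the exponents \<beta> and 1-\<beta> destroys the
  form required in \<open>S_mean\<close>, and transposing the kernel restores it. Transposition
  reverses products, and this is what the second factor in \<open>rho_n\<close> compensates: in the
  product of the two estimates each value at \<beta> receives the total exponent \<theta> +
  (1-\<theta>).

  Two obstacles shape the rest. \<open>adj\<close> and \<open>nonneg_kernel\<close> are arbitrary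
  choices, so kernels have to be a.e. nonnegative and unique before anything can be computed; yet
  the exceptional set in \<open>has_kernel\<close> depends on the function, and the sigma-algebra
  need not be countably generated. The measure of non-compactness is an infimum over nets and does
  not react to pointwise inequalities; it is therefore compared, from below for \<open>C\<close> and
  \<open>D\<close> and from above for \<open>T\<close>, with norms of images of functions cut to
  sets of small weight, and these norms obey Hoelder's inequality.\<close>

abbreviation (input) cr :: "('a \<Rightarrow> real) \<Rightarrow> 'a \<Rightarrow> complex" where
  "cr u \<equiv> (\<lambda>x. complex_of_real (u x))"

text \<open>Nonnegativity is imposed at every point, not almost everywhere, so that real powers and
  Hoelder's inequality apply without exceptional sets.\<close>

definition pL :: "'a measure \<Rightarrow> ('a \<Rightarrow> real) set" where
  "pL M = {u \<in> borel_measurable M. (\<forall>x. 0 \<le> u x) \<and> integrable M (\<lambda>x. (u x)\<^sup>2)}"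

lemma pLD:
  assumes "u \<in> pL M"
  shows "u \<in> borel_measurable M" "0 \<le> u x" "integrable M (\<lambda>x. (u x)\<^sup>2)"
  using assms by (auto simp: pL_def)

lemma L2D:
  assumes "f \<in> L2 M"
  shows "f \<in> borel_measurable M" "integrable M (\<lambda>x. (cmod (f x))\<^sup>2)"
  using assms by (auto simp: L2_def)

lemma cr_L2: "u \<in> pL M \<Longrightarrow> cr u \<in> L2 M"
  by (auto simp: pL_def L2_def)

lemma cmod_pL: "f \<in> L2 M \<Longrightarrow> (\<lambda>x. cmod (f x)) \<in> pL M"
  by (auto simp: pL_def L2_def)

lemma l2_norm_cr: "l2_norm M (cr u) = sqrt (\<integral>x. (u x)\<^sup>2 \<partial>M)"
  by (simp add: l2_norm_def)

lemma l2_norm_cmod: "l2_norm M (cr (\<lambda>x. cmod (f x))) = l2_norm M f"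
  by (simp add: l2_norm_def)

lemma l2_norm_nonneg [simp]: "0 \<le> l2_norm M f"
  by (simp add: l2_norm_def)

lemma l2_norm_sq: "(l2_norm M f)\<^sup>2 = (\<integral>x. (cmod (f x))\<^sup>2 \<partial>M)"
  by (simp add: l2_norm_def)

lemma L2_dominated:
  assumes "u \<in> pL M" "f \<in> borel_measurable M" "AE x in M. cmod (f x) \<le> u x"
  shows "f \<in> L2 M" "l2_norm M f \<le> l2_norm M (cr u)"
proof -
  have ae: "AE x in M. (cmod (f x))\<^sup>2 \<le> (u x)\<^sup>2"
    using assms(3) by eventually_elim (simp add: power_mono)
  show *: "f \<in> L2 M"
    unfolding L2_def using assms(2)
    using Bochner_Integration.integrable_bound[OF pLD(3)[OF assms(1)], of "\<lambda>x. (cmod (f x))\<^sup>2"] ae by auto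
  show "l2_norm M f \<le> l2_norm M (cr u)"
    unfolding l2_norm_def
    by (rule real_sqrt_le_mono, rule integral_mono_AE)
      (use * ae pLD(3)[OF assms(1)] in \<open>auto simp: L2_def\<close>)
qed

lemma l2_norm_mono:
  assumes "g \<in> L2 M" "f \<in> borel_measurable M" "AE x in M. cmod (f x) \<le> cmod (g x)"
  shows "f \<in> L2 M" "l2_norm M f \<le> l2_norm M g"
  using L2_dominated[OF cmod_pL[OF assms(1)] assms(2,3)] by (simp_all add: l2_norm_cmod)

lemma pL_dominated:
  assumes "u \<in> pL M" "v \<in> borel_measurable M" "\<And>x. 0 \<le> v x" "AE x in M. v x \<le> u x"
  shows "v \<in> pL M" "l2_norm M (cr v) \<le> l2_norm M (cr u)"
proof -
  have "cr v \<in> borel_measurable M" "AE x in M. cmod (cr v x) \<le> u x"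
    using assms by auto
  note L2_dominated[OF assms(1) this]
  then show "v \<in> pL M" "l2_norm M (cr v) \<le> l2_norm M (cr u)"
    using assms by (auto simp: L2_def pL_def)
qed

lemma l2_norm_cong_AE:
  assumes "f \<in> borel_measurable M" "g \<in> borel_measurable M" "AE x in M. f x = g x"
  shows "l2_norm M f = l2_norm M g"
  unfolding l2_norm_def
  by (rule arg_cong[where f=sqrt], rule integral_cong_AE) (use assms in auto)

lemma L2_0 [simp]: "(\<lambda>x. 0) \<in> L2 M"
  by (simp add: L2_def)

lemma l2_norm_0 [simp]: "l2_norm M (\<lambda>x. 0) = 0"
  by (simp add: l2_norm_def)

lemma L2_scale: "f \<in> L2 M \<Longrightarrow> (\<lambda>x. c * f x) \<in> L2 M"
  by (auto simp: L2_def norm_mult power_mult_distrib)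

lemma l2_norm_scale: "l2_norm M (\<lambda>x. c * f x) = cmod c * l2_norm M f"
  by (simp add: l2_norm_def norm_mult power_mult_distrib real_sqrt_mult)

lemma pL_add:
  assumes "u \<in> pL M" "v \<in> pL M"
  shows "(\<lambda>x. u x + v x) \<in> pL M"
proof -
  have i: "integrable M (\<lambda>x. 2 * (u x)\<^sup>2 + 2 * (v x)\<^sup>2)"
    using pLD(3)[OF assms(1)] pLD(3)[OF assms(2)] by auto
  have b: "(u x + v x)\<^sup>2 \<le> 2 * (u x)\<^sup>2 + 2 * (v x)\<^sup>2" for x
    using sum_squares_bound[of "u x" "v x"] by (simp add: power2_sum)
  have "integrable M (\<lambda>x. (u x + v x)\<^sup>2)"
    by (rule Bochner_Integration.integrable_bound[OF i])
      (use b pLD(1)[OF assms(1)] pLD(1)[OF assms(2)] in \<open>auto simp: abs_of_nonneg intro: AE_I2\<close>)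
  then show ?thesis
    using assms by (auto simp: pL_def)
qed

lemma L2_add:
  assumes "f \<in> L2 M" "g \<in> L2 M"
  shows "(\<lambda>x. f x + g x) \<in> L2 M"
  by (rule L2_dominated[OF pL_add[OF cmod_pL[OF assms(1)] cmod_pL[OF assms(2)]]])
    (use assms in \<open>auto simp: L2_def norm_triangle_ineq\<close>)

lemma L2_diff:
  assumes "f \<in> L2 M" "g \<in> L2 M"
  shows "(\<lambda>x. f x - g x) \<in> L2 M"
  using L2_add[OF assms(1) L2_scale[OF assms(2), of "-1"]] by simp

lemma L2_sum:
  assumes "finite I" "\<And>i. i \<in> I \<Longrightarrow> f i \<in> L2 M"
  shows "(\<lambda>x. \<Sum>i\<in>I. f i x) \<in> L2 M"
  using assms by (induction I) (auto intro: L2_add)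

section \<open>Hoelder's inequality, inner product and norm\<close>

text \<open>Young's inequality for \<open>f / ?A\<close> and \<open>g / ?B\<close>, integrated. If
  one of the integrals vanishes this normalisation is impossible, but then the integrand is zero
  a.e.\<close>

lemma Hoelder_integral:
  fixes f g :: "'a \<Rightarrow> real"
  assumes "0 < \<theta>" "\<theta> < 1" "integrable M f" "integrable M g" "\<And>x. 0 \<le> f x" "\<And>x. 0 \<le> g x"
  shows "integrable M (\<lambda>x. f x powr \<theta> * g x powr (1-\<theta>))"
    and "(\<integral>x. f x powr \<theta> * g x powr (1-\<theta>) \<partial>M) \<le> (\<integral>x. f x \<partial>M) powr \<theta> * (\<integral>x. g x \<partial>M) powr (1-\<theta>)"
proof -
  have Y: "a powr \<theta> * b powr (1-\<theta>) \<le> \<theta> * a + (1-\<theta>) * b" if "0 \<le> a" "0 \<le> b" for a b :: real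
    using Youngs_inequality_0[of \<theta> "1-\<theta>" a b] assms that by (cases "a = 0 \<or> b = 0") auto
  show int: "integrable M (\<lambda>x. f x powr \<theta> * g x powr (1-\<theta>))"
    by (rule Bochner_Integration.integrable_bound[of M "\<lambda>x. \<theta> * f x + (1-\<theta>) * g x"])
      (use assms Y in \<open>auto intro!: AE_I2 order_trans[OF Y] abs_ge_self\<close>)
  let ?A = "\<integral>x. f x \<partial>M" and ?B = "\<integral>x. g x \<partial>M"
  have pos: "0 \<le> ?A" "0 \<le> ?B" using assms by auto
  show "(\<integral>x. f x powr \<theta> * g x powr (1-\<theta>) \<partial>M) \<le> ?A powr \<theta> * ?B powr (1-\<theta>)"
  proof (cases "?A = 0 \<or> ?B = 0")
    case True
    have "AE x in M. f x powr \<theta> * g x powr (1-\<theta>) = 0"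
      using True
    proof
      assume "?A = 0"
      then have "AE x in M. f x = 0" using assms by (simp add: integral_nonneg_eq_0_iff_AE)
      then show ?thesis by eventually_elim (use assms in simp)
    next
      assume "?B = 0"
      then have "AE x in M. g x = 0" using assms by (simp add: integral_nonneg_eq_0_iff_AE)
      then show ?thesis by eventually_elim (use assms in simp)
    qed
    then have "(\<integral>x. f x powr \<theta> * g x powr (1-\<theta>) \<partial>M) = 0"
      by (rule integral_eq_zero_AE)
    then show ?thesis using pos by simp
  next
    case False
    then have A: "?A > 0" and B: "?B > 0" using pos by auto
    have pw: "f x powr \<theta> * g x powr (1-\<theta>)
        \<le> ?A powr \<theta> * ?B powr (1-\<theta>) * (\<theta> * (f x / ?A) + (1-\<theta>) * (g x / ?B))" for x
    proof -
      have "f x powr \<theta> * g x powr (1-\<theta>)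
        = ?A powr \<theta> * ?B powr (1-\<theta>) * ((f x / ?A) powr \<theta> * (g x / ?B) powr (1-\<theta>))"
        using A B assms(5,6)[of x] by (simp add: powr_divide)
      also have "\<dots> \<le> ?A powr \<theta> * ?B powr (1-\<theta>) * (\<theta> * (f x / ?A) + (1-\<theta>) * (g x / ?B))"
        by (rule mult_left_mono[OF Y]) (use assms A B in auto)
      finally show ?thesis .
    qed
    have "(\<integral>x. f x powr \<theta> * g x powr (1-\<theta>) \<partial>M)
       \<le> (\<integral>x. ?A powr \<theta> * ?B powr (1-\<theta>) * (\<theta> * (f x / ?A) + (1-\<theta>) * (g x / ?B)) \<partial>M)"
      by (rule integral_mono_AE[OF int]) (use assms pw in auto)
    also have "\<dots> = ?A powr \<theta> * ?B powr (1-\<theta>) * (\<theta> * (?A / ?A) + (1-\<theta>) * (?B / ?B))"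
      using assms by simp
    also have "\<dots> = ?A powr \<theta> * ?B powr (1-\<theta>)"
      using A B by simp
    finally show ?thesis .
  qed
qed

lemma powr_half_sq: "0 \<le> a \<Longrightarrow> (a\<^sup>2) powr (1/2) = (a::real)"
  by (simp add: powr_half_sqrt)

text \<open>Hoelder's inequality with \<theta> = 1/2 for the squares of \<open>u\<close> and
  \<open>v\<close>.\<close>

lemma pL_Cauchy_Schwarz:
  assumes "u \<in> pL M" "v \<in> pL M"
  shows "integrable M (\<lambda>x. u x * v x)"
    and "(\<integral>x. u x * v x \<partial>M) \<le> l2_norm M (cr u) * l2_norm M (cr v)"
proof -
  have eq: "(u x)\<^sup>2 powr (1/2) * (v x)\<^sup>2 powr (1-1/2) = u x * v x" for x
    using powr_half_sq[OF pLD(2)[OF assms(1)]] powr_half_sq[OF pLD(2)[OF assms(2)]] by simp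
  show "integrable M (\<lambda>x. u x * v x)"
    "(\<integral>x. u x * v x \<partial>M) \<le> l2_norm M (cr u) * l2_norm M (cr v)"
    using Hoelder_integral[of "1/2" M "\<lambda>x. (u x)\<^sup>2" "\<lambda>x. (v x)\<^sup>2", unfolded eq]
      pLD(3)[OF assms(1)] pLD(3)[OF assms(2)]
    by (simp_all add: l2_norm_cr powr_half_sqrt)
qed

lemma borel_measurable_cnj [measurable (raw)]:
  "f \<in> borel_measurable M \<Longrightarrow> (\<lambda>x. cnj (f x)) \<in> borel_measurable M"
  by (rule measurable_compose[OF _ borel_measurable_continuous_onI]) (auto intro: continuous_intros)

lemma L2_mult_integrable:
  assumes "f \<in> L2 M" "g \<in> L2 M"
  shows "integrable M (\<lambda>x. f x * g x)" "integrable M (\<lambda>x. f x * cnj (g x))"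
    "integrable M (\<lambda>x. cmod (f x) * cmod (g x))"
proof -
  show *: "integrable M (\<lambda>x. cmod (f x) * cmod (g x))"
    by (rule pL_Cauchy_Schwarz[OF cmod_pL[OF assms(1)] cmod_pL[OF assms(2)]])
  have m: "f \<in> borel_measurable M" "g \<in> borel_measurable M" using assms by (auto simp: L2_def)
  show "integrable M (\<lambda>x. f x * g x)" "integrable M (\<lambda>x. f x * cnj (g x))"
    using m by (auto intro!: Bochner_Integration.integrable_bound[OF *] simp: norm_mult)
qed

lemma l2_inner_le:
  assumes "f \<in> L2 M" "g \<in> L2 M"
  shows "cmod (l2_inner M f g) \<le> (\<integral>x. cmod (f x) * cmod (g x) \<partial>M)"
    and "(\<integral>x. cmod (f x) * cmod (g x) \<partial>M) \<le> l2_norm M f * l2_norm M g"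
    and "cmod (l2_inner M f g) \<le> l2_norm M f * l2_norm M g"
proof -
  show 1: "cmod (l2_inner M f g) \<le> (\<integral>x. cmod (f x) * cmod (g x) \<partial>M)"
    unfolding l2_inner_def
    using integral_norm_bound[of M "\<lambda>x. f x * cnj (g x)"] by (simp add: norm_mult)
  show 2: "(\<integral>x. cmod (f x) * cmod (g x) \<partial>M) \<le> l2_norm M f * l2_norm M g"
    using pL_Cauchy_Schwarz(2)[OF cmod_pL[OF assms(1)] cmod_pL[OF assms(2)]]
    by (simp add: l2_norm_def)
  show "cmod (l2_inner M f g) \<le> l2_norm M f * l2_norm M g"
    using 1 2 by simp
qed

lemma l2_inner_self: "l2_inner M f f = complex_of_real ((l2_norm M f)\<^sup>2)"
proof -
  have "l2_inner M f f = (\<integral>x. complex_of_real ((cmod (f x))\<^sup>2) \<partial>M)"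
    unfolding l2_inner_def by (simp only: complex_norm_square)
  also have "\<dots> = complex_of_real (\<integral>x. (cmod (f x))\<^sup>2 \<partial>M)"
    by (rule integral_complex_of_real)
  finally show ?thesis by (simp add: l2_norm_sq)
qed

lemma l2_inner_scale_left: "l2_inner M (\<lambda>x. c * f x) h = c * l2_inner M f h"
  by (simp add: l2_inner_def mult.assoc)

lemma l2_inner_diff_left:
  assumes "f \<in> L2 M" "g \<in> L2 M" "h \<in> L2 M"
  shows "l2_inner M (\<lambda>x. f x - g x) h = l2_inner M f h - l2_inner M g h"
  using L2_mult_integrable(2)[OF assms(1,3)] L2_mult_integrable(2)[OF assms(2,3)]
  by (simp add: l2_inner_def left_diff_distrib)

lemma l2_inner_cnj: "l2_inner M g f = cnj (l2_inner M f g)"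
proof -
  have "cnj (\<integral>x. f x * cnj (g x) \<partial>M) = (\<integral>x. cnj (f x * cnj (g x)) \<partial>M)"
    by (simp del: complex_cnj_mult)
  then show ?thesis by (simp add: l2_inner_def mult.commute)
qed

lemma l2_inner_cong_AE:
  assumes "f \<in> borel_measurable M" "g \<in> borel_measurable M" "h \<in> borel_measurable M"
    "AE x in M. f x = g x"
  shows "l2_inner M f h = l2_inner M g h" "l2_inner M h f = l2_inner M h g"
  unfolding l2_inner_def using assms by (auto intro!: integral_cong_AE)

lemma l2_norm_triangle:
  assumes "f \<in> L2 M" "g \<in> L2 M"
  shows "l2_norm M (\<lambda>x. f x + g x) \<le> l2_norm M f + l2_norm M g"
proof (rule power2_le_imp_le)
  let ?u = "\<lambda>x. cmod (f x)" and ?v = "\<lambda>x. cmod (g x)"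
  have i: "integrable M (\<lambda>x. (?u x)\<^sup>2)" "integrable M (\<lambda>x. (?v x)\<^sup>2)" "integrable M (\<lambda>x. ?u x * ?v x)"
    using assms L2_mult_integrable(3)[OF assms] by (auto simp: L2_def)
  have "(l2_norm M (\<lambda>x. f x + g x))\<^sup>2 = (\<integral>x. (cmod (f x + g x))\<^sup>2 \<partial>M)"
    by (simp add: l2_norm_sq)
  also have "\<dots> \<le> (\<integral>x. (?u x)\<^sup>2 + (?v x)\<^sup>2 + 2 * (?u x * ?v x) \<partial>M)"
  proof (rule integral_mono_AE)
    show "AE x in M. (cmod (f x + g x))\<^sup>2 \<le> (?u x)\<^sup>2 + (?v x)\<^sup>2 + 2 * (?u x * ?v x)"
    proof (rule AE_I2)
      fix x
      have "(cmod (f x + g x))\<^sup>2 \<le> (?u x + ?v x)\<^sup>2"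
        by (intro power_mono norm_triangle_ineq) auto
      then show "(cmod (f x + g x))\<^sup>2 \<le> (?u x)\<^sup>2 + (?v x)\<^sup>2 + 2 * (?u x * ?v x)"
        by (simp add: power2_sum)
    qed
  qed (use i L2_add[OF assms] in \<open>auto simp: L2_def\<close>)
  also have "\<dots> = (l2_norm M f)\<^sup>2 + (l2_norm M g)\<^sup>2 + 2 * (\<integral>x. ?u x * ?v x \<partial>M)"
    using i by (simp add: l2_norm_sq)
  also have "\<dots> \<le> (l2_norm M f + l2_norm M g)\<^sup>2"
    using l2_inner_le(2)[OF assms] by (simp add: power2_sum)
  finally show "(l2_norm M (\<lambda>x. f x + g x))\<^sup>2 \<le> (l2_norm M f + l2_norm M g)\<^sup>2" .
qed simp

lemma l2_norm_triangle_diff: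
  assumes "f \<in> L2 M" "g \<in> L2 M"
  shows "l2_norm M (\<lambda>x. f x - g x) \<le> l2_norm M f + l2_norm M g"
  using l2_norm_triangle[OF assms(1) L2_scale[OF assms(2), of "-1"]] l2_norm_scale[of M "-1" g] by simp

lemma l2_norm_sum_le:
  assumes "finite I" "\<And>i. i \<in> I \<Longrightarrow> f i \<in> L2 M"
  shows "l2_norm M (\<lambda>x. \<Sum>i\<in>I. f i x) \<le> (\<Sum>i\<in>I. l2_norm M (f i))"
  using assms
proof (induction I)
  case (insert i I)
  have "l2_norm M (\<lambda>x. f i x + (\<Sum>i\<in>I. f i x)) \<le> l2_norm M (f i) + l2_norm M (\<lambda>x. \<Sum>i\<in>I. f i x)"
    by (rule l2_norm_triangle) (use insert in \<open>auto intro!: L2_sum\<close>)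
  also have "\<dots> \<le> l2_norm M (f i) + (\<Sum>i\<in>I. l2_norm M (f i))"
    using insert by simp
  finally show ?case using insert by simp
qed simp

lemma l2_norm_eq_0:
  assumes "f \<in> L2 M" "l2_norm M f = 0"
  shows "AE x in M. f x = 0"
proof -
  have "(\<integral>x. (cmod (f x))\<^sup>2 \<partial>M) = 0" using assms l2_norm_sq[of M f] by simp
  then have "AE x in M. (cmod (f x))\<^sup>2 = 0"
    using assms by (simp add: integral_nonneg_eq_0_iff_AE L2_def)
  then show ?thesis by simp
qed

text \<open>Hoelder's inequality for the squares, followed by a square root. It turns pointwise
  geometric means into geometric means of norms.\<close>

lemma pL_interpolate:
  assumes "0 < \<theta>" "\<theta> < 1" "u \<in> pL M" "v \<in> pL M"
  shows "(\<lambda>x. u x powr \<theta> * v x powr (1-\<theta>)) \<in> pL M"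
    and "l2_norm M (cr (\<lambda>x. u x powr \<theta> * v x powr (1-\<theta>)))
          \<le> l2_norm M (cr u) powr \<theta> * l2_norm M (cr v) powr (1-\<theta>)"
proof -
  have eq: "(u x powr \<theta> * v x powr (1-\<theta>))\<^sup>2 = ((u x)\<^sup>2) powr \<theta> * ((v x)\<^sup>2) powr (1-\<theta>)" for x
    using pLD(2)[OF assms(3), of x] pLD(2)[OF assms(4), of x]
    by (simp add: power2_eq_square powr_mult)
  note H = Hoelder_integral[OF assms(1,2) pLD(3)[OF assms(3)] pLD(3)[OF assms(4)]]
  show "(\<lambda>x. u x powr \<theta> * v x powr (1-\<theta>)) \<in> pL M"
    using H(1) pLD(1)[OF assms(3)] pLD(1)[OF assms(4)] by (simp add: pL_def eq)
  have sq: "sqrt (a powr b) = sqrt a powr b" if "0 \<le> a" for a b :: real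
    using that by (simp add: powr_half_sqrt[symmetric] powr_powr mult.commute)
  have "l2_norm M (cr (\<lambda>x. u x powr \<theta> * v x powr (1-\<theta>)))
      \<le> sqrt ((\<integral>x. (u x)\<^sup>2 \<partial>M) powr \<theta> * (\<integral>x. (v x)\<^sup>2 \<partial>M) powr (1-\<theta>))"
    unfolding l2_norm_cr eq by (rule real_sqrt_le_mono[OF H(2)]) auto
  then show "l2_norm M (cr (\<lambda>x. u x powr \<theta> * v x powr (1-\<theta>)))
          \<le> l2_norm M (cr u) powr \<theta> * l2_norm M (cr v) powr (1-\<theta>)"
    by (simp add: l2_norm_cr real_sqrt_mult sq)
qed

section \<open>Bounded operators\<close>

lemma linear_opD:
  assumes "linear_op M A" "f \<in> L2 M"
  shows "A f \<in> L2 M"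
    and "g \<in> L2 M \<Longrightarrow> AE x in M. f x = g x \<Longrightarrow> AE x in M. A f x = A g x"
    and "g \<in> L2 M \<Longrightarrow> AE x in M. A (\<lambda>t. f t + g t) x = A f x + A g x"
    and "AE x in M. A (\<lambda>t. c * f t) x = c * A f x"
  using assms unfolding linear_op_def by blast+

lemma linear_op_diff:
  assumes "linear_op M A" "f \<in> L2 M" "g \<in> L2 M"
  shows "AE x in M. A (\<lambda>t. f t - g t) x = A f x - A g x"
proof -
  have "AE x in M. A (\<lambda>t. f t + -1 * g t) x = A f x + A (\<lambda>t. -1 * g t) x"
    by (rule linear_opD(3)[OF assms(1,2) L2_scale[OF assms(3)]])
  moreover have "AE x in M. A (\<lambda>t. -1 * g t) x = -1 * A g x"
    by (rule linear_opD(4)[OF assms(1,3)])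
  ultimately show ?thesis by eventually_elim simp
qed

lemma bounded_op_linear: "bounded_op M A \<Longrightarrow> linear_op M A"
  by (simp add: bounded_op_def)

lemma bounded_op_L2: "bounded_op M A \<Longrightarrow> f \<in> L2 M \<Longrightarrow> A f \<in> L2 M"
  by (rule linear_opD(1)[OF bounded_op_linear])

lemma bounded_op_cong:
  assumes "bounded_op M A" "f \<in> L2 M" "g \<in> L2 M" "AE x in M. f x = g x"
  shows "AE x in M. A f x = A g x"
  by (rule linear_opD(2)[OF bounded_op_linear]) (use assms in auto)

lemma sup0_upper: "bdd_above S \<Longrightarrow> x \<in> S \<Longrightarrow> x \<le> sup0 S"
  unfolding sup0_def by (auto intro: cSup_upper)

lemma sup0_nonneg: "bdd_above S \<Longrightarrow> 0 \<le> sup0 S"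
  unfolding sup0_def by (auto intro: cSup_upper)

lemma sup0_least: "0 \<le> c \<Longrightarrow> (\<And>x. x \<in> S \<Longrightarrow> x \<le> c) \<Longrightarrow> sup0 S \<le> c"
  unfolding sup0_def by (rule cSup_least) auto

lemma bounded_op_ball_bdd:
  assumes "bounded_op M A"
  shows "bdd_above {l2_norm M (A f) | f. f \<in> l2_ball M}"
proof -
  obtain C where C: "\<And>f. f \<in> L2 M \<Longrightarrow> l2_norm M (A f) \<le> C * l2_norm M f"
    using assms unfolding bounded_op_def by blast
  have "l2_norm M (A f) \<le> \<bar>C\<bar>" if "f \<in> l2_ball M" for f
  proof -
    have f: "f \<in> L2 M" "l2_norm M f \<le> 1" using that by (auto simp: l2_ball_def)
    have "l2_norm M (A f) \<le> C * l2_norm M f" by (rule C[OF f(1)])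
    also have "\<dots> \<le> \<bar>C\<bar> * l2_norm M f" by (intro mult_right_mono) auto
    also have "\<dots> \<le> \<bar>C\<bar> * 1" using f by (intro mult_left_mono) auto
    finally show ?thesis by simp
  qed
  then show ?thesis by (intro bdd_aboveI[of _ "\<bar>C\<bar>"]) auto
qed

lemma op_norm_nonneg: "bounded_op M A \<Longrightarrow> 0 \<le> op_norm M A"
  unfolding op_norm_def by (rule sup0_nonneg[OF bounded_op_ball_bdd])

lemma op_norm_least:
  assumes "0 \<le> C" "\<And>f. f \<in> L2 M \<Longrightarrow> l2_norm M (A f) \<le> C * l2_norm M f"
  shows "op_norm M A \<le> C"
  unfolding op_norm_def
proof (rule sup0_least[OF assms(1)])
  fix x assume "x \<in> {l2_norm M (A f) | f. f \<in> l2_ball M}"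
  then obtain f where f: "f \<in> L2 M" "l2_norm M f \<le> 1" "x = l2_norm M (A f)"
    by (auto simp: l2_ball_def)
  then show "x \<le> C" using assms(2)[OF f(1)] mult_left_mono[OF f(2) assms(1)] by simp
qed

lemma l2_norm_apply_le:
  assumes "bounded_op M A" "f \<in> L2 M"
  shows "l2_norm M (A f) \<le> op_norm M A * l2_norm M f"
proof (cases "l2_norm M f = 0")
  case True
  \<comment> \<open>Normalising \<open>f\<close> is impossible here, but any bound from the
    definition of boundedness gives \<open>C * 0\<close>.\<close>
  obtain C where "\<And>f. f \<in> L2 M \<Longrightarrow> l2_norm M (A f) \<le> C * l2_norm M f"
    using assms(1) unfolding bounded_op_def by blast
  from this[OF assms(2)] True show ?thesis by simp
next
  case False
  define n where "n = l2_norm M f"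
  have n: "n > 0" using False l2_norm_nonneg[of M f] unfolding n_def by linarith
  define h where "h = (\<lambda>x. complex_of_real (1/n) * f x)"
  have hL: "h \<in> L2 M" unfolding h_def by (rule L2_scale[OF assms(2)])
  have hn: "l2_norm M h = 1" unfolding h_def l2_norm_scale using n by (simp add: n_def norm_divide)
  have "l2_norm M (A h) \<le> op_norm M A"
    unfolding op_norm_def
    by (rule sup0_upper[OF bounded_op_ball_bdd[OF assms(1)]]) (use hL hn in \<open>auto simp: l2_ball_def\<close>)
  moreover have "l2_norm M (A h) = l2_norm M (\<lambda>x. complex_of_real (1/n) * A f x)"
    by (rule l2_norm_cong_AE)
      (use linear_opD(4)[OF bounded_op_linear[OF assms(1)] assms(2), of "complex_of_real (1/n)"]
        L2D(1)[OF bounded_op_L2[OF assms(1) assms(2)]] L2D(1)[OF bounded_op_L2[OF assms(1) hL]] in \<open>auto simp: h_def\<close>)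
  ultimately have "l2_norm M (A f) / n \<le> op_norm M A"
    unfolding l2_norm_scale using n by (simp add: norm_divide)
  then show ?thesis using n by (simp add: n_def field_simps)
qed

lemma linear_op_comp:
  assumes "linear_op M A" "linear_op M B"
  shows "linear_op M (A \<circ> B)"
  unfolding linear_op_def
proof (intro conjI ballI allI impI)
  fix f g assume f: "f \<in> L2 M" and g: "g \<in> L2 M"
  note [simp, intro!] = linear_opD(1)[OF assms(1)] linear_opD(1)[OF assms(2)]
  show "(A \<circ> B) f \<in> L2 M" using f by simp
  show "AE x in M. (A \<circ> B) f x = (A \<circ> B) g x" if "AE x in M. f x = g x"
    using linear_opD(2)[OF assms(1), of "B f" "B g"] linear_opD(2)[OF assms(2) f g that] f g by simp
  show "AE x in M. (A \<circ> B) (\<lambda>t. f t + g t) x = (A \<circ> B) f x + (A \<circ> B) g x"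
  proof -
    have "AE x in M. A (B (\<lambda>t. f t + g t)) x = A (\<lambda>t. B f t + B g t) x"
      by (rule linear_opD(2)[OF assms(1)]) (use f g linear_opD(3)[OF assms(2) f g] in \<open>auto intro!: L2_add\<close>)
    moreover have "AE x in M. A (\<lambda>t. B f t + B g t) x = A (B f) x + A (B g) x"
      by (rule linear_opD(3)[OF assms(1)]) (use f g in auto)
    ultimately show ?thesis by eventually_elim simp
  qed
next
  fix c f assume f: "f \<in> L2 M"
  note [simp, intro!] = linear_opD(1)[OF assms(1)] linear_opD(1)[OF assms(2)]
  have "AE x in M. A (B (\<lambda>t. c * f t)) x = A (\<lambda>t. c * B f t) x"
    by (rule linear_opD(2)[OF assms(1)]) (use f linear_opD(4)[OF assms(2) f] in \<open>auto intro!: L2_scale\<close>)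
  moreover have "AE x in M. A (\<lambda>t. c * B f t) x = c * A (B f) x"
    by (rule linear_opD(4)[OF assms(1)]) (use f in auto)
  ultimately show "AE x in M. (A \<circ> B) (\<lambda>t. c * f t) x = c * (A \<circ> B) f x"
    by eventually_elim simp
qed

lemma bounded_op_comp_norm:
  assumes "bounded_op M A" "bounded_op M B" "f \<in> L2 M"
  shows "l2_norm M ((A \<circ> B) f) \<le> op_norm M A * op_norm M B * l2_norm M f"
proof -
  have "l2_norm M (A (B f)) \<le> op_norm M A * l2_norm M (B f)"
    by (rule l2_norm_apply_le[OF assms(1) bounded_op_L2[OF assms(2,3)]])
  also have "\<dots> \<le> op_norm M A * (op_norm M B * l2_norm M f)"
    by (intro mult_left_mono l2_norm_apply_le op_norm_nonneg assms)
  finally show ?thesis by (simp add: mult.assoc)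
qed

lemma bounded_op_comp:
  assumes "bounded_op M A" "bounded_op M B"
  shows "bounded_op M (A \<circ> B)"
  using linear_op_comp bounded_op_comp_norm[OF assms] assms unfolding bounded_op_def by blast

lemma op_norm_comp:
  assumes "bounded_op M A" "bounded_op M B"
  shows "op_norm M (A \<circ> B) \<le> op_norm M A * op_norm M B"
  by (rule op_norm_least[OF mult_nonneg_nonneg[OF op_norm_nonneg op_norm_nonneg] bounded_op_comp_norm])
    (use assms in auto)

lemma bounded_op_id: "bounded_op M id"
  unfolding bounded_op_def linear_op_def by (auto intro!: exI[of _ 1])

lemma bounded_op_funpow: "bounded_op M A \<Longrightarrow> bounded_op M (A ^^ j)"
  by (induction j) (auto intro: bounded_op_comp bounded_op_id)

lemma adjoint_ofD:
  assumes "adjoint_of M A B"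
  shows "bounded_op M B" "f \<in> L2 M \<Longrightarrow> g \<in> L2 M \<Longrightarrow> l2_inner M (A f) g = l2_inner M f (B g)"
  using assms by (auto simp: adjoint_of_def)

lemma adjoint_of_sym:
  assumes "bounded_op M A" "adjoint_of M A B"
  shows "adjoint_of M B A"
  unfolding adjoint_of_def
proof (intro conjI ballI assms(1))
  fix f g assume f: "f \<in> L2 M" and g: "g \<in> L2 M"
  have "l2_inner M (B f) g = cnj (l2_inner M g (B f))" by (rule l2_inner_cnj)
  also have "\<dots> = cnj (l2_inner M (A g) f)" using adjoint_ofD(2)[OF assms(2) g f] by simp
  also have "\<dots> = l2_inner M f (A g)" by (rule l2_inner_cnj[symmetric])
  finally show "l2_inner M (B f) g = l2_inner M f (A g)" .
qed

lemma adjoint_of_comp: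
  assumes "adjoint_of M A A'" "adjoint_of M B B'" "bounded_op M B"
  shows "adjoint_of M (A \<circ> B) (B' \<circ> A')"
  using assms bounded_op_comp[of M B' A'] bounded_op_L2[of M] adjoint_ofD[OF assms(1)] adjoint_ofD[OF assms(2)]
  by (auto simp: adjoint_of_def)

text \<open>The square of the norm of \<open>B g\<close> is the inner product of
  \<open>A (B g)\<close> and \<open>g\<close>, hence at most the norm of \<open>A\<close> times the
  norms of \<open>B g\<close> and \<open>g\<close>; one factor is then cancelled.\<close>

lemma op_norm_adjoint_le:
  assumes "bounded_op M A" "adjoint_of M A B"
  shows "op_norm M B \<le> op_norm M A"
proof (rule op_norm_least[OF op_norm_nonneg[OF assms(1)]])
  fix g assume g: "g \<in> L2 M"
  have Bg: "B g \<in> L2 M" by (rule bounded_op_L2[OF adjoint_ofD(1)[OF assms(2)] g])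
  have "(l2_norm M (B g))\<^sup>2 = cmod (l2_inner M (B g) (B g))"
    by (simp add: l2_inner_self norm_power)
  also have "\<dots> = cmod (l2_inner M (A (B g)) g)"
    using adjoint_ofD(2)[OF assms(2) Bg g] by simp
  also have "\<dots> \<le> l2_norm M (A (B g)) * l2_norm M g"
    by (rule l2_inner_le(3)[OF bounded_op_L2[OF assms(1) Bg] g])
  also have "\<dots> \<le> op_norm M A * l2_norm M (B g) * l2_norm M g"
    by (intro mult_right_mono l2_norm_apply_le assms Bg) auto
  finally have "l2_norm M (B g) * l2_norm M (B g) \<le> l2_norm M (B g) * (op_norm M A * l2_norm M g)"
    by (simp add: power2_eq_square mult_ac)
  then show "l2_norm M (B g) \<le> op_norm M A * l2_norm M g"
    using mult_le_cancel_left_pos[of "l2_norm M (B g)"] mult_nonneg_nonneg[OF op_norm_nonneg[OF assms(1)] l2_norm_nonneg[of M g]]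
    by (cases "l2_norm M (B g) = 0") (simp_all add: order_less_le)
qed

lemma op_norm_adjoint:
  assumes "bounded_op M A" "adjoint_of M A B"
  shows "op_norm M B = op_norm M A"
  by (rule antisym[OF op_norm_adjoint_le[OF assms]
        op_norm_adjoint_le[OF adjoint_ofD(1)[OF assms(2)] adjoint_of_sym[OF assms]]])

text \<open>Tested against the difference \<open>?h\<close> itself. Since \<open>adj\<close> is
  picked by \<open>SOME\<close>, this is what transfers the kernel of one concrete adjoint to the
  chosen one.\<close>

lemma adjoint_of_unique:
  assumes "bounded_op M A" "adjoint_of M A B" "adjoint_of M A C" "g \<in> L2 M"
  shows "AE x in M. B g x = C g x"
proof -
  have BC: "B g \<in> L2 M" "C g \<in> L2 M"
    using adjoint_ofD(1)[OF assms(2)] adjoint_ofD(1)[OF assms(3)] assms(4) bounded_op_L2 by auto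
  let ?h = "\<lambda>x. B g x - C g x"
  have h: "?h \<in> L2 M" by (rule L2_diff[OF BC])
  have "l2_inner M (B g) ?h = l2_inner M (C g) ?h"
    using adjoint_ofD(2)[OF assms(2) h assms(4)] adjoint_ofD(2)[OF assms(3) h assms(4)]
    unfolding l2_inner_cnj[of M "B g" ?h] l2_inner_cnj[of M "C g" ?h] by simp
  then have "l2_inner M ?h ?h = 0" using l2_inner_diff_left[OF BC h] by simp
  then have "l2_norm M ?h = 0" unfolding l2_inner_self by simp
  from l2_norm_eq_0[OF h this] show ?thesis by simp
qed

section \<open>The Hausdorff measure of non-compactness\<close>

lemma hausdorff_mnc_bdd_below: "bdd_below {\<delta>. \<delta> > 0 \<and>
     (\<exists>F. finite F \<and> F \<subseteq> L2 M \<and>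
        (\<forall>f\<in>l2_ball M. \<exists>g\<in>F. \<exists>h\<in>l2_ball M. AE x in M. A f x = g x + complex_of_real \<delta> * h x))}"
  by (rule bdd_belowI[of _ 0]) auto

text \<open>Dividing the error by \<delta> turns the usual net condition into the decomposition
  \<open>g + \<delta> h\<close> with \<open>h\<close> in the ball, as the definition
  demands.\<close>

lemma hausdorff_mnc_le:
  assumes "\<delta> > 0" "finite F" "F \<subseteq> L2 M" "\<And>f. f \<in> l2_ball M \<Longrightarrow> A f \<in> L2 M"
    and net: "\<And>f. f \<in> l2_ball M \<Longrightarrow> \<exists>g\<in>F. l2_norm M (\<lambda>x. A f x - g x) \<le> \<delta>"
  shows "hausdorff_mnc M A \<le> \<delta>"
  unfolding hausdorff_mnc_def
proof (rule cInf_lower[OF _ hausdorff_mnc_bdd_below], intro CollectI conjI assms(1) exI[of _ F] assms(2,3) ballI)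
  fix f assume f: "f \<in> l2_ball M"
  obtain g where g: "g \<in> F" "l2_norm M (\<lambda>x. A f x - g x) \<le> \<delta>" using net[OF f] by blast
  let ?h = "\<lambda>x. complex_of_real (1/\<delta>) * (A f x - g x)"
  have "?h \<in> l2_ball M"
    using L2_scale[OF L2_diff[OF assms(4)[OF f]], of g "complex_of_real (1/\<delta>)"] g assms(1,3)
    unfolding l2_ball_def by (simp add: l2_norm_scale norm_divide subset_eq del: of_real_divide of_real_1)
  moreover have "AE x in M. A f x = g x + complex_of_real \<delta> * ?h x" using assms(1) by simp
  ultimately show "\<exists>g\<in>F. \<exists>h\<in>l2_ball M. AE x in M. A f x = g x + complex_of_real \<delta> * h x"
    by (intro bexI[of _ g] bexI[of _ ?h] g(1))
qed

text \<open>The single point 0 is a net. Besides the bound by the norm this shows that the infimum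
  is taken over a nonempty set, without which its value would be meaningless.\<close>

lemma hausdorff_mnc_net_norm:
  assumes "bounded_op M A" "op_norm M A < \<delta>"
  shows "\<delta> \<in> {\<delta>. \<delta> > 0 \<and>
     (\<exists>F. finite F \<and> F \<subseteq> L2 M \<and>
        (\<forall>f\<in>l2_ball M. \<exists>g\<in>F. \<exists>h\<in>l2_ball M. AE x in M. A f x = g x + complex_of_real \<delta> * h x))}"
proof -
  have d: "\<delta> > 0" using assms op_norm_nonneg[OF assms(1)] by simp
  have "\<exists>h\<in>l2_ball M. AE x in M. A f x = 0 + complex_of_real \<delta> * h x" if f: "f \<in> l2_ball M" for f
  proof
    let ?h = "\<lambda>x. complex_of_real (1/\<delta>) * A f x"
    have fL: "f \<in> L2 M" "l2_norm M f \<le> 1" using f by (auto simp: l2_ball_def)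
    have "l2_norm M (A f) \<le> op_norm M A * 1"
      using l2_norm_apply_le[OF assms(1) fL(1)] mult_left_mono[OF fL(2) op_norm_nonneg[OF assms(1)]] by simp
    then have "l2_norm M (A f) \<le> \<delta>" using assms(2) by simp
    then show "?h \<in> l2_ball M"
      using L2_scale[OF bounded_op_L2[OF assms(1) fL(1)], of "complex_of_real (1/\<delta>)"] d
      unfolding l2_ball_def mem_Collect_eq l2_norm_scale by (simp add: norm_divide)
    show "AE x in M. A f x = 0 + complex_of_real \<delta> * ?h x" using d by simp
  qed
  then show ?thesis using d by (intro CollectI conjI exI[of _ "{\<lambda>x. 0}"]) simp_all
qed

lemma hausdorff_mnc_net:
  assumes "bounded_op M A" "hausdorff_mnc M A < \<delta>"
  obtains F where "finite F" "F \<subseteq> L2 M"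
    "\<And>f. f \<in> l2_ball M \<Longrightarrow> \<exists>g\<in>F. l2_norm M (\<lambda>x. A f x - g x) \<le> \<delta>"
proof -
  let ?S = "{\<delta>. \<delta> > 0 \<and>
     (\<exists>F. finite F \<and> F \<subseteq> L2 M \<and>
        (\<forall>f\<in>l2_ball M. \<exists>g\<in>F. \<exists>h\<in>l2_ball M. AE x in M. A f x = g x + complex_of_real \<delta> * h x))}"
  have "?S \<noteq> {}" using hausdorff_mnc_net_norm[OF assms(1) less_add_one] by blast
  then obtain d where d: "d \<in> ?S" "d < \<delta>"
    using assms(2) unfolding hausdorff_mnc_def by (meson cInf_lessD)
  then obtain F where F: "finite F" "F \<subseteq> L2 M"
    "\<And>f. f \<in> l2_ball M \<Longrightarrow> \<exists>g\<in>F. \<exists>h\<in>l2_ball M. AE x in M. A f x = g x + complex_of_real d * h x"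
    by blast
  have "\<exists>g\<in>F. l2_norm M (\<lambda>x. A f x - g x) \<le> \<delta>" if f: "f \<in> l2_ball M" for f
  proof -
    obtain g h where g: "g \<in> F" and h: "h \<in> l2_ball M"
      and ae: "AE x in M. A f x = g x + complex_of_real d * h x"
      using F(3)[OF f] by blast
    have L: "A f \<in> L2 M" "g \<in> L2 M" "h \<in> L2 M"
      using f g h F(2) bounded_op_L2[OF assms(1)] by (auto simp: l2_ball_def)
    have "l2_norm M (\<lambda>x. A f x - g x) = l2_norm M (\<lambda>x. complex_of_real d * h x)"
      by (rule l2_norm_cong_AE) (use ae L2D(1)[OF L(1)] L2D(1)[OF L(2)] L2D(1)[OF L(3)] in auto)
    also have "\<dots> \<le> d * 1" unfolding l2_norm_scale using d h by (auto simp: l2_ball_def intro!: mult_left_mono)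
    finally show ?thesis using g d(2) by (intro bexI[of _ g]) auto
  qed
  with F(1,2) show ?thesis by (rule that)
qed

lemma hausdorff_mnc_nonneg:
  assumes "bounded_op M A"
  shows "0 \<le> hausdorff_mnc M A"
  unfolding hausdorff_mnc_def
  using hausdorff_mnc_net_norm[OF assms less_add_one] by (intro cInf_greatest) (blast, simp)

lemma hausdorff_mnc_le_norm:
  assumes "bounded_op M A"
  shows "hausdorff_mnc M A \<le> op_norm M A"
proof (rule field_le_epsilon)
  fix e :: real assume "e > 0"
  then show "hausdorff_mnc M A \<le> op_norm M A + e"
    unfolding hausdorff_mnc_def
    by (intro cInf_lower[OF _ hausdorff_mnc_bdd_below] hausdorff_mnc_net_norm[OF assms]) auto
qed

lemma le_mult_epsilon:
  fixes a b x :: real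
  assumes "\<And>e. e > 0 \<Longrightarrow> x \<le> (a + e) * (b + e)"
  shows "x \<le> a * b"
proof (rule tendsto_lowerbound)
  show "((\<lambda>e. (a + e) * (b + e)) \<longlongrightarrow> a * b) (at_right 0)"
    by (auto intro!: tendsto_eq_intros)
  show "\<forall>\<^sub>F e in at_right 0. x \<le> (a + e) * (b + e)"
    using assms by (auto simp: eventually_at_right_field intro: exI[of _ 1])
qed simp

text \<open>A net \<open>G\<close> for \<open>B\<close> leaves errors of the form \<open>b h\<close>
  with \<open>h\<close> in the ball; \<open>A h\<close> is then approximated by a net
  \<open>F\<close> for \<open>A\<close>. The points \<open>A g + b k\<close> form a net of radius
  \<open>a b\<close>. The infima need not be attained, hence the \<epsilon> in both radii.\<close>

lemma hausdorff_mnc_comp: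
  assumes A: "bounded_op M A" and B: "bounded_op M B"
  shows "hausdorff_mnc M (A \<circ> B) \<le> hausdorff_mnc M A * hausdorff_mnc M B"
proof (rule le_mult_epsilon)
  fix e :: real assume e: "e > 0"
  define a where "a = hausdorff_mnc M A + e"
  define b where "b = hausdorff_mnc M B + e"
  have ab: "a > 0" "b > 0"
    using e hausdorff_mnc_nonneg[OF A] hausdorff_mnc_nonneg[OF B] by (auto simp: a_def b_def)
  obtain F where F: "finite F" "F \<subseteq> L2 M"
    "\<And>f. f \<in> l2_ball M \<Longrightarrow> \<exists>g\<in>F. l2_norm M (\<lambda>x. A f x - g x) \<le> a"
    by (rule hausdorff_mnc_net[OF A, of a]) (use e in \<open>auto simp: a_def\<close>)
  obtain G where G: "finite G" "G \<subseteq> L2 M"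
    "\<And>f. f \<in> l2_ball M \<Longrightarrow> \<exists>g\<in>G. l2_norm M (\<lambda>x. B f x - g x) \<le> b"
    by (rule hausdorff_mnc_net[OF B, of b]) (use e in \<open>auto simp: b_def\<close>)
  define N where "N = (\<lambda>(g, k). (\<lambda>x. A g x + complex_of_real b * k x)) ` (G \<times> F)"
  show "hausdorff_mnc M (A \<circ> B) \<le> a * b"
  proof (rule hausdorff_mnc_le[of _ N])
    show "0 < a * b" using ab by simp
    show "finite N" unfolding N_def using F G by auto
    show "N \<subseteq> L2 M" unfolding N_def using F G bounded_op_L2[OF A] by (auto intro!: L2_add L2_scale)
    fix f assume f: "f \<in> l2_ball M"
    then have fL: "f \<in> L2 M" by (simp add: l2_ball_def)
    have Bf: "B f \<in> L2 M" by (rule bounded_op_L2[OF B fL])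
    show "(A \<circ> B) f \<in> L2 M" using bounded_op_L2[OF A Bf] by simp
    obtain g where g: "g \<in> G" "l2_norm M (\<lambda>x. B f x - g x) \<le> b" using G(3)[OF f] by blast
    have gL: "g \<in> L2 M" using g G by auto
    define h where "h = (\<lambda>x. complex_of_real (1/b) * (B f x - g x))"
    have hL: "h \<in> L2 M" unfolding h_def by (intro L2_scale L2_diff Bf gL)
    have h: "h \<in> l2_ball M"
      using g(2) ab hL unfolding l2_ball_def h_def mem_Collect_eq l2_norm_scale by (simp add: norm_divide)
    obtain k where k: "k \<in> F" "l2_norm M (\<lambda>x. A h x - k x) \<le> a" using F(3)[OF h] by blast
    have kL: "k \<in> L2 M" using k F by auto
    have Bf_eq: "B f = (\<lambda>x. g x + complex_of_real b * h x)"
      using ab by (auto simp: h_def fun_eq_iff)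
    note lA = bounded_op_linear[OF A]
    have "AE x in M. A (B f) x = A g x + A (\<lambda>x. complex_of_real b * h x) x"
      unfolding Bf_eq by (rule linear_opD(3)[OF lA gL L2_scale[OF hL]])
    moreover have "AE x in M. A (\<lambda>x. complex_of_real b * h x) x = complex_of_real b * A h x"
      by (rule linear_opD(4)[OF lA hL])
    ultimately have ae: "AE x in M. A (B f) x - (A g x + complex_of_real b * k x)
        = complex_of_real b * (A h x - k x)"
      by eventually_elim (simp add: algebra_simps)
    have "l2_norm M (\<lambda>x. A (B f) x - (A g x + complex_of_real b * k x))
      = l2_norm M (\<lambda>x. complex_of_real b * (A h x - k x))"
      using L2D(1)[OF bounded_op_L2[OF A Bf]] L2D(1)[OF bounded_op_L2[OF A gL]]
        L2D(1)[OF bounded_op_L2[OF A hL]] L2D(1)[OF kL]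
      by (intro l2_norm_cong_AE ae) auto
    also have "\<dots> \<le> a * b" unfolding l2_norm_scale using ab k by (simp add: mult.commute)
    finally show "\<exists>n\<in>N. l2_norm M (\<lambda>x. (A \<circ> B) f x - n x) \<le> a * b"
      unfolding N_def using g(1) k(1)
      by (intro bexI[of _ "\<lambda>x. A g x + complex_of_real b * k x"] image_eqI[of _ _ "(g, k)"]) auto
  qed
qed

section \<open>Positive operators and domination by a geometric mean\<close>

text \<open>
  For a positive operator, \<open>absop T u\<close> is the real-valued version of \<open>T u\<close>; the modulus is only
  taken to stay in the reals.
\<close>

definition absop :: "'a l2op \<Rightarrow> ('a \<Rightarrow> real) \<Rightarrow> 'a \<Rightarrow> real" where
  "absop T u = (\<lambda>x. cmod (T (cr u) x))"

text \<open>Positivity is recorded as domination of complex-valued functions, because all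
  functionals test complex \<open>f\<close>. The clause on \<open>pL\<close> says that images of
  nonnegative functions are a.e. real and nonnegative.\<close>

definition pos_op :: "'a measure \<Rightarrow> 'a l2op \<Rightarrow> bool" where
  "pos_op M T \<longleftrightarrow> bounded_op M T \<and>
     (\<forall>u\<in>pL M. AE x in M. T (cr u) x = complex_of_real (absop T u x)) \<and>
     (\<forall>f\<in>L2 M. \<forall>u\<in>pL M. (AE x in M. cmod (f x) \<le> u x) \<longrightarrow> (AE x in M. cmod (T f x) \<le> absop T u x))"

lemma pos_opD:
  assumes "pos_op M T"
  shows "bounded_op M T"
    and "u \<in> pL M \<Longrightarrow> AE x in M. T (cr u) x = complex_of_real (absop T u x)"
    and "f \<in> L2 M \<Longrightarrow> u \<in> pL M \<Longrightarrow> AE x in M. cmod (f x) \<le> u x \<Longrightarrow> AE x in M. cmod (T f x) \<le> absop T u x"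
proof -
  note * = assms[unfolded pos_op_def]
  show "bounded_op M T" using * by (rule conjunct1)
  show "u \<in> pL M \<Longrightarrow> AE x in M. T (cr u) x = complex_of_real (absop T u x)"
    using *[THEN conjunct2, THEN conjunct1, THEN bspec, of u] .
  show "f \<in> L2 M \<Longrightarrow> u \<in> pL M \<Longrightarrow> AE x in M. cmod (f x) \<le> u x \<Longrightarrow> AE x in M. cmod (T f x) \<le> absop T u x"
    using *[THEN conjunct2, THEN conjunct2, THEN bspec, of f, THEN bspec, of u, THEN mp] .
qed

lemma absop_pL: "pos_op M T \<Longrightarrow> u \<in> pL M \<Longrightarrow> absop T u \<in> pL M"
  unfolding absop_def by (rule cmod_pL[OF bounded_op_L2[OF pos_opD(1) cr_L2]])

lemma absop_nonneg [simp]: "0 \<le> absop T u x"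
  by (simp add: absop_def)

lemma l2_norm_absop: "l2_norm M (cr (absop T u)) = l2_norm M (T (cr u))"
  by (simp add: absop_def l2_norm_cmod)

lemma absop_mono:
  assumes "pos_op M T" "u \<in> pL M" "v \<in> pL M" "AE x in M. u x \<le> v x"
  shows "AE x in M. absop T u x \<le> absop T v x"
  using pos_opD(3)[OF assms(1) cr_L2[OF assms(2)] assms(3)] assms(4) pLD(2)[OF assms(2)]
  by (simp add: absop_def)

lemma absop_comp:
  assumes "pos_op M A" "pos_op M B" "u \<in> pL M"
  shows "AE x in M. absop (A \<circ> B) u x = absop A (absop B u) x"
    and "AE x in M. (A \<circ> B) (cr u) x = complex_of_real (absop A (absop B u) x)"
proof -
  note b = pos_opD(1)[OF assms(1)] pos_opD(1)[OF assms(2)]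
  note p = absop_pL[OF assms(2,3)]
  have "AE x in M. A (B (cr u)) x = A (cr (absop B u)) x"
    by (rule bounded_op_cong[OF b(1)])
      (use bounded_op_L2[OF b(2)] cr_L2 p assms(3) pos_opD(2)[OF assms(2,3)] in auto)
  with pos_opD(2)[OF assms(1) p]
  show *: "AE x in M. (A \<circ> B) (cr u) x = complex_of_real (absop A (absop B u) x)"
    by eventually_elim simp
  then show "AE x in M. absop (A \<circ> B) u x = absop A (absop B u) x"
    by eventually_elim (simp add: absop_def)
qed

lemma pos_op_comp:
  assumes "pos_op M A" "pos_op M B"
  shows "pos_op M (A \<circ> B)"
  unfolding pos_op_def
proof (intro conjI ballI impI)
  note b = pos_opD(1)[OF assms(1)] pos_opD(1)[OF assms(2)]
  show "bounded_op M (A \<circ> B)" by (rule bounded_op_comp[OF b])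
  show "AE x in M. (A \<circ> B) (cr u) x = complex_of_real (absop (A \<circ> B) u x)" if "u \<in> pL M" for u
    using absop_comp[OF assms that] by eventually_elim simp
  fix f u assume f: "f \<in> L2 M" and u: "u \<in> pL M" and le: "AE x in M. cmod (f x) \<le> u x"
  have "AE x in M. cmod (A (B f) x) \<le> absop A (absop B u) x"
    by (rule pos_opD(3)[OF assms(1) bounded_op_L2[OF b(2) f] absop_pL[OF assms(2) u]
          pos_opD(3)[OF assms(2) f u le]])
  with absop_comp(1)[OF assms u] show "AE x in M. cmod ((A \<circ> B) f x) \<le> absop (A \<circ> B) u x"
    by eventually_elim simp
qed

lemma pos_op_id: "pos_op M id"
  unfolding pos_op_def absop_def using bounded_op_id by (auto simp: pLD(2))

lemma pos_op_funpow: "pos_op M A \<Longrightarrow> pos_op M (A ^^ j)"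
  by (induction j) (auto intro: pos_op_comp pos_op_id)

lemma pos_op_cmod_le:
  assumes "pos_op M T" "f \<in> L2 M"
  shows "AE x in M. cmod (T f x) \<le> absop T (\<lambda>x. cmod (f x)) x"
  by (rule pos_opD(3)[OF assms cmod_pL[OF assms(2)]]) simp

definition mdom :: "'a measure \<Rightarrow> real \<Rightarrow> 'a l2op \<Rightarrow> 'a l2op \<Rightarrow> 'a l2op \<Rightarrow> bool" where
  "mdom M \<theta> T E G \<longleftrightarrow> (\<forall>u\<in>pL M. \<forall>v\<in>pL M. AE x in M.
     absop T (\<lambda>x. u x powr \<theta> * v x powr (1-\<theta>)) x \<le> absop E u x powr \<theta> * absop G v x powr (1-\<theta>))"

lemma mdomD:
  "mdom M \<theta> T E G \<Longrightarrow> u \<in> pL M \<Longrightarrow> v \<in> pL M \<Longrightarrow>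
     AE x in M. absop T (\<lambda>x. u x powr \<theta> * v x powr (1-\<theta>)) x \<le> absop E u x powr \<theta> * absop G v x powr (1-\<theta>)"
  by (simp add: mdom_def)

lemma mdom_id: "mdom M \<theta> id id id"
  by (auto simp: mdom_def absop_def pLD(2) norm_mult)

text \<open>The inequality for \<open>T2\<close> is pushed through \<open>T1\<close> by
  monotonicity, and the one for \<open>T1\<close> is then applied to the pair
  \<open>absop E2 u\<close>, \<open>absop G2 v\<close>. This pair is distinct even when
  \<open>u = v\<close>; hence the two independent functions in \<open>mdom\<close>.\<close>

lemma mdom_comp:
  assumes \<theta>: "0 < \<theta>" "\<theta> < 1"
    and T: "pos_op M T1" "pos_op M T2" and E: "pos_op M E1" "pos_op M E2"
    and G: "pos_op M G1" "pos_op M G2"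
    and d: "mdom M \<theta> T1 E1 G1" "mdom M \<theta> T2 E2 G2"
  shows "mdom M \<theta> (T1 \<circ> T2) (E1 \<circ> E2) (G1 \<circ> G2)"
  unfolding mdom_def
proof (intro ballI)
  fix u v assume u: "u \<in> pL M" and v: "v \<in> pL M"
  let ?m = "\<lambda>u v x. u x powr \<theta> * v x powr (1-\<theta>)"
  note m = pL_interpolate(1)[OF \<theta>]
  note EG = absop_pL[OF E(2) u] absop_pL[OF G(2) v]
  have "AE x in M. absop T1 (absop T2 (?m u v)) x \<le> absop T1 (?m (absop E2 u) (absop G2 v)) x"
    by (rule absop_mono[OF T(1)]) (use m u v EG absop_pL[OF T(2)] mdomD[OF d(2) u v] in auto)
  moreover have "AE x in M. absop T1 (?m (absop E2 u) (absop G2 v)) x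
      \<le> absop E1 (absop E2 u) x powr \<theta> * absop G1 (absop G2 v) x powr (1-\<theta>)"
    by (rule mdomD[OF d(1) EG])
  ultimately show "AE x in M. absop (T1 \<circ> T2) (?m u v) x
      \<le> absop (E1 \<circ> E2) u x powr \<theta> * absop (G1 \<circ> G2) v x powr (1-\<theta>)"
    using absop_comp(1)[OF T m[OF u v]] absop_comp(1)[OF E u] absop_comp(1)[OF G v]
    by eventually_elim simp
qed

lemma powr_split: "0 \<le> (a::real) \<Longrightarrow> a powr \<theta> * a powr (1-\<theta>) = a"
  by (simp add: powr_add[symmetric])

text \<open>Both functions are taken to be the modulus of \<open>f\<close>, whose weighted geometric
  mean with itself is again the modulus.\<close>

lemma mdom_cmod_le:
  assumes "mdom M \<theta> T E G" "pos_op M T" "f \<in> L2 M"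
  shows "AE x in M. cmod (T f x)
      \<le> absop E (\<lambda>x. cmod (f x)) x powr \<theta> * absop G (\<lambda>x. cmod (f x)) x powr (1-\<theta>)"
  using pos_op_cmod_le[OF assms(2,3)] mdomD[OF assms(1) cmod_pL[OF assms(3)] cmod_pL[OF assms(3)]]
  unfolding powr_split[OF norm_ge_zero] by eventually_elim simp

lemma mdom_l2_norm:
  assumes "0 < \<theta>" "\<theta> < 1" "mdom M \<theta> T E G" "pos_op M T" "pos_op M E" "pos_op M G" "f \<in> L2 M"
  shows "l2_norm M (T f) \<le> l2_norm M (E (cr (\<lambda>x. cmod (f x)))) powr \<theta> *
           l2_norm M (G (cr (\<lambda>x. cmod (f x)))) powr (1-\<theta>)"
proof -
  let ?u = "\<lambda>x. cmod (f x)"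
  note u = cmod_pL[OF assms(7)]
  note I = pL_interpolate[OF assms(1,2) absop_pL[OF assms(5) u] absop_pL[OF assms(6) u]]
  have "l2_norm M (T f) \<le> l2_norm M (cr (\<lambda>x. absop E ?u x powr \<theta> * absop G ?u x powr (1-\<theta>)))"
    by (rule L2_dominated(2)[OF I(1) L2D(1)[OF bounded_op_L2[OF pos_opD(1)]]])
      (use assms mdom_cmod_le[OF assms(3,4)] in auto)
  also note I(2)
  finally show ?thesis by (simp only: l2_norm_absop)
qed

lemma powr_mult_mono:
  fixes a b c d :: real
  assumes "0 \<le> a" "a \<le> b" "0 \<le> c" "c \<le> d" "0 < \<theta>" "\<theta> < 1"
  shows "a powr \<theta> * c powr (1-\<theta>) \<le> b powr \<theta> * d powr (1-\<theta>)"
  using assms by (intro mult_mono powr_mono2) auto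

lemma powr_mult_homogeneous:
  fixes a b n :: real
  assumes "0 \<le> a" "0 \<le> b" "0 \<le> n"
  shows "(a * n) powr \<theta> * (b * n) powr (1-\<theta>) = a powr \<theta> * b powr (1-\<theta>) * n"
proof -
  have "(a * n) powr \<theta> * (b * n) powr (1-\<theta>)
      = a powr \<theta> * b powr (1-\<theta>) * (n powr \<theta> * n powr (1-\<theta>))"
    using assms by (simp add: powr_mult mult_ac)
  then show ?thesis using powr_split[OF assms(3)] by simp
qed

lemma mdom_op_norm:
  assumes \<theta>: "0 < \<theta>" "\<theta> < 1" and "mdom M \<theta> T E G" "pos_op M T" "pos_op M E" "pos_op M G"
  shows "op_norm M T \<le> op_norm M E powr \<theta> * op_norm M G powr (1-\<theta>)"
proof (rule op_norm_least)
  fix f assume f: "f \<in> L2 M"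
  let ?u = "\<lambda>x. cmod (f x)"
  note b = pos_opD(1)[OF assms(5)] pos_opD(1)[OF assms(6)]
  have "l2_norm M (T f) \<le> l2_norm M (E (cr ?u)) powr \<theta> * l2_norm M (G (cr ?u)) powr (1-\<theta>)"
    by (rule mdom_l2_norm[OF assms f])
  also have "\<dots> \<le> (op_norm M E * l2_norm M f) powr \<theta> * (op_norm M G * l2_norm M f) powr (1-\<theta>)"
    using l2_norm_apply_le[OF b(1) cr_L2[OF cmod_pL[OF f]]] l2_norm_apply_le[OF b(2) cr_L2[OF cmod_pL[OF f]]]
    by (intro powr_mult_mono \<theta>) (auto simp: l2_norm_cmod)
  also have "\<dots> = op_norm M E powr \<theta> * op_norm M G powr (1-\<theta>) * l2_norm M f"
    by (rule powr_mult_homogeneous) (use op_norm_nonneg b in auto)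
  finally show "l2_norm M (T f) \<le> op_norm M E powr \<theta> * op_norm M G powr (1-\<theta>) * l2_norm M f" .
qed simp

lemma numerical_radius_bdd:
  assumes "bounded_op M A"
  shows "bdd_above {cmod (l2_inner M (A f) f) | f. f \<in> L2 M \<and> l2_norm M f = 1}"
proof (rule bdd_aboveI[of _ "op_norm M A"], safe)
  fix f assume f: "f \<in> L2 M" "l2_norm M f = 1"
  have "cmod (l2_inner M (A f) f) \<le> l2_norm M (A f) * l2_norm M f"
    by (rule l2_inner_le(3)[OF bounded_op_L2[OF assms f(1)] f(1)])
  also have "\<dots> \<le> op_norm M A" using l2_norm_apply_le[OF assms f(1)] f by simp
  finally show "cmod (l2_inner M (A f) f) \<le> op_norm M A" .
qed

lemma numerical_radius_nonneg: "bounded_op M A \<Longrightarrow> 0 \<le> numerical_radius M A"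
  unfolding numerical_radius_def by (rule sup0_nonneg[OF numerical_radius_bdd])

lemma numerical_radius_le_norm:
  assumes "bounded_op M A"
  shows "numerical_radius M A \<le> op_norm M A"
  unfolding numerical_radius_def
proof (rule sup0_least[OF op_norm_nonneg[OF assms]], safe)
  fix f assume f: "f \<in> L2 M" "l2_norm M f = 1"
  have "cmod (l2_inner M (A f) f) \<le> l2_norm M (A f) * l2_norm M f"
    by (rule l2_inner_le(3)[OF bounded_op_L2[OF assms f(1)] f(1)])
  also have "\<dots> \<le> op_norm M A" using l2_norm_apply_le[OF assms f(1)] f by simp
  finally show "cmod (l2_inner M (A f) f) \<le> op_norm M A" .
qed

lemma absop_inner:
  assumes "pos_op M T" "u \<in> pL M"
  shows "l2_inner M (T (cr u)) (cr u) = complex_of_real (\<integral>x. absop T u x * u x \<partial>M)"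
proof -
  have "l2_inner M (T (cr u)) (cr u) = l2_inner M (cr (absop T u)) (cr u)"
    by (rule l2_inner_cong_AE)
      (use L2D(1)[OF cr_L2[OF assms(2)]] L2D(1)[OF cr_L2[OF absop_pL[OF assms]]]
        L2D(1)[OF bounded_op_L2[OF pos_opD(1)[OF assms(1)] cr_L2[OF assms(2)]]]
        pos_opD(2)[OF assms] in auto)
  also have "\<dots> = (\<integral>x. complex_of_real (absop T u x * u x) \<partial>M)"
    by (simp add: l2_inner_def)
  finally show ?thesis by (simp only: integral_complex_of_real)
qed

text \<open>Hoelder's inequality for \<open>a x * u x\<close> and \<open>b x * u x\<close>: the
  factor \<open>u\<close> coming from the quadratic form is split as
  \<open>u powr \<theta> * u powr (1-\<theta>)\<close>. Nonnegativity identifies the two integrals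
  with values of the quadratic forms of \<open>E\<close> and \<open>G\<close>, and the form of
  \<open>G\<close> is the conjugate of that of \<open>D\<close>.\<close>

lemma mdom_numerical_radius:
  assumes \<theta>: "0 < \<theta>" "\<theta> < 1" and d: "mdom M \<theta> T E G"
    and T: "pos_op M T" and E: "pos_op M E" and G: "pos_op M G"
    and D: "bounded_op M D" "adjoint_of M D G"
  shows "numerical_radius M T \<le> numerical_radius M E powr \<theta> * numerical_radius M D powr (1-\<theta>)"
  unfolding numerical_radius_def[of M T]
proof (rule sup0_least, simp, safe)
  fix f assume f: "f \<in> L2 M" "l2_norm M f = 1"
  define u where "u = (\<lambda>x. cmod (f x))"
  have u: "u \<in> pL M" unfolding u_def by (rule cmod_pL[OF f(1)])
  have un: "l2_norm M (cr u) = 1" by (simp add: u_def l2_norm_cmod f)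
  define a where "a = absop E u"
  define b where "b = absop G u"
  have ab: "a \<in> pL M" "b \<in> pL M" unfolding a_def b_def using absop_pL E G u by auto
  have Tf: "T f \<in> L2 M" by (rule bounded_op_L2[OF pos_opD(1)[OF T] f(1)])
  note ia = pL_Cauchy_Schwarz(1)[OF ab(1) u] and ib = pL_Cauchy_Schwarz(1)[OF ab(2) u]
  have nn: "0 \<le> a x * u x" "0 \<le> b x * u x" for x
    using pLD(2)[OF ab(1)] pLD(2)[OF ab(2)] pLD(2)[OF u] by auto
  note H = Hoelder_integral[OF \<theta> ia ib nn]
  have "cmod (l2_inner M (T f) f) \<le> (\<integral>x. cmod (T f x) * cmod (f x) \<partial>M)"
    by (rule l2_inner_le(1)[OF Tf f(1)])
  also have "\<dots> \<le> (\<integral>x. (a x * u x) powr \<theta> * (b x * u x) powr (1-\<theta>) \<partial>M)"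
  proof (rule integral_mono_AE[OF L2_mult_integrable(3)[OF Tf f(1)] H(1)])
    show "AE x in M. cmod (T f x) * cmod (f x) \<le> (a x * u x) powr \<theta> * (b x * u x) powr (1-\<theta>)"
      using mdom_cmod_le[OF d T f(1)]
    proof eventually_elim
      case (elim x)
      have "cmod (T f x) * cmod (f x) \<le> a x powr \<theta> * b x powr (1-\<theta>) * u x"
        using elim unfolding a_def b_def u_def by (intro mult_right_mono) auto
      then show ?case
        using powr_mult_homogeneous[OF pLD(2)[OF ab(1), of x] pLD(2)[OF ab(2), of x] pLD(2)[OF u, of x]] by simp
    qed
  qed
  also have "\<dots> \<le> (\<integral>x. a x * u x \<partial>M) powr \<theta> * (\<integral>x. b x * u x \<partial>M) powr (1-\<theta>)"
    by (rule H(2))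
  also have "\<dots> \<le> numerical_radius M E powr \<theta> * numerical_radius M D powr (1-\<theta>)"
  proof (intro powr_mult_mono \<theta>)
    show "0 \<le> (\<integral>x. a x * u x \<partial>M)" "0 \<le> (\<integral>x. b x * u x \<partial>M)" using nn by auto
    have "(\<integral>x. a x * u x \<partial>M) = cmod (l2_inner M (E (cr u)) (cr u))"
      unfolding absop_inner[OF E u] using nn by (simp add: a_def)
    also have "\<dots> \<le> numerical_radius M E"
      unfolding numerical_radius_def
      by (rule sup0_upper[OF numerical_radius_bdd[OF pos_opD(1)[OF E]]]) (use cr_L2[OF u] un in auto)
    finally show "(\<integral>x. a x * u x \<partial>M) \<le> numerical_radius M E" .
    have "(\<integral>x. b x * u x \<partial>M) = cmod (l2_inner M (G (cr u)) (cr u))"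
      unfolding absop_inner[OF G u] using nn by (simp add: b_def)
    also have "\<dots> = cmod (l2_inner M (D (cr u)) (cr u))"
      unfolding adjoint_ofD(2)[OF D(2) cr_L2[OF u] cr_L2[OF u]] l2_inner_cnj[of M "G (cr u)"] by simp
    also have "\<dots> \<le> numerical_radius M D"
      unfolding numerical_radius_def
      by (rule sup0_upper[OF numerical_radius_bdd[OF D(1)]]) (use cr_L2[OF u] un in auto)
    finally show "(\<integral>x. b x * u x \<partial>M) \<le> numerical_radius M D" .
  qed
  finally show "cmod (l2_inner M (T f) f) \<le> numerical_radius M E powr \<theta> * numerical_radius M D powr (1-\<theta>)" .
qed

section \<open>The spectral radius of a positive operator\<close>

lemma root_powr_mult:
  fixes a b :: real
  assumes "0 \<le> a" "0 \<le> b" "0 < m"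
  shows "root m (a powr \<theta> * b powr \<eta>) = root m a powr \<theta> * root m b powr \<eta>"
  using assms by (simp add: real_root_mult root_powr_inverse powr_powr mult.commute)

text \<open>The limit is the infimum of the roots. Indices start at 1 because \<open>root 0\<close>
  is constantly 0 and nothing is assumed about \<open>u 0\<close>.\<close>

lemma Fekete_root:
  fixes u :: "nat \<Rightarrow> real"
  assumes nn: "\<And>m. m \<ge> 1 \<Longrightarrow> 0 \<le> u m"
    and sub: "\<And>m k. m \<ge> 1 \<Longrightarrow> k \<ge> 1 \<Longrightarrow> u (m + k) \<le> u m * u k"
  obtains L where "0 \<le> L" "(\<lambda>m. root m (u m)) \<longlonglongrightarrow> L"
proof -
  define L where "L = Inf ((\<lambda>m. root m (u m)) ` {1..})"
  have bdd: "bdd_below ((\<lambda>m. root m (u m)) ` {1..})"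
    by (rule bdd_belowI[of _ 0]) (use nn in auto)
  have L: "L \<le> root m (u m)" if "m \<ge> 1" for m
    unfolding L_def by (rule cInf_lower[OF _ bdd]) (use that in auto)
  have L0: "0 \<le> L" unfolding L_def by (rule cInf_greatest) (use nn in auto)
  have upper: "\<forall>\<^sub>F m in sequentially. root m (u m) < y" if Ly: "L < y" for y
  proof -
    obtain s where s: "L < s" "s < y" using dense[OF Ly] by auto
    have s0: "s > 0" using L0 s by simp
    obtain p where p: "p \<ge> 1" "root p (u p) < s"
      using s(1) cInf_lessD[of "(\<lambda>m. root m (u m)) ` {1..}" s] unfolding L_def by auto
    have up: "u p \<le> s ^ p"
    proof -
      have "u p = root p (u p) ^ p" using nn[OF p(1)] p(1) by (simp add: real_root_pow_pos2)
      also have "\<dots> \<le> s ^ p" using p nn[OF p(1)] by (intro power_mono) auto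
      finally show ?thesis .
    qed
    have mult: "u (q * p + r) \<le> s ^ (q * p) * u r" if "r \<ge> 1" for q r
    proof (induction q)
      case (Suc q)
      have "u (Suc q * p + r) = u (p + (q * p + r))" by (simp add: algebra_simps)
      also have "\<dots> \<le> u p * u (q * p + r)" by (rule sub) (use p that in auto)
      also have "\<dots> \<le> s ^ p * (s ^ (q * p) * u r)"
        by (intro mult_mono up Suc.IH nn) (use that s0 in auto)
      finally show ?case by (simp add: power_add mult_ac)
    qed simp
    \<comment> \<open>The summand 1 only makes \<open>K\<close> positive, so that its roots tend to
      1.\<close>
    define K where "K = 1 + (\<Sum>r=1..p. u r / s ^ r)"
    have K: "u r / s ^ r \<le> K" if "r \<in> {1..p}" for r
    proof -
      have "u r / s ^ r \<le> (\<Sum>r=1..p. u r / s ^ r)"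
        using that s0 nn by (intro member_le_sum) auto
      then show ?thesis by (simp add: K_def)
    qed
    have "0 \<le> (\<Sum>r=1..p. u r / s ^ r)" using s0 nn by (intro sum_nonneg) auto
    then have K0: "K > 0" by (simp add: K_def)
    have bound: "root m (u m) \<le> s * root m K" if m: "m \<ge> 1" for m
    proof -
      \<comment> \<open>Dividing \<open>m - 1\<close> instead of \<open>m\<close> puts the remainder
        into 1..p, so that \<open>u 0\<close> never occurs.\<close>
      define q r where "q = (m - 1) div p" and "r = (m - 1) mod p + 1"
      have qr: "m = q * p + r" unfolding q_def r_def using m by simp
      have r: "r \<in> {1..p}" unfolding r_def using p(1) by (simp add: Suc_leI)
      have "u m \<le> s ^ (q * p) * u r" using mult[of r q] r unfolding qr by simp
      also have "\<dots> = s ^ m * (u r / s ^ r)" using s0 unfolding qr by (simp add: power_add)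
      also have "\<dots> \<le> s ^ m * K" by (intro mult_left_mono K r) (use s0 in auto)
      finally have "root m (u m) \<le> root m (s ^ m * K)" using m by simp
      also have "\<dots> = s * root m K" using m s0 by (simp add: real_root_mult real_root_power_cancel)
      finally show ?thesis .
    qed
    have "(\<lambda>m. s * root m K) \<longlonglongrightarrow> s * 1"
      by (intro tendsto_mult tendsto_const LIMSEQ_root_const K0)
    then have "\<forall>\<^sub>F m in sequentially. s * root m K < y"
      using s by (auto dest: order_tendstoD)
    then show ?thesis
      using eventually_ge_at_top[of "1::nat"]
    proof eventually_elim
      case (elim m)
      then show ?case using bound[of m] by simp
    qed
  qed
  have "(\<lambda>m. root m (u m)) \<longlonglongrightarrow> L"
  proof (rule order_tendstoI)
    fix a assume "a < L"
    then show "\<forall>\<^sub>F m in sequentially. a < root m (u m)"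
      using L by (intro eventually_sequentiallyI[of 1]) fastforce
  qed (rule upper)
  then show ?thesis using that L0 by blast
qed

section \<open>Limits and series of square-integrable functions\<close>

lemma L2_Fatou:
  assumes f: "\<And>n. f n \<in> L2 M" and K: "\<And>n. l2_norm M (f n) \<le> K"
    and g: "g \<in> borel_measurable M" and lim: "AE x in M. (\<lambda>n. f n x) \<longlonglongrightarrow> g x"
  shows "g \<in> L2 M" "l2_norm M g \<le> K"
proof -
  have [measurable]: "f n \<in> borel_measurable M" "g \<in> borel_measurable M" for n
    using f g by (auto simp: L2_def)
  have K0: "0 \<le> K" using K[of 0] l2_norm_nonneg[of M "f 0"] by linarith
  have nn: "(\<integral>\<^sup>+x. ennreal ((cmod (f n x))\<^sup>2) \<partial>M) \<le> ennreal (K\<^sup>2)" for n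
  proof -
    have "(\<integral>\<^sup>+x. ennreal ((cmod (f n x))\<^sup>2) \<partial>M) = ennreal (\<integral>x. (cmod (f n x))\<^sup>2 \<partial>M)"
      using f[of n] by (intro nn_integral_eq_integral) (auto simp: L2_def)
    also have "\<dots> = ennreal ((l2_norm M (f n))\<^sup>2)" by (simp only: l2_norm_sq)
    also have "\<dots> \<le> ennreal (K\<^sup>2)" by (intro ennreal_leI power_mono K) simp
    finally show ?thesis .
  qed
  have "(\<integral>\<^sup>+x. ennreal ((cmod (g x))\<^sup>2) \<partial>M) = (\<integral>\<^sup>+x. liminf (\<lambda>n. ennreal ((cmod (f n x))\<^sup>2)) \<partial>M)"
  proof (rule nn_integral_cong_AE)
    show "AE x in M. ennreal ((cmod (g x))\<^sup>2) = liminf (\<lambda>n. ennreal ((cmod (f n x))\<^sup>2))"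
      using lim
    proof eventually_elim
      case (elim x)
      have "(\<lambda>n. ennreal ((cmod (f n x))\<^sup>2)) \<longlonglongrightarrow> ennreal ((cmod (g x))\<^sup>2)"
        by (intro tendsto_ennrealI tendsto_power tendsto_norm elim)
      then show ?case by (rule lim_imp_Liminf[OF sequentially_bot, symmetric])
    qed
  qed
  also have "\<dots> \<le> liminf (\<lambda>n. \<integral>\<^sup>+x. ennreal ((cmod (f n x))\<^sup>2) \<partial>M)"
    by (rule nn_integral_liminf) measurable
  also have "\<dots> \<le> ennreal (K\<^sup>2)"
    using nn by (intro Liminf_le) auto
  finally have le: "(\<integral>\<^sup>+x. ennreal ((cmod (g x))\<^sup>2) \<partial>M) \<le> ennreal (K\<^sup>2)" .
  have int: "integrable M (\<lambda>x. (cmod (g x))\<^sup>2)"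
    by (rule integrableI_bounded) (use le in \<open>auto simp: le_less_trans\<close>)
  then show "g \<in> L2 M" by (simp add: L2_def)
  have "ennreal (\<integral>x. (cmod (g x))\<^sup>2 \<partial>M) \<le> ennreal (K\<^sup>2)"
    using nn_integral_eq_integral[OF int] le by simp
  then have "(l2_norm M g)\<^sup>2 \<le> K\<^sup>2" by (simp add: l2_norm_sq)
  then show "l2_norm M g \<le> K" using K0 by (rule power2_le_imp_le)
qed

text \<open>Monotone convergence for the squares of the partial sums of the moduli: their supremum
  has finite integral, hence is finite a.e.\<close>

lemma L2_abs_summable:
  assumes a: "\<And>k. a k \<in> L2 M" and K: "\<And>n. (\<Sum>k<n. l2_norm M (a k)) \<le> K"
  shows "AE x in M. summable (\<lambda>k. cmod (a k x))"
proof -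
  have [measurable]: "a k \<in> borel_measurable M" for k using a by (auto simp: L2_def)
  define s where "s = (\<lambda>n x. \<Sum>k<n. cmod (a k x))"
  have sL: "cr (s n) \<in> L2 M" "l2_norm M (cr (s n)) \<le> K" for n
  proof -
    have c: "(\<lambda>x. complex_of_real (cmod (a k x))) \<in> L2 M" for k by (intro cr_L2 cmod_pL a)
    show "cr (s n) \<in> L2 M" unfolding s_def of_real_sum by (intro L2_sum c) auto
    have "l2_norm M (cr (s n)) \<le> (\<Sum>k<n. l2_norm M (\<lambda>x. complex_of_real (cmod (a k x))))"
      unfolding s_def of_real_sum by (intro l2_norm_sum_le c) auto
    also have "\<dots> \<le> K" using K by (simp add: l2_norm_cmod)
    finally show "l2_norm M (cr (s n)) \<le> K" .
  qed
  have [measurable]: "s n \<in> borel_measurable M" for n unfolding s_def by measurable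
  have s0: "0 \<le> s n x" for n x unfolding s_def by (intro sum_nonneg) auto
  have "(\<integral>\<^sup>+x. (SUP n. ennreal ((s n x)\<^sup>2)) \<partial>M) = (SUP n. \<integral>\<^sup>+x. ennreal ((s n x)\<^sup>2) \<partial>M)"
    by (rule nn_integral_monotone_convergence_SUP_AE)
      (auto intro!: AE_I2 ennreal_leI power_mono s0 simp: s_def sum_nonneg)
  also have "\<dots> \<le> ennreal (K\<^sup>2)"
  proof (rule SUP_least)
    fix n
    have "(\<integral>\<^sup>+x. ennreal ((s n x)\<^sup>2) \<partial>M) = ennreal (\<integral>x. (s n x)\<^sup>2 \<partial>M)"
      using sL(1)[of n] by (intro nn_integral_eq_integral) (auto simp: L2_def)
    also have "\<dots> = ennreal ((l2_norm M (cr (s n)))\<^sup>2)" by (simp add: l2_norm_sq)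
    also have "\<dots> \<le> ennreal (K\<^sup>2)" by (intro ennreal_leI power_mono sL) simp
    finally show "(\<integral>\<^sup>+x. ennreal ((s n x)\<^sup>2) \<partial>M) \<le> ennreal (K\<^sup>2)" .
  qed
  finally have "(\<integral>\<^sup>+x. (SUP n. ennreal ((s n x)\<^sup>2)) \<partial>M) \<noteq> \<infinity>"
    by (metis ennreal_neq_top infinity_ennreal_def neq_top_trans)
  then have "AE x in M. (SUP n. ennreal ((s n x)\<^sup>2)) \<noteq> \<infinity>"
    by (intro nn_integral_PInf_AE) measurable
  then show ?thesis
  proof eventually_elim
    case (elim x)
    then obtain r where r: "(SUP n. ennreal ((s n x)\<^sup>2)) = ennreal r" "0 \<le> r"
      by (cases "SUP n. ennreal ((s n x)\<^sup>2)") auto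
    have b: "s n x \<le> sqrt r" for n
    proof -
      have "ennreal ((s n x)\<^sup>2) \<le> ennreal r" unfolding r(1)[symmetric] by (rule SUP_upper) simp
      then show ?thesis using r(2) by (intro real_le_rsqrt) simp
    qed
    show ?case
      by (rule summableI_nonneg_bounded[of _ "sqrt r"]) (use b in \<open>auto simp: s_def\<close>)
  qed
qed

text \<open>Completeness, in the form needed for the Neumann series. Each remainder is the a.e.
  limit of the finite sums of \<open>a (n + k)\<close>, whose norms are bounded by the tail of the
  geometric series; Fatou's lemma carries this bound over to the limit.\<close>

lemma L2_series:
  assumes a: "\<And>k. a k \<in> L2 M" and b: "\<And>k. l2_norm M (a k) \<le> K * \<theta> ^ k"
    and \<theta>: "0 \<le> \<theta>" "\<theta> < 1"
  obtains S where "S \<in> L2 M"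
    "\<And>n. l2_norm M (\<lambda>x. S x - (\<Sum>k<n. a k x)) \<le> K / (1-\<theta>) * \<theta> ^ n"
proof -
  have K0: "0 \<le> K" using order_trans[OF l2_norm_nonneg b[of 0]] by simp
  have sums: "(\<Sum>k<m. l2_norm M (a (n + k))) \<le> K / (1-\<theta>) * \<theta> ^ n" for n m
  proof -
    have "(\<Sum>k<m. l2_norm M (a (n + k))) \<le> (\<Sum>k<m. K * \<theta> ^ n * \<theta> ^ k)"
    proof (rule sum_mono)
      show "l2_norm M (a (n + k)) \<le> K * \<theta> ^ n * \<theta> ^ k" for k
        using b[of "n + k"] by (simp add: power_add mult.assoc)
    qed
    also have "\<dots> = K * \<theta> ^ n * (\<Sum>k<m. \<theta> ^ k)" by (simp add: sum_distrib_left)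
    also have "\<dots> \<le> K * \<theta> ^ n * (1 / (1-\<theta>))"
    proof (intro mult_left_mono)
      show "(\<Sum>k<m. \<theta> ^ k) \<le> 1 / (1-\<theta>)"
        using \<theta> sum_le_suminf[OF summable_geometric, of \<theta> "{..<m}"] by (simp add: suminf_geometric)
    qed (use K0 \<theta> in auto)
    finally show ?thesis by (simp add: field_simps)
  qed
  have [measurable]: "a k \<in> borel_measurable M" for k using a by (auto simp: L2_def)
  \<comment> \<open>\<open>lim\<close> gives a measurable function; its value at the null set of
    points of divergence is irrelevant.\<close>
  define S where "S = (\<lambda>x. lim (\<lambda>n. \<Sum>k<n. a k x))"
  have [measurable]: "S \<in> borel_measurable M" unfolding S_def by measurable
  have "AE x in M. summable (\<lambda>k. cmod (a k x))"
    by (rule L2_abs_summable[OF a, where K="K / (1-\<theta>)"]) (use sums[where n=0] in simp)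
  then have lim: "AE x in M. (\<lambda>n. \<Sum>k<n. a k x) \<longlonglongrightarrow> S x"
  proof eventually_elim
    case (elim x)
    then have "summable (\<lambda>k. a k x)" by (rule summable_norm_cancel)
    then have "(\<lambda>n. \<Sum>k<n. a k x) \<longlonglongrightarrow> suminf (\<lambda>k. a k x)" by (rule summable_LIMSEQ)
    then show ?case unfolding S_def by (metis limI)
  qed
  have rest: "(\<lambda>x. S x - (\<Sum>k<n. a k x)) \<in> L2 M"
    "l2_norm M (\<lambda>x. S x - (\<Sum>k<n. a k x)) \<le> K / (1-\<theta>) * \<theta> ^ n" for n
  proof -
    define f where "f = (\<lambda>m x. \<Sum>k<m. a (n + k) x)"
    have 1: "f m \<in> L2 M" for m unfolding f_def by (intro L2_sum a) auto
    have 2: "l2_norm M (f m) \<le> K / (1-\<theta>) * \<theta> ^ n" for m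
      unfolding f_def by (rule order_trans[OF l2_norm_sum_le sums]) (use a in auto)
    have 3: "(\<lambda>x. S x - (\<Sum>k<n. a k x)) \<in> borel_measurable M" by measurable
    have 4: "AE x in M. (\<lambda>m. f m x) \<longlonglongrightarrow> S x - (\<Sum>k<n. a k x)"
      using lim
    proof eventually_elim
      case (elim x)
      have "f m x = (\<Sum>k<m + n. a k x) - (\<Sum>k<n. a k x)" for m
        unfolding f_def by (induction m) (simp_all add: add.commute)
      then show ?case
        using tendsto_diff[OF LIMSEQ_ignore_initial_segment[OF elim, of n] tendsto_const] by simp
    qed
    show "(\<lambda>x. S x - (\<Sum>k<n. a k x)) \<in> L2 M"
      "l2_norm M (\<lambda>x. S x - (\<Sum>k<n. a k x)) \<le> K / (1-\<theta>) * \<theta> ^ n"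
      using L2_Fatou[OF 1 2 3 4] by auto
  qed
  have "S \<in> L2 M" using rest(1)[of 0] by simp
  then show ?thesis using rest(2) by (rule that)
qed

section \<open>The spectrum and the Neumann series\<close>

lemma l2_spectrum_iff:
  "z \<notin> l2_spectrum M A \<longleftrightarrow> (\<exists>R. bounded_op M R \<and>
     (\<forall>f\<in>L2 M. (AE x in M. R (\<lambda>t. z * f t - A f t) x = f x) \<and>
                (AE x in M. z * R f x - A (R f) x = f x)))"
  by (simp add: l2_spectrum_def)

text \<open>Choosing a solution for every \<open>f\<close> yields a bare function \<open>R\<close>.
  Injectivity of \<open>z - A\<close> makes solutions unique a.e., and this gives linearity of
  \<open>R\<close>, its compatibility with a.e. equality and the left inverse property.\<close>

lemma not_in_l2_spectrumI:
  assumes A: "bounded_op M A"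
    and sol: "\<And>f. f \<in> L2 M \<Longrightarrow> \<exists>g\<in>L2 M. (AE x in M. z * g x - A g x = f x) \<and> l2_norm M g \<le> K * l2_norm M f"
    and inj: "\<And>h. h \<in> L2 M \<Longrightarrow> AE x in M. A h x = z * h x \<Longrightarrow> AE x in M. h x = 0"
  shows "z \<notin> l2_spectrum M A"
proof -
  note lA = bounded_op_linear[OF A]
  obtain R where R: "\<And>f. f \<in> L2 M \<Longrightarrow> R f \<in> L2 M"
    "\<And>f. f \<in> L2 M \<Longrightarrow> AE x in M. z * R f x - A (R f) x = f x"
    "\<And>f. f \<in> L2 M \<Longrightarrow> l2_norm M (R f) \<le> K * l2_norm M f"
    using sol by metis
  have uniq: "AE x in M. g x = h x"
    if g: "g \<in> L2 M" and h: "h \<in> L2 M" and eq: "AE x in M. z * g x - A g x = z * h x - A h x" for g h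
  proof -
    have "AE x in M. A (\<lambda>t. g t - h t) x = z * (g x - h x)"
      using linear_op_diff[OF lA g h] eq
    proof eventually_elim
      case (elim x)
      have "A g x - A h x = z * g x - z * h x" using elim(2) by (simp add: algebra_simps)
      then show ?case using elim(1) by (simp add: right_diff_distrib)
    qed
    then have "AE x in M. g x - h x = 0" by (rule inj[OF L2_diff[OF g h]])
    then show ?thesis by simp
  qed
  have AL: "A f \<in> L2 M" if "f \<in> L2 M" for f by (rule bounded_op_L2[OF A that])
  have "linear_op M R"
    unfolding linear_op_def
  proof (intro conjI ballI allI impI)
    fix f g assume f: "f \<in> L2 M" and g: "g \<in> L2 M"
    show "R f \<in> L2 M" by (rule R(1)[OF f])
    show "AE x in M. R f x = R g x" if "AE x in M. f x = g x"
      by (rule uniq[OF R(1)[OF f] R(1)[OF g]])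
        (use R(2)[OF f] R(2)[OF g] that in eventually_elim, simp)
    show "AE x in M. R (\<lambda>t. f t + g t) x = R f x + R g x"
    proof (rule uniq[OF R(1)[OF L2_add[OF f g]] L2_add[OF R(1)[OF f] R(1)[OF g]]])
      show "AE x in M. z * R (\<lambda>t. f t + g t) x - A (R (\<lambda>t. f t + g t)) x
        = z * (R f x + R g x) - A (\<lambda>x. R f x + R g x) x"
        using R(2)[OF L2_add[OF f g]] R(2)[OF f] R(2)[OF g]
          linear_opD(3)[OF lA R(1)[OF f] R(1)[OF g]]
        by eventually_elim (simp add: algebra_simps)
    qed
  next
    fix c f assume f: "f \<in> L2 M"
    show "AE x in M. R (\<lambda>t. c * f t) x = c * R f x"
    proof (rule uniq[OF R(1)[OF L2_scale[OF f]] L2_scale[OF R(1)[OF f]]])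
      show "AE x in M. z * R (\<lambda>t. c * f t) x - A (R (\<lambda>t. c * f t)) x
        = z * (c * R f x) - A (\<lambda>x. c * R f x) x"
        using R(2)[OF L2_scale[OF f, of c]] R(2)[OF f] linear_opD(4)[OF lA R(1)[OF f], of c]
      proof eventually_elim
        case (elim x)
        have "z * (c * R f x) - A (\<lambda>x. c * R f x) x = c * (z * R f x - A (R f) x)"
          unfolding elim(3) by (simp add: algebra_simps)
        then show ?case using elim(1,2) by simp
      qed
    qed
  qed
  then have "bounded_op M R" using R(3) unfolding bounded_op_def by blast
  moreover have "AE x in M. R (\<lambda>t. z * f t - A f t) x = f x" if f: "f \<in> L2 M" for f
  proof -
    have L: "(\<lambda>t. z * f t - A f t) \<in> L2 M" by (intro L2_diff L2_scale f AL)
    show ?thesis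
      by (rule uniq[OF R(1)[OF L] f R(2)[OF L]])
  qed
  ultimately show ?thesis unfolding l2_spectrum_iff using R(2) by blast
qed

lemma le_geometric_imp_le_0:
  fixes a E \<theta> :: real
  assumes "\<And>n. a \<le> E * \<theta> ^ n" "0 \<le> \<theta>" "\<theta> < 1"
  shows "a \<le> 0"
proof (rule LIMSEQ_le_const)
  have "(\<lambda>n. E * \<theta> ^ n) \<longlonglongrightarrow> E * 0"
    by (intro tendsto_mult tendsto_const LIMSEQ_realpow_zero) (use assms in auto)
  then show "(\<lambda>n. E * \<theta> ^ n) \<longlonglongrightarrow> 0" by simp
qed (use assms in auto)

text \<open>Existence comes from the series with terms \<open>1 / z ^ Suc k * (A ^^ k) f\<close>.
  For injectivity, \<open>A h = z h\<close> gives \<open>(A ^^ k) h = z ^ k h\<close>, so the norm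
  of \<open>h\<close> is at most a constant times \<open>(q / cmod z) ^ k\<close> for every
  \<open>k\<close>.\<close>

lemma Neumann_series:
  assumes A: "bounded_op M A" and C: "\<And>k. op_norm M (A ^^ k) \<le> C * q ^ k"
    and q: "0 \<le> q" "q < cmod z"
  shows "z \<notin> l2_spectrum M A"
proof -
  note lA = bounded_op_linear[OF A]
  have Ak: "bounded_op M (A ^^ k)" for k by (rule bounded_op_funpow[OF A])
  have z: "cmod z > 0" "z \<noteq> 0" using q by auto
  define \<theta> where "\<theta> = q / cmod z"
  have \<theta>: "0 \<le> \<theta>" "\<theta> < 1" using q z by (auto simp: \<theta>_def)
  have C0: "0 \<le> C" using C[of 0] op_norm_nonneg[OF Ak[of 0]] by simp
  have normk: "l2_norm M (\<lambda>x. 1 / z ^ k * (A ^^ k) f x) \<le> C * l2_norm M f * \<theta> ^ k" if f: "f \<in> L2 M" for f k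
  proof -
    have "l2_norm M (\<lambda>x. 1 / z ^ k * (A ^^ k) f x) = 1 / cmod z ^ k * l2_norm M ((A ^^ k) f)"
      unfolding l2_norm_scale by (simp add: norm_divide norm_power)
    also have "\<dots> \<le> 1 / cmod z ^ k * (C * q ^ k * l2_norm M f)"
      using l2_norm_apply_le[OF Ak f, of k] mult_right_mono[OF C l2_norm_nonneg, of k M f]
      by (intro mult_left_mono) auto
    finally show ?thesis by (simp add: \<theta>_def power_divide mult_ac)
  qed
  show ?thesis
  proof (rule not_in_l2_spectrumI[OF A, where K="C / cmod z / (1-\<theta>)"])
    fix f assume f: "f \<in> L2 M"
    define a where "a = (\<lambda>k x. 1 / z ^ Suc k * (A ^^ k) f x)"
    have aL: "a k \<in> L2 M" for k unfolding a_def by (intro L2_scale bounded_op_L2[OF Ak] f)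
    have an: "l2_norm M (a k) \<le> C * l2_norm M f / cmod z * \<theta> ^ k" for k
    proof -
      have "a k = (\<lambda>x. 1 / z * (1 / z ^ k * (A ^^ k) f x))" by (simp add: a_def)
      then have "l2_norm M (a k) = cmod (1 / z) * l2_norm M (\<lambda>x. 1 / z ^ k * (A ^^ k) f x)"
        by (simp only: l2_norm_scale)
      also have "\<dots> \<le> cmod (1 / z) * (C * l2_norm M f * \<theta> ^ k)"
        by (intro mult_left_mono normk f) simp
      finally show ?thesis by (simp add: norm_divide)
    qed
    obtain S where S: "S \<in> L2 M"
      "\<And>n. l2_norm M (\<lambda>x. S x - (\<Sum>k<n. a k x)) \<le> C * l2_norm M f / cmod z / (1-\<theta>) * \<theta> ^ n"
      using L2_series[OF aL an \<theta>] by blast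
    define B where "B = C * l2_norm M f / cmod z / (1-\<theta>)"
    have SnL: "(\<lambda>x. \<Sum>k<n. a k x) \<in> L2 M" for n by (intro L2_sum aL) auto
    \<comment> \<open>The partial sums telescope under \<open>z - A\<close>.\<close>
    have tel: "AE x in M. z * (\<Sum>k<n. a k x) - A (\<lambda>x. \<Sum>k<n. a k x) x = f x - 1 / z ^ n * (A ^^ n) f x" for n
    proof (induction n)
      case 0
      show ?case using linear_opD(4)[OF lA L2_0, of 0] by simp
    next
      case (Suc n)
      have "AE x in M. A (a n) x = 1 / z ^ Suc n * A ((A ^^ n) f) x"
        unfolding a_def by (rule linear_opD(4)[OF lA bounded_op_L2[OF Ak f]])
      with Suc.IH linear_opD(3)[OF lA SnL aL, of n n] show ?case
      proof eventually_elim
        case (elim x)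
        have "z * a n x = 1 / z ^ n * (A ^^ n) f x" using z by (simp add: a_def)
        then show ?case using elim by (simp add: algebra_simps)
      qed
    qed
    let ?d = "\<lambda>x. z * S x - A S x - f x"
    have AS: "A S \<in> L2 M" by (rule bounded_op_L2[OF A S(1)])
    have dL: "?d \<in> L2 M" by (intro L2_diff L2_scale S AS f)
    \<comment> \<open>The defect \<open>?d\<close> does not depend on \<open>n\<close>, but by
      telescoping it equals \<open>z e - A e - z^(-n) A^n f\<close> with \<open>e\<close> the n-th
      remainder, and all three terms decay like \<open>\<theta> ^ n\<close>.\<close>
    have "l2_norm M ?d \<le> (cmod z * B + op_norm M A * B + C * l2_norm M f) * \<theta> ^ n" for n
    proof -
      let ?e = "\<lambda>x. S x - (\<Sum>k<n. a k x)"
      have eL: "?e \<in> L2 M" by (intro L2_diff S SnL)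
      have ze: "(\<lambda>x. z * ?e x) \<in> L2 M" by (intro L2_scale eL)
      have Ae: "A ?e \<in> L2 M" by (rule bounded_op_L2[OF A eL])
      have Af: "(\<lambda>x. 1 / z ^ n * (A ^^ n) f x) \<in> L2 M" by (intro L2_scale bounded_op_L2[OF Ak f])
      have "l2_norm M ?d = l2_norm M (\<lambda>x. z * ?e x - A ?e x - 1 / z ^ n * (A ^^ n) f x)"
      proof (rule l2_norm_cong_AE[OF L2D(1)[OF dL] L2D(1)[OF L2_diff[OF L2_diff[OF ze Ae] Af]]])
        show "AE x in M. ?d x = z * ?e x - A ?e x - 1 / z ^ n * (A ^^ n) f x"
          using tel[of n] linear_op_diff[OF lA S(1) SnL[of n]]
        proof eventually_elim
          case (elim x)
          have "z * ?e x - A ?e x = z * S x - A S x - (z * (\<Sum>k<n. a k x) - A (\<lambda>x. \<Sum>k<n. a k x) x)"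
            using elim(2) by (simp add: algebra_simps)
          then show ?case using elim(1) by simp
        qed
      qed
      also have "\<dots> \<le> l2_norm M (\<lambda>x. z * ?e x - A ?e x) + l2_norm M (\<lambda>x. 1 / z ^ n * (A ^^ n) f x)"
        by (rule l2_norm_triangle_diff[OF L2_diff[OF ze Ae] Af])
      also have "\<dots> \<le> (l2_norm M (\<lambda>x. z * ?e x) + l2_norm M (A ?e)) + C * l2_norm M f * \<theta> ^ n"
        by (intro add_mono l2_norm_triangle_diff ze Ae normk f)
      also have "l2_norm M (\<lambda>x. z * ?e x) \<le> cmod z * (B * \<theta> ^ n)"
        unfolding l2_norm_scale B_def by (intro mult_left_mono S) simp
      also have "l2_norm M (A ?e) \<le> op_norm M A * (B * \<theta> ^ n)"
        unfolding B_def by (rule order_trans[OF l2_norm_apply_le[OF A eL] mult_left_mono[OF S(2) op_norm_nonneg[OF A]]])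
      finally show ?thesis by (simp add: algebra_simps)
    qed
    then have "l2_norm M ?d \<le> 0" by (rule le_geometric_imp_le_0[OF _ \<theta>])
    then have "AE x in M. ?d x = 0" using l2_norm_eq_0[OF dL] l2_norm_nonneg[of M ?d] by linarith
    then have "AE x in M. z * S x - A S x = f x" by simp
    moreover have "l2_norm M S \<le> C / cmod z / (1-\<theta>) * l2_norm M f" using S(2)[of 0] by simp
    ultimately show "\<exists>g\<in>L2 M. (AE x in M. z * g x - A g x = f x) \<and> l2_norm M g \<le> C / cmod z / (1-\<theta>) * l2_norm M f"
      using S(1) by blast
  next
    fix h assume h: "h \<in> L2 M" and eq: "AE x in M. A h x = z * h x"
    have pow: "AE x in M. (A ^^ k) h x = z ^ k * h x" for k
    proof (induction k)
      case (Suc k)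
      have "AE x in M. A ((A ^^ k) h) x = A (\<lambda>t. z ^ k * h t) x"
        by (rule bounded_op_cong[OF A bounded_op_L2[OF Ak h] L2_scale[OF h] Suc.IH])
      with eq linear_opD(4)[OF lA h, of "z ^ k"] show ?case by eventually_elim simp
    qed simp
    have "l2_norm M h \<le> C * l2_norm M h * \<theta> ^ k" for k
    proof -
      have "l2_norm M h = l2_norm M (\<lambda>x. 1 / z ^ k * (A ^^ k) h x)"
      proof (rule l2_norm_cong_AE[OF L2D(1)[OF h] L2D(1)[OF L2_scale[OF bounded_op_L2[OF Ak h]]]])
        show "AE x in M. h x = 1 / z ^ k * (A ^^ k) h x"
          using pow[of k] by eventually_elim (use z in simp)
      qed
      then show ?thesis using normk[OF h, of k] by simp
    qed
    then have "l2_norm M h \<le> 0" by (rule le_geometric_imp_le_0[OF _ \<theta>])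
    then show "AE x in M. h x = 0" using l2_norm_eq_0[OF h] l2_norm_nonneg[of M h] by linarith
  qed
qed

section \<open>Positivity of the resolvent and growth of powers\<close>

text \<open>The clause of \<open>pos_op\<close> on nonnegative functions alone: this is what the
  fixpoint argument delivers for resolvents, and what the bound on the powers consumes.\<close>

definition cone_pos :: "'a measure \<Rightarrow> 'a l2op \<Rightarrow> bool" where
  "cone_pos M K \<longleftrightarrow> (\<forall>u\<in>pL M. AE x in M. K (cr u) x = complex_of_real (absop K u x))"

lemma cone_posD: "cone_pos M K \<Longrightarrow> u \<in> pL M \<Longrightarrow> AE x in M. K (cr u) x = complex_of_real (absop K u x)"
  by (simp add: cone_pos_def)

lemma cone_pos_pos_op: "pos_op M T \<Longrightarrow> cone_pos M T"
  by (simp add: cone_pos_def pos_opD(2))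

lemma cmod_diff_nonneg_part:
  assumes "0 \<le> r"
  shows "cmod (z - complex_of_real (max 0 (Re z))) \<le> cmod (z - complex_of_real r)"
proof (cases "Re z \<ge> 0")
  case True
  then show ?thesis by (simp add: cmod_def)
next
  case False
  then have "(Re z)\<^sup>2 \<le> (Re z - r)\<^sup>2" using assms by (intro abs_le_square_iff[THEN iffD1]) auto
  with False show ?thesis by (simp add: cmod_def)
qed

text \<open>
  The function \<open>cr w\<close> below is the pointwise projection of \<open>g\<close> to the half-line of nonnegative
  numbers. Since \<open>p + c K w\<close> is nonnegative as well, \<open>\<bar>g - w\<bar> \<le> c \<bar>K (g - w)\<bar>\<close>.
\<close>

lemma cone_fixpoint_nonneg:
  assumes K: "bounded_op M K" "cone_pos M K" and c: "0 \<le> c" "c * op_norm M K < 1"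
    and p: "p \<in> pL M" and g: "g \<in> L2 M"
    and eq: "AE x in M. g x = complex_of_real (p x) + complex_of_real c * K g x"
  shows "AE x in M. g x = complex_of_real (cmod (g x))"
proof -
  define w where "w = (\<lambda>x. max 0 (Re (g x)))"
  have [measurable]: "g \<in> borel_measurable M" using g by (auto simp: L2_def)
  have w: "w \<in> pL M"
    unfolding w_def
    by (rule pL_dominated(1)[OF cmod_pL[OF g]]) (auto simp: complex_Re_le_cmod)
  note wL = cr_L2[OF w]
  define d where "d = (\<lambda>x. g x - complex_of_real (w x))"
  have d: "d \<in> L2 M" unfolding d_def by (rule L2_diff[OF g wL])
  have Kd: "K d \<in> L2 M" by (rule bounded_op_L2[OF K(1) d])
  have "AE x in M. cmod (d x) \<le> cmod (complex_of_real c * K d x)"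
    using eq linear_op_diff[OF bounded_op_linear[OF K(1)] g wL] cone_posD[OF K(2) w]
  proof eventually_elim
    case (elim x)
    define r where "r = p x + c * absop K w x"
    have "0 \<le> r" unfolding r_def using pLD(2)[OF p] c by simp
    have le: "cmod (d x) \<le> cmod (g x - complex_of_real r)"
      unfolding d_def w_def by (rule cmod_diff_nonneg_part[OF \<open>0 \<le> r\<close>])
    have "K g x = complex_of_real (absop K w x) + K d x"
      using elim(2,3) by (simp add: d_def)
    then have "g x - complex_of_real r = complex_of_real c * K d x"
      using elim(1) unfolding r_def by (simp add: distrib_left)
    with le show ?case by simp
  qed
  then have "l2_norm M d \<le> l2_norm M (\<lambda>x. complex_of_real c * K d x)"
    by (rule l2_norm_mono(2)[OF L2_scale[OF Kd] L2D(1)[OF d]])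
  also have "\<dots> = c * l2_norm M (K d)" unfolding l2_norm_scale using c by simp
  also have "\<dots> \<le> c * (op_norm M K * l2_norm M d)" by (intro mult_left_mono l2_norm_apply_le K d c)
  finally have "(1 - c * op_norm M K) * l2_norm M d \<le> 0" by (simp add: algebra_simps)
  then have "l2_norm M d = 0"
    using c l2_norm_nonneg[of M d] by (simp add: mult_le_0_iff)
  from l2_norm_eq_0[OF d this] show ?thesis
  proof eventually_elim
    case (elim x)
    then have *: "g x = complex_of_real (w x)" by (simp add: d_def)
    show ?case unfolding * by (simp add: w_def)
  qed
qed

text \<open>\<open>Rt\<close> is applied to \<open>t g - A g = f + (t - s) g\<close> with
  \<open>g = Rs f\<close>. Read as an equation for \<open>g\<close>, the result is a fixpoint
  equation with operator \<open>Rt\<close>, which is how positivity passes from \<open>t\<close> to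
  \<open>s\<close>.\<close>

lemma resolvent_identity:
  assumes A: "bounded_op M A" and R: "bounded_op M Rs" "bounded_op M Rt" and f: "f \<in> L2 M"
    and s: "AE x in M. s * Rs f x - A (Rs f) x = f x"
    and t: "\<And>g. g \<in> L2 M \<Longrightarrow> AE x in M. Rt (\<lambda>y. t * g y - A g y) x = g x"
  shows "AE x in M. Rs f x = Rt f x + (t - s) * Rt (Rs f) x"
proof -
  let ?g = "Rs f"
  have g: "?g \<in> L2 M" by (rule bounded_op_L2[OF R(1) f])
  have Ag: "A ?g \<in> L2 M" by (rule bounded_op_L2[OF A g])
  have L: "(\<lambda>y. t * ?g y - A ?g y) \<in> L2 M" "(\<lambda>y. (t - s) * ?g y) \<in> L2 M"
    by (intro L2_diff L2_scale g Ag)+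
  note lR = bounded_op_linear[OF R(2)]
  have "AE x in M. Rt (\<lambda>y. t * ?g y - A ?g y) x = Rt (\<lambda>y. f y + (t - s) * ?g y) x"
  proof (rule bounded_op_cong[OF R(2) L(1) L2_add[OF f L(2)]])
    show "AE x in M. t * ?g x - A ?g x = f x + (t - s) * ?g x"
      using s
    proof eventually_elim
      case (elim x)
      show ?case unfolding elim[symmetric] by (simp add: algebra_simps)
    qed
  qed
  with t[OF g] linear_opD(3)[OF lR f L(2)] linear_opD(4)[OF lR g, of "t - s"] show ?thesis
    by eventually_elim simp
qed

text \<open>Since \<open>u\<close> and \<open>T w\<close> are nonnegative, the equation contains
  \<open>u \<le> s w\<close> and \<open>T w \<le> s w\<close>; applying \<open>T\<close> repeatedly
  to the first and using the second closes the induction. Here \<open>w\<close> stands for the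
  resolvent at \<open>s\<close> applied to \<open>u\<close>.\<close>

lemma nonneg_resolvent_power_le:
  assumes T: "pos_op M T" and u: "u \<in> pL M" and w: "w \<in> pL M" and s: "0 < s"
    and eq: "AE x in M. s * w x = u x + absop T w x"
  shows "AE x in M. absop (T ^^ k) u x \<le> s ^ Suc k * w x"
proof (induction k)
  case 0
  show ?case using eq by eventually_elim (simp add: absop_def pLD(2)[OF u] abs_of_nonneg del: of_real_add)
next
  case (Suc k)
  have sc: "(\<lambda>x. s ^ Suc k * w x) \<in> pL M"
    using pLD[OF w] s by (auto simp: pL_def power_mult_distrib simp del: power_Suc)
  have "AE x in M. absop T (absop (T ^^ k) u) x \<le> absop T (\<lambda>x. s ^ Suc k * w x) x"
    by (rule absop_mono[OF T absop_pL[OF pos_op_funpow[OF T] u] sc Suc.IH])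
  moreover have "AE x in M. absop T (\<lambda>x. s ^ Suc k * w x) x = s ^ Suc k * absop T w x"
    using linear_opD(4)[OF bounded_op_linear[OF pos_opD(1)[OF T]] cr_L2[OF w], of "complex_of_real (s ^ Suc k)"]
    by eventually_elim (use s in \<open>simp add: absop_def norm_mult norm_power\<close>)
  moreover have "AE x in M. absop (T ^^ Suc k) u x = absop T (absop (T ^^ k) u) x"
    using absop_comp(1)[OF T pos_op_funpow[OF T] u, of k] by simp
  ultimately show ?case using eq
  proof eventually_elim
    case (elim x)
    have "s ^ Suc k * absop T w x \<le> s ^ Suc k * (s * w x)"
      using elim(4) pLD(2)[OF u, of x] s by (intro mult_left_mono) auto
    with elim(1,2,3) have "absop (T ^^ Suc k) u x \<le> s ^ Suc k * (s * w x)" by linarith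
    then show ?case by (simp add: mult_ac comp_def)
  qed
qed

lemma pos_op_power_norm_le:
  assumes T: "pos_op M T" and C: "0 \<le> C"
    and u: "\<And>u. u \<in> pL M \<Longrightarrow> \<exists>w\<in>pL M. l2_norm M (cr w) \<le> C * l2_norm M (cr u) \<and>
      (AE x in M. absop (T ^^ k) u x \<le> a * w x)" and a: "0 \<le> a"
  shows "op_norm M (T ^^ k) \<le> C * a"
proof (rule op_norm_least)
  fix f assume f: "f \<in> L2 M"
  note P = pos_op_funpow[OF T, of k]
  obtain w where w: "w \<in> pL M" "l2_norm M (cr w) \<le> C * l2_norm M (cr (\<lambda>x. cmod (f x)))"
    "AE x in M. absop (T ^^ k) (\<lambda>x. cmod (f x)) x \<le> a * w x"
    using u[OF cmod_pL[OF f]] by blast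
  have "AE x in M. cmod ((T ^^ k) f x) \<le> cmod (complex_of_real a * complex_of_real (w x))"
    using pos_op_cmod_le[OF P f] w(3)
    by eventually_elim (use pLD(2)[OF w(1)] a in \<open>simp add: norm_mult abs_mult abs_of_nonneg\<close>)
  then have "l2_norm M ((T ^^ k) f) \<le> l2_norm M (\<lambda>x. complex_of_real a * complex_of_real (w x))"
    by (rule l2_norm_mono(2)[OF L2_scale[OF cr_L2[OF w(1)]] L2D(1)[OF bounded_op_L2[OF pos_opD(1)[OF P] f]]])
  also have "\<dots> = a * l2_norm M (cr w)" unfolding l2_norm_scale using a by simp
  also have "\<dots> \<le> a * (C * l2_norm M f)" using w(2) a by (intro mult_left_mono) (auto simp: l2_norm_cmod)
  finally show "l2_norm M ((T ^^ k) f) \<le> C * a * l2_norm M f" by (simp add: mult_ac)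
qed (use C a in auto)

text \<open>
  Positivity of the resolvent at \<open>s > r\<close> is obtained by continuation along the real axis: it
  holds for large \<open>s\<close>, and it propagates downwards over intervals whose length is controlled by
  the norm of the resolvent, which is locally bounded.
\<close>

lemma positive_resolvent:
  fixes R :: "real \<Rightarrow> 'a l2op"
  assumes T: "pos_op M T" and r: "0 \<le> r"
    and R: "\<And>s. r < s \<Longrightarrow> bounded_op M (R s)"
    and Rl: "\<And>s f. r < s \<Longrightarrow> f \<in> L2 M \<Longrightarrow> AE x in M. R s (\<lambda>t. complex_of_real s * f t - T f t) x = f x"
    and Rr: "\<And>s f. r < s \<Longrightarrow> f \<in> L2 M \<Longrightarrow> AE x in M. complex_of_real s * R s f x - T (R s f) x = f x"
    and s0: "r < s0"
  shows "cone_pos M (R s0)"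
proof -
  note bT = pos_opD(1)[OF T]
  note RL = bounded_op_L2[OF R]
  have ident: "AE x in M. R s f x = R t f x + complex_of_real (t - s) * R t (R s f) x"
    if "r < s" "r < t" "f \<in> L2 M" for s t f
    using resolvent_identity[OF bT R[OF that(1)] R[OF that(2)] that(3) Rr[OF that(1,3)] Rl[OF that(2)]]
    by simp
  \<comment> \<open>For \<open>s\<close> beyond the norm the resolvent solves
    \<open>g = u / s + (1 / s) T g\<close>, a contraction.\<close>
  have large: "cone_pos M (R s)" if s: "r < s" "op_norm M T < s" for s
    unfolding cone_pos_def
  proof
    fix u assume u: "u \<in> pL M"
    have sp: "s > 0" using s r by simp
    have us: "(\<lambda>x. u x / s) \<in> pL M" using u sp by (auto simp: pL_def power_divide)
    have "AE x in M. R s (cr u) x = complex_of_real (cmod (R s (cr u) x))"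
    proof (rule cone_fixpoint_nonneg[OF bT cone_pos_pos_op[OF T], where c="1/s" and p="\<lambda>x. u x / s"])
      show "AE x in M. R s (cr u) x = complex_of_real (u x / s) + complex_of_real (1 / s) * T (R s (cr u)) x"
        using Rr[OF s(1) cr_L2[OF u]] by eventually_elim (use sp in \<open>simp add: field_simps\<close>)
    qed (use sp s us RL[OF s(1) cr_L2[OF u]] in auto)
    then show "AE x in M. R s (cr u) x = complex_of_real (absop (R s) u x)"
      by (simp add: absop_def)
  qed
  \<comment> \<open>The resolvent identity is a fixpoint equation for \<open>R s u\<close> with
    operator \<open>R t\<close>, factor \<open>t - s\<close> and inhomogeneity
    \<open>R t u\<close>.\<close>
  have down: "cone_pos M (R s)" if s: "r < s" "s \<le> t" and t: "cone_pos M (R t)"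
    and st: "(t - s) * op_norm M (R t) < 1" for s t
    unfolding cone_pos_def
  proof
    fix u assume u: "u \<in> pL M"
    have rt: "r < t" using s by simp
    note uL = cr_L2[OF u]
    have p: "absop (R t) u \<in> pL M" unfolding absop_def by (rule cmod_pL[OF RL[OF rt uL]])
    have "AE x in M. R s (cr u) x = complex_of_real (cmod (R s (cr u) x))"
    proof (rule cone_fixpoint_nonneg[OF R[OF rt] t _ st p RL[OF s(1) uL]])
      show "AE x in M. R s (cr u) x
          = complex_of_real (absop (R t) u x) + complex_of_real (t - s) * R t (R s (cr u)) x"
        using ident[OF s(1) rt uL] cone_posD[OF t u] by eventually_elim simp
    qed (use s in simp)
    then show "AE x in M. R s (cr u) x = complex_of_real (absop (R s) u x)"
      by (simp add: absop_def)
  qed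
  \<comment> \<open>In the resolvent identity the term with \<open>R s f\<close> on the right has
    coefficient at most 1/2 and is absorbed on the left.\<close>
  have norm2: "op_norm M (R s) \<le> 2 * op_norm M (R t)"
    if s: "r < s" and t: "r < t" and st: "\<bar>t - s\<bar> * op_norm M (R t) \<le> 1/2" for s t
  proof (rule op_norm_least)
    fix f assume f: "f \<in> L2 M"
    have L: "R s f \<in> L2 M" "R t f \<in> L2 M" "R t (R s f) \<in> L2 M"
      using RL[OF s f] RL[OF t f] RL[OF t RL[OF s f]] .
    have "l2_norm M (R s f) = l2_norm M (\<lambda>x. R t f x + complex_of_real (t - s) * R t (R s f) x)"
      by (rule l2_norm_cong_AE[OF L2D(1)[OF L(1)] L2D(1)[OF L2_add[OF L(2) L2_scale[OF L(3)]]] ident[OF s t f]])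
    also have "\<dots> \<le> l2_norm M (R t f) + l2_norm M (\<lambda>x. complex_of_real (t - s) * R t (R s f) x)"
      by (rule l2_norm_triangle[OF L(2) L2_scale[OF L(3)]])
    also have "\<dots> \<le> op_norm M (R t) * l2_norm M f + \<bar>t - s\<bar> * (op_norm M (R t) * l2_norm M (R s f))"
      unfolding l2_norm_scale norm_of_real
      by (intro add_mono mult_left_mono l2_norm_apply_le R s t f L) auto
    also have "\<bar>t - s\<bar> * (op_norm M (R t) * l2_norm M (R s f)) \<le> 1/2 * l2_norm M (R s f)"
      using mult_right_mono[OF st l2_norm_nonneg[of M "R s f"]] by (simp add: mult_ac)
    finally show "l2_norm M (R s f) \<le> 2 * op_norm M (R t) * l2_norm M f" by simp
  qed (use op_norm_nonneg[OF R[OF t]] in simp)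
  define N where "N = {s. s0 \<le> s \<and> (\<forall>t\<ge>s. cone_pos M (R t))}"
  have Nne: "max s0 (op_norm M T + 1) \<in> N"
  proof -
    have "cone_pos M (R t)" if "max s0 (op_norm M T + 1) \<le> t" for t
      using large[of t] that s0 by simp
    then show ?thesis unfolding N_def by (intro CollectI conjI allI impI) auto
  qed
  have Nbdd: "bdd_below N" by (rule bdd_belowI[of _ s0]) (simp add: N_def)
  define t0 where "t0 = Inf N"
  have t0: "s0 \<le> t0" unfolding t0_def using Nne by (intro cInf_greatest) (blast, simp add: N_def)
  have rt0: "r < t0" using s0 t0 by simp
  define \<rho> where "\<rho> = op_norm M (R t0)"
  have \<rho>: "0 \<le> \<rho>" unfolding \<rho>_def by (rule op_norm_nonneg[OF R[OF rt0]])
  \<comment> \<open>For \<open>t\<close> within \<epsilon> of \<open>t0\<close> the norm of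
    \<open>R t\<close> is at most \<open>2 * \<rho>\<close>, and from there positivity reaches down
    over a length of at most \<open>2 * \<epsilon>\<close>: the product is at most
    \<open>4 * \<epsilon> * \<rho> \<le> 1/2\<close>. Adding 1 to \<rho> keeps the denominator
    positive.\<close>
  define \<epsilon> where "\<epsilon> = 1 / (8 * (\<rho> + 1))"
  have \<epsilon>: "\<epsilon> > 0" "\<epsilon> * \<rho> \<le> 1/8" using \<rho> by (auto simp: \<epsilon>_def field_simps)
  obtain t where t: "t \<in> N" "t < t0 + \<epsilon>"
    using cInf_lessD[of N "t0 + \<epsilon>"] Nne \<epsilon>(1) unfolding t0_def by auto
  have tt0: "t0 \<le> t" unfolding t0_def by (rule cInf_lower[OF t(1) Nbdd])
  have rt: "r < t" using rt0 tt0 by simp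
  have "(t0 - t) * \<rho> \<le> 0" "(t - t0) * \<rho> \<le> \<epsilon> * \<rho>" using t tt0 \<rho>
    by (auto simp: mult_le_0_iff intro!: mult_right_mono)
  then have nt: "op_norm M (R t) \<le> 2 * \<rho>"
    unfolding \<rho>_def using \<epsilon>(2) tt0 by (intro norm2[OF rt rt0]) (simp add: \<rho>_def abs_if)
  have pos: "cone_pos M (R s)" if s: "max s0 (t0 - \<epsilon>/2) \<le> s" for s
  proof (cases "s \<le> t")
    case True
    have "(t - s) * op_norm M (R t) \<le> (2 * \<epsilon>) * (2 * \<rho>)"
      using t s nt True \<epsilon> op_norm_nonneg[OF R[OF rt]] by (intro mult_mono) auto
    also have "\<dots> < 1" using \<epsilon>(2) by simp
    finally have "(t - s) * op_norm M (R t) < 1" .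
    then show ?thesis using down[of s t] True s s0 t(1) unfolding N_def by auto
  next
    case False
    then show ?thesis using t(1) unfolding N_def by auto
  qed
  \<comment> \<open>A point of \<open>N\<close> below its infimum is impossible, so the cut-off at
    \<open>s0\<close> must be active.\<close>
  have "max s0 (t0 - \<epsilon>/2) \<in> N" unfolding N_def using pos by auto
  then have "t0 \<le> max s0 (t0 - \<epsilon>/2)" unfolding t0_def by (rule cInf_lower[OF _ Nbdd])
  then have "t0 = s0" using \<epsilon>(1) t0 by auto
  then show ?thesis using pos[of s0] \<epsilon>(1) by auto
qed

text \<open>With \<open>w = R s u\<close>, which is nonnegative, the resolvent equation reads
  \<open>s w = u + T w\<close>, so \<open>(T ^^ k) u\<close> stays below
  \<open>s ^ Suc k * w\<close>. Only real points of the resolvent set are used, where complex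
  analysis would use a whole circle.\<close>

lemma pos_op_power_bound:
  assumes T: "pos_op M T" and r: "0 \<le> r"
    and spec: "\<And>s. r < s \<Longrightarrow> complex_of_real s \<notin> l2_spectrum M T" and s: "r < s"
  shows "\<exists>C>0. \<forall>k. op_norm M (T ^^ k) \<le> C * s ^ k"
proof -
  note bT = pos_opD(1)[OF T]
  have "\<forall>s\<in>{r<..}. \<exists>R. bounded_op M R \<and>
     (\<forall>f\<in>L2 M. (AE x in M. R (\<lambda>t. complex_of_real s * f t - T f t) x = f x) \<and>
                (AE x in M. complex_of_real s * R f x - T (R f) x = f x))"
    using spec unfolding l2_spectrum_iff by blast
  from bchoice[OF this] obtain R where
    "\<forall>s\<in>{r<..}. bounded_op M (R s) \<and>
     (\<forall>f\<in>L2 M. (AE x in M. R s (\<lambda>t. complex_of_real s * f t - T f t) x = f x) \<and>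
                (AE x in M. complex_of_real s * R s f x - T (R s f) x = f x))"
    by blast
  then have R: "\<And>s. r < s \<Longrightarrow> bounded_op M (R s)"
    and Rl: "\<And>s f. r < s \<Longrightarrow> f \<in> L2 M \<Longrightarrow> AE x in M. R s (\<lambda>t. complex_of_real s * f t - T f t) x = f x"
    and Rr: "\<And>s f. r < s \<Longrightarrow> f \<in> L2 M \<Longrightarrow> AE x in M. complex_of_real s * R s f x - T (R s f) x = f x"
    by simp_all
  have pos: "cone_pos M (R s)" by (rule positive_resolvent[OF T r R Rl Rr s])
  have sp: "s > 0" using s r by simp
  let ?N = "op_norm M (R s)"
  have N: "0 \<le> ?N" by (rule op_norm_nonneg[OF R[OF s]])
  have "op_norm M (T ^^ k) \<le> ?N * s ^ Suc k" for k
  proof (rule pos_op_power_norm_le[OF T N])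
    fix u assume u: "u \<in> pL M"
    let ?w = "absop (R s) u"
    have RL: "R s (cr u) \<in> L2 M" by (rule bounded_op_L2[OF R[OF s] cr_L2[OF u]])
    have w: "?w \<in> pL M" unfolding absop_def by (rule cmod_pL[OF RL])
    have "AE x in M. T (R s (cr u)) x = T (cr ?w) x"
      by (rule bounded_op_cong[OF bT RL cr_L2[OF w] cone_posD[OF pos u]])
    with Rr[OF s cr_L2[OF u]] cone_posD[OF pos u] pos_opD(2)[OF T w]
    have "AE x in M. s * ?w x = u x + absop T ?w x"
    proof eventually_elim
      case (elim x)
      have "complex_of_real (s * ?w x) = complex_of_real (u x + absop T ?w x)"
        using elim by (simp add: algebra_simps)
      then show ?case by (simp only: of_real_eq_iff)
    qed
    from nonneg_resolvent_power_le[OF T u w sp this]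
    have "AE x in M. absop (T ^^ k) u x \<le> s ^ Suc k * ?w x" .
    moreover have "l2_norm M (cr ?w) \<le> ?N * l2_norm M (cr u)"
      unfolding l2_norm_absop by (rule l2_norm_apply_le[OF R[OF s] cr_L2[OF u]])
    ultimately show "\<exists>w\<in>pL M. l2_norm M (cr w) \<le> ?N * l2_norm M (cr u) \<and>
      (AE x in M. absop (T ^^ k) u x \<le> s ^ Suc k * w x)" using w by blast
  qed (use sp in simp)
  \<comment> \<open>Adding 1 makes the constant positive even when the resolvent has norm 0, as on a
    trivial space.\<close>
  then have "op_norm M (T ^^ k) \<le> (?N * s + 1) * s ^ k" for k
    by (rule order_trans) (use sp in \<open>simp add: algebra_simps\<close>)
  moreover have "?N * s + 1 > 0" using N sp by (simp add: add_nonneg_pos)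
  ultimately show ?thesis by blast
qed

section \<open>The spectral radius formula\<close>

lemma op_norm_funpow_add:
  assumes "bounded_op M A"
  shows "op_norm M (A ^^ (m + k)) \<le> op_norm M (A ^^ m) * op_norm M (A ^^ k)"
  unfolding funpow_add by (rule op_norm_comp[OF bounded_op_funpow bounded_op_funpow]) (rule assms)+

text \<open>The Neumann series excludes spectrum beyond the limit \<open>L\<close>; conversely
  \<open>pos_op_power_bound\<close> gives \<open>L \<le> s\<close> for every \<open>s\<close> above
  the spectral radius. Boundedness of the spectrum is recorded as well, since otherwise the real
  supremum in \<open>spectral_rad\<close> would say nothing.\<close>

lemma spectral_radius_formula:
  assumes T: "pos_op M T"
  shows "(\<lambda>k. root k (op_norm M (T ^^ k))) \<longlonglongrightarrow> spectral_rad M T"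
    and "bdd_above (cmod ` l2_spectrum M T)"
proof -
  note bT = pos_opD(1)[OF T]
  have nn: "0 \<le> op_norm M (T ^^ k)" for k by (rule op_norm_nonneg[OF bounded_op_funpow[OF bT]])
  obtain L where L: "0 \<le> L" "(\<lambda>k. root k (op_norm M (T ^^ k))) \<longlonglongrightarrow> L"
    using Fekete_root[of "\<lambda>k. op_norm M (T ^^ k)"] nn op_norm_funpow_add[OF bT] by blast
  have le: "cmod z \<le> L" if z: "z \<in> l2_spectrum M T" for z
  proof (rule ccontr)
    assume "\<not> cmod z \<le> L"
    then obtain q where q: "L < q" "q < cmod z" using dense[of L "cmod z"] by auto
    have q0: "q > 0" using L q by simp
    from order_tendstoD(2)[OF L(2) q(1)] obtain N where
      N: "\<And>k. k \<ge> N \<Longrightarrow> root k (op_norm M (T ^^ k)) < q"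
      by (auto simp: eventually_sequentially)
    \<comment> \<open>The finitely many powers before the root bound sets in are absorbed into the
      constant.\<close>
    define C where "C = 1 + (\<Sum>k\<le>N. op_norm M (T ^^ k) / q ^ k)"
    have C1: "C \<ge> 1" unfolding C_def using q0 nn by (auto intro!: sum_nonneg)
    have "op_norm M (T ^^ k) \<le> C * q ^ k" for k
    proof (cases "k \<le> N")
      case True
      then have "op_norm M (T ^^ k) / q ^ k \<le> (\<Sum>k\<le>N. op_norm M (T ^^ k) / q ^ k)"
        using nn q0 by (intro member_le_sum) auto
      then have "op_norm M (T ^^ k) / q ^ k \<le> C" by (simp add: C_def)
      then show ?thesis using q0 by (simp add: pos_divide_le_eq)
    next
      case False
      then have k: "k > 0" "k \<ge> N" by auto
      have "op_norm M (T ^^ k) = root k (op_norm M (T ^^ k)) ^ k"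
        using nn k by (simp add: real_root_pow_pos2)
      also have "\<dots> \<le> q ^ k" using N[OF k(2)] nn k by (intro power_mono) auto
      also have "\<dots> \<le> C * q ^ k" using C1 q0 by simp
      finally show ?thesis .
    qed
    from Neumann_series[OF bT this _ q(2)] q0 z show False by auto
  qed
  then show bdd: "bdd_above (cmod ` l2_spectrum M T)" by (intro bdd_aboveI[of _ L]) auto
  have "spectral_rad M T \<le> L"
    unfolding spectral_rad_def by (rule sup0_least[OF L(1)]) (use le in auto)
  moreover have "L \<le> spectral_rad M T"
  proof (rule dense_ge)
    fix s assume s: "spectral_rad M T < s"
    have r0: "0 \<le> spectral_rad M T" unfolding spectral_rad_def by (rule sup0_nonneg[OF bdd])
    have "complex_of_real t \<notin> l2_spectrum M T" if t: "spectral_rad M T < t" for t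
    proof
      assume "complex_of_real t \<in> l2_spectrum M T"
      then have "cmod (complex_of_real t) \<le> spectral_rad M T"
        unfolding spectral_rad_def by (intro sup0_upper[OF bdd] imageI)
      then show False using t by simp
    qed
    from pos_op_power_bound[OF T r0 this s] obtain C where
      C: "C > 0" "\<And>k. op_norm M (T ^^ k) \<le> C * s ^ k" by blast
    have sp: "s > 0" using r0 s by simp
    have "(\<lambda>k. root k C * s) \<longlonglongrightarrow> 1 * s" by (intro tendsto_mult LIMSEQ_root_const C tendsto_const)
    moreover have "\<forall>\<^sub>F k in sequentially. root k (op_norm M (T ^^ k)) \<le> root k C * s"
      using eventually_gt_at_top[of 0]
    proof eventually_elim
      case (elim k)
      have "root k (op_norm M (T ^^ k)) \<le> root k (C * s ^ k)" using C(2) elim by simp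
      also have "\<dots> = root k C * s" using elim sp by (simp add: real_root_mult real_root_power_cancel)
      finally show ?case .
    qed
    ultimately show "L \<le> s" using tendsto_le[OF sequentially_bot _ L(2)] by fastforce
  qed
  ultimately show "(\<lambda>k. root k (op_norm M (T ^^ k))) \<longlonglongrightarrow> spectral_rad M T" using L(2) by simp
qed

section \<open>Measure of non-compactness and domination\<close>

definition cut :: "'a set \<Rightarrow> ('a \<Rightarrow> 'b::zero) \<Rightarrow> 'a \<Rightarrow> 'b" where
  "cut H f = (\<lambda>x. if x \<in> H then f x else 0)"

lemma cut_measurable [measurable (raw)]:
  fixes f :: "'a \<Rightarrow> 'b::{zero,topological_space}"
  assumes "H \<in> sets M" "f \<in> borel_measurable M"
  shows "cut H f \<in> borel_measurable M"
  unfolding cut_def using assms by (intro measurable_If_set) (auto intro: sets.Int_space_eq2)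

lemma cut_L2:
  assumes "H \<in> sets M" "f \<in> L2 M"
  shows "cut H f \<in> L2 M" "l2_norm M (cut H f) \<le> l2_norm M f"
proof -
  have "cut H f \<in> borel_measurable M" using assms by (auto simp: L2_def intro: cut_measurable)
  moreover have "AE x in M. cmod (cut H f x) \<le> cmod (f x)" by (simp add: cut_def)
  ultimately show "cut H f \<in> L2 M" "l2_norm M (cut H f) \<le> l2_norm M f"
    using l2_norm_mono[OF assms(2)] by auto
qed

lemma cut_compl_L2:
  assumes "H \<in> sets M" "f \<in> L2 M"
  shows "(\<lambda>x. f x - cut H f x) \<in> L2 M"
  by (rule L2_diff[OF assms(2) cut_L2(1)[OF assms]])

text \<open>AM-compactness in the sense of Banach lattices: the image of every order interval is
  totally bounded.\<close>

definition am_compact :: "'a measure \<Rightarrow> 'a l2op \<Rightarrow> bool" where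
  "am_compact M T \<longleftrightarrow> (\<forall>u\<in>pL M. \<forall>e>0. \<exists>F. finite F \<and> F \<subseteq> L2 M \<and>
     (\<forall>f\<in>L2 M. (AE x in M. cmod (f x) \<le> u x) \<longrightarrow> (\<exists>g\<in>F. l2_norm M (\<lambda>x. T f x - g x) \<le> e)))"

lemma am_compactE:
  assumes "am_compact M T" "u \<in> pL M" "0 < e"
  obtains F where "finite F" "F \<subseteq> L2 M"
    "\<And>f. f \<in> L2 M \<Longrightarrow> AE x in M. cmod (f x) \<le> u x \<Longrightarrow> \<exists>g\<in>F. l2_norm M (\<lambda>x. T f x - g x) \<le> e"
proof -
  from bspec[OF assms(1)[unfolded am_compact_def] assms(2), rule_format, OF assms(3)]
  obtain F where F: "finite F" "F \<subseteq> L2 M"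
    "\<forall>f\<in>L2 M. (AE x in M. cmod (f x) \<le> u x) \<longrightarrow> (\<exists>g\<in>F. l2_norm M (\<lambda>x. T f x - g x) \<le> e)"
    by (elim exE conjE)
  show ?thesis by (rule that[OF F(1,2) F(3)[rule_format]])
qed

text \<open>A positive \<open>B\<close> maps the order interval of \<open>u\<close> into that of
  \<open>absop B u\<close>, so compactness of the left factor is inherited by the product.\<close>

lemma am_compact_comp:
  assumes "am_compact M A" "pos_op M B"
  shows "am_compact M (A \<circ> B)"
  unfolding am_compact_def
proof (intro ballI allI impI)
  fix u and e :: real assume u: "u \<in> pL M" and e: "e > 0"
  obtain F where F: "finite F" "F \<subseteq> L2 M"
    "\<And>f. f \<in> L2 M \<Longrightarrow> AE x in M. cmod (f x) \<le> absop B u x \<Longrightarrow> \<exists>g\<in>F. l2_norm M (\<lambda>x. A f x - g x) \<le> e"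
    using am_compactE[OF assms(1) absop_pL[OF assms(2) u] e] by metis
  have "\<exists>g\<in>F. l2_norm M (\<lambda>x. (A \<circ> B) f x - g x) \<le> e"
    if f: "f \<in> L2 M" "AE x in M. cmod (f x) \<le> u x" for f
    using F(3)[OF bounded_op_L2[OF pos_opD(1)[OF assms(2)] f(1)] pos_opD(3)[OF assms(2) f(1) u f(2)]]
    by simp
  then show "\<exists>F. finite F \<and> F \<subseteq> L2 M \<and>
     (\<forall>f\<in>L2 M. (AE x in M. cmod (f x) \<le> u x) \<longrightarrow> (\<exists>g\<in>F. l2_norm M (\<lambda>x. (A \<circ> B) f x - g x) \<le> e))"
    using F(1,2) by blast
qed

text \<open>A weight is the density of a finite measure equivalent to \<open>M\<close>; it measures how small a set is.\<close>

definition weight :: "'a measure \<Rightarrow> ('a \<Rightarrow> real) \<Rightarrow> bool" where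
  "weight M h \<longleftrightarrow> h \<in> borel_measurable M \<and> (\<forall>x. 0 < h x) \<and> integrable M h"

text \<open>The square of \<open>u\<close> is at most \<open>n h\<close> plus the excess
  \<open>\<phi> n\<close>. The integral of the excess tends to 0 by dominated convergence, and over
  \<open>H\<close> the other part contributes at most \<open>n\<close> times the weight of
  \<open>H\<close>.\<close>

lemma cut_absolutely_continuous:
  assumes h: "weight M h" and u: "u \<in> pL M" and e: "e > 0"
  shows "\<exists>\<eta>>0. \<forall>H\<in>sets M. (\<integral>x. cut H h x \<partial>M) < \<eta> \<longrightarrow> l2_norm M (cr (cut H u)) \<le> e"
proof -
  have [measurable]: "h \<in> borel_measurable M" "u \<in> borel_measurable M" and h0: "\<And>x. 0 < h x"
    and hi: "integrable M h" and ui: "integrable M (\<lambda>x. (u x)\<^sup>2)"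
    using h pLD[OF u] by (auto simp: weight_def)
  define \<phi> where "\<phi> = (\<lambda>n x. (u x)\<^sup>2 - min ((u x)\<^sup>2) (real n * h x))"
  have \<phi>0: "0 \<le> \<phi> n x" "\<phi> n x \<le> (u x)\<^sup>2" for n x
    unfolding \<phi>_def using h0[of x] by (auto simp: min_def)
  have "(\<lambda>n. \<integral>x. \<phi> n x \<partial>M) \<longlonglongrightarrow> (\<integral>x. 0 \<partial>M)"
  proof (rule integral_dominated_convergence[OF _ _ ui])
    show "AE x in M. (\<lambda>n. \<phi> n x) \<longlonglongrightarrow> 0"
    proof (rule AE_I2)
      fix x
      obtain N :: nat where N: "(u x)\<^sup>2 / h x \<le> N" using real_arch_simple by blast
      have "\<phi> n x = 0" if "n \<ge> N" for n
      proof -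
        have "(u x)\<^sup>2 / h x \<le> real n" using N that by (meson of_nat_le_iff order_trans)
        then have "(u x)\<^sup>2 \<le> real n * h x" using h0[of x] by (simp add: pos_divide_le_eq)
        then show ?thesis by (simp add: \<phi>_def)
      qed
      then show "(\<lambda>n. \<phi> n x) \<longlonglongrightarrow> 0"
        by (intro tendsto_eventually eventually_sequentiallyI[of N]) auto
    qed
  qed (use \<phi>0 in \<open>auto simp: \<phi>_def\<close>)
  then have "\<forall>\<^sub>F n in sequentially. (\<integral>x. \<phi> n x \<partial>M) < e\<^sup>2 / 2"
    using e by (auto dest: order_tendstoD(2)[of _ _ _ "e\<^sup>2/2"])
  then obtain n where n: "(\<integral>x. \<phi> n x \<partial>M) < e\<^sup>2 / 2"
    by (auto simp: eventually_sequentially)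
  have \<phi>i: "integrable M (\<phi> n)"
    by (rule Bochner_Integration.integrable_bound[OF ui]) (use \<phi>0 in \<open>auto simp: \<phi>_def\<close>)
  \<comment> \<open>Each of the two parts is allowed half of \<open>e^2\<close>; the summand 1 in
    the denominator covers \<open>n = 0\<close>.\<close>
  show ?thesis
  proof (intro exI[of _ "e\<^sup>2 / (2 * (real n + 1))"] conjI ballI impI)
    show "e\<^sup>2 / (2 * (real n + 1)) > 0" using e by simp
    fix H assume H[measurable]: "H \<in> sets M" and m: "(\<integral>x. cut H h x \<partial>M) < e\<^sup>2 / (2 * (real n + 1))"
    have ci: "integrable M (cut H h)"
      by (rule Bochner_Integration.integrable_bound[OF hi]) (use h0 in \<open>auto simp: cut_def less_imp_le\<close>)
    have m0: "0 \<le> (\<integral>x. cut H h x \<partial>M)" using h0 by (intro Bochner_Integration.integral_nonneg) (auto simp: cut_def less_imp_le)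
    have "(\<integral>x. (cut H u x)\<^sup>2 \<partial>M) \<le> (\<integral>x. real n * cut H h x + \<phi> n x \<partial>M)"
    proof (rule integral_mono_AE')
      show "AE x in M. (cut H u x)\<^sup>2 \<le> real n * cut H h x + \<phi> n x"
        using \<phi>0 by (auto simp: cut_def \<phi>_def min_def)
      show "AE x in M. 0 \<le> real n * cut H h x + \<phi> n x"
        using \<phi>0 h0 by (intro AE_I2) (auto simp: cut_def less_imp_le)
    qed (use ci \<phi>i in auto)
    also have "\<dots> = real n * (\<integral>x. cut H h x \<partial>M) + (\<integral>x. \<phi> n x \<partial>M)" using ci \<phi>i by simp
    also have "\<dots> \<le> (real n + 1) * (e\<^sup>2 / (2 * (real n + 1))) + e\<^sup>2 / 2"
      using m n m0 by (intro add_mono mult_mono) auto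
    also have "\<dots> = e\<^sup>2" by (simp add: field_simps)
    finally have "sqrt (\<integral>x. (cut H u x)\<^sup>2 \<partial>M) \<le> e" using e by (intro real_le_lsqrt) auto
    then show "l2_norm M (cr (cut H u)) \<le> e" by (simp add: l2_norm_cr)
  qed
qed

lemma l2_inner_cut:
  assumes "H \<in> sets M" "f \<in> L2 M" "g \<in> L2 M"
  shows "cmod (l2_inner M (cut H f) g) \<le> l2_norm M f * l2_norm M (cut H g)"
proof -
  have "l2_inner M (cut H f) g = l2_inner M f (cut H g)"
    unfolding l2_inner_def by (rule Bochner_Integration.integral_cong) (auto simp: cut_def)
  then show ?thesis using l2_inner_le(3)[OF assms(2) cut_L2(1)[OF assms(1,3)]] by simp
qed

lemma finite_uniform_cut:
  assumes h: "weight M h" and F: "finite F" "F \<subseteq> L2 M" and e: "e > 0"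
  shows "\<exists>\<eta>>0. \<forall>H\<in>sets M. (\<integral>x. cut H h x \<partial>M) < \<eta> \<longrightarrow> (\<forall>g\<in>F. l2_norm M (cut H g) \<le> e)"
  using F
proof (induction F)
  case empty
  show ?case by (auto intro: exI[of _ 1])
next
  case (insert g F)
  from insert obtain \<eta> where \<eta>: "\<eta> > 0"
    "\<And>H. H \<in> sets M \<Longrightarrow> (\<integral>x. cut H h x \<partial>M) < \<eta> \<Longrightarrow> \<forall>g\<in>F. l2_norm M (cut H g) \<le> e" by auto
  have g: "g \<in> L2 M" using insert by simp
  obtain \<eta>' where \<eta>': "\<eta>' > 0"
    "\<And>H. H \<in> sets M \<Longrightarrow> (\<integral>x. cut H h x \<partial>M) < \<eta>' \<Longrightarrow> l2_norm M (cr (cut H (\<lambda>x. cmod (g x)))) \<le> e"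
    using cut_absolutely_continuous[OF h cmod_pL[OF g] e] by blast
  have eq: "l2_norm M (cr (cut H (\<lambda>x. cmod (g x)))) = l2_norm M (cut H g)" for H
    by (simp add: l2_norm_def cut_def if_distrib[of cmod] if_distrib[of abs] cong: if_cong)
  show ?case
    by (rule exI[of _ "min \<eta> \<eta>'"]) (use \<eta> \<eta>' in \<open>auto simp: eq\<close>)
qed

section \<open>The measure of non-compactness through small sets\<close>

text \<open>The image \<open>p\<close> of a cut function is within \<delta> of some \<open>g\<close>
  in a finite net. Its inner product with \<open>g\<close> moves to \<open>E' g\<close>, and the
  finitely many functions \<open>E' g\<close> are uniformly small on small sets. So the square of
  the norm of \<open>p\<close> is at most \<delta> times that norm, up to a small error.\<close>

lemma mnc_small_sets:
  assumes h: "weight M h" and E: "bounded_op M E" "adjoint_of M E E'"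
    and d: "hausdorff_mnc M E < \<delta>" and e: "e > 0"
  shows "\<exists>\<eta>>0. \<forall>H\<in>sets M. (\<integral>x. cut H h x \<partial>M) < \<eta> \<longrightarrow> (\<forall>f\<in>l2_ball M. l2_norm M (E (cut H f)) \<le> \<delta> + e)"
proof -
  obtain F where F: "finite F" "F \<subseteq> L2 M"
    "\<And>f. f \<in> l2_ball M \<Longrightarrow> \<exists>g\<in>F. l2_norm M (\<lambda>x. E f x - g x) \<le> \<delta>"
    using hausdorff_mnc_net[OF E(1) d] by metis
  have \<delta>: "0 < \<delta>" using d hausdorff_mnc_nonneg[OF E(1)] by simp
  have F': "finite (E' ` F)" "E' ` F \<subseteq> L2 M"
    using F bounded_op_L2[OF adjoint_ofD(1)[OF E(2)]] by auto
  have e2: "e\<^sup>2 > 0" using e by simp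
  \<comment> \<open>The tolerance is \<open>e^2\<close> because a norm above
    \<open>\<delta> + e\<close> would make the norm times its excess over \<delta> larger than
    \<open>e * e\<close>.\<close>
  obtain \<eta> where \<eta>: "\<eta> > 0"
    "\<And>H. H \<in> sets M \<Longrightarrow> (\<integral>x. cut H h x \<partial>M) < \<eta> \<Longrightarrow> \<forall>g\<in>E' ` F. l2_norm M (cut H g) \<le> e\<^sup>2"
    using finite_uniform_cut[OF h F' e2] by blast
  have "l2_norm M (E (cut H f)) \<le> \<delta> + e"
    if H: "H \<in> sets M" "(\<integral>x. cut H h x \<partial>M) < \<eta>" and f: "f \<in> l2_ball M" for H f
  proof -
    have fL: "f \<in> L2 M" "l2_norm M f \<le> 1" using f by (auto simp: l2_ball_def)
    note c = cut_L2[OF H(1) fL(1)]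
    define p where "p = E (cut H f)"
    have p: "p \<in> L2 M" unfolding p_def by (rule bounded_op_L2[OF E(1) c(1)])
    obtain g where g: "g \<in> F" "l2_norm M (\<lambda>x. p x - g x) \<le> \<delta>"
      using F(3)[of "cut H f"] c fL unfolding p_def l2_ball_def by force
    have gL: "g \<in> L2 M" using g F by auto
    have E'g: "E' g \<in> L2 M" using F' g by auto
    have "l2_inner M p g = l2_inner M (cut H f) (E' g)"
      unfolding p_def by (rule adjoint_ofD(2)[OF E(2) c(1) gL])
    then have "cmod (l2_inner M p g) \<le> l2_norm M f * l2_norm M (cut H (E' g))"
      using l2_inner_cut[OF H(1) fL(1) E'g] by simp
    also have "\<dots> \<le> 1 * e\<^sup>2" using \<eta>(2)[OF H] g fL by (intro mult_mono) auto
    finally have pg: "cmod (l2_inner M g p) \<le> e\<^sup>2" unfolding l2_inner_cnj[of M g p] by simp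
    have "(l2_norm M p)\<^sup>2 = cmod (l2_inner M p p)" by (simp add: l2_inner_self norm_power)
    also have "l2_inner M p p = l2_inner M (\<lambda>x. p x - g x) p + l2_inner M g p"
      using l2_inner_diff_left[OF p gL p] by simp
    also have "cmod \<dots> \<le> \<delta> * l2_norm M p + e\<^sup>2"
      by (rule norm_triangle_le, rule add_mono[OF order_trans[OF l2_inner_le(3)] pg])
        (use p gL g in \<open>auto intro: L2_diff mult_right_mono\<close>)
    finally have le: "l2_norm M p * (l2_norm M p - \<delta>) \<le> e\<^sup>2" by (simp add: algebra_simps power2_eq_square)
    show ?thesis
    proof (rule ccontr)
      assume "\<not> ?thesis"
      then have gt: "l2_norm M p > \<delta> + e" by (simp add: p_def)
      have "e * e < l2_norm M p * (l2_norm M p - \<delta>)"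
        using gt e \<delta> by (intro mult_strict_mono) auto
      with le show False by (simp add: power2_eq_square)
    qed
  qed
  then show ?thesis using \<eta>(1) by blast
qed

text \<open>The norm of \<open>p = G (cut H f)\<close> is its inner product with the normalised
  \<open>q\<close>, that is, the inner product of \<open>D q\<close> with \<open>cut H f\<close>.
  The net of \<open>D\<close> replaces \<open>D q\<close> by one of finitely many \<open>g\<close>,
  each almost orthogonal to functions living on small sets. The estimate for \<open>G\<close> is
  thus expressed by the non-compactness of \<open>D\<close> itself.\<close>

lemma mnc_small_sets_adjoint:
  assumes h: "weight M h" and D: "bounded_op M D" "adjoint_of M D G"
    and d: "hausdorff_mnc M D < \<delta>" and e: "e > 0"
  shows "\<exists>\<eta>>0. \<forall>H\<in>sets M. (\<integral>x. cut H h x \<partial>M) < \<eta> \<longrightarrow> (\<forall>f\<in>l2_ball M. l2_norm M (G (cut H f)) \<le> \<delta> + e)"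
proof -
  obtain F where F: "finite F" "F \<subseteq> L2 M"
    "\<And>f. f \<in> l2_ball M \<Longrightarrow> \<exists>g\<in>F. l2_norm M (\<lambda>x. D f x - g x) \<le> \<delta>"
    using hausdorff_mnc_net[OF D(1) d] by metis
  have \<delta>: "0 < \<delta>" using d hausdorff_mnc_nonneg[OF D(1)] by simp
  obtain \<eta> where \<eta>: "\<eta> > 0"
    "\<And>H. H \<in> sets M \<Longrightarrow> (\<integral>x. cut H h x \<partial>M) < \<eta> \<Longrightarrow> \<forall>g\<in>F. l2_norm M (cut H g) \<le> e"
    using finite_uniform_cut[OF h F(1,2) e] by blast
  have "l2_norm M (G (cut H f)) \<le> \<delta> + e"
    if H: "H \<in> sets M" "(\<integral>x. cut H h x \<partial>M) < \<eta>" and f: "f \<in> l2_ball M" for H f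
  proof -
    have fL: "f \<in> L2 M" "l2_norm M f \<le> 1" using f by (auto simp: l2_ball_def)
    note c = cut_L2[OF H(1) fL(1)]
    note bG = adjoint_ofD(1)[OF D(2)]
    define p where "p = G (cut H f)"
    have p: "p \<in> L2 M" unfolding p_def by (rule bounded_op_L2[OF bG c(1)])
    show ?thesis
    proof (cases "l2_norm M p = 0")
      case True
      then show ?thesis using \<delta> e by (simp add: p_def)
    next
      case False
      define a where "a = 1 / l2_norm M p"
      define q where "q = (\<lambda>x. complex_of_real a * p x)"
      have q: "q \<in> L2 M" unfolding q_def by (rule L2_scale[OF p])
      have qb: "q \<in> l2_ball M" using q False unfolding l2_ball_def q_def mem_Collect_eq l2_norm_scale
        by (simp add: a_def norm_divide)
      obtain g where g: "g \<in> F" "l2_norm M (\<lambda>x. D q x - g x) \<le> \<delta>" using F(3)[OF qb] by blast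
      have gL: "g \<in> L2 M" using g F by auto
      have Dq: "D q \<in> L2 M" by (rule bounded_op_L2[OF D(1) q])
      have "l2_norm M p = cmod (complex_of_real a * l2_inner M p p)"
        using False by (simp add: l2_inner_self a_def norm_mult norm_power norm_divide power2_eq_square)
      also have "complex_of_real a * l2_inner M p p = l2_inner M q p"
        unfolding q_def by (rule l2_inner_scale_left[symmetric])
      also have "l2_inner M q p = l2_inner M (D q) (cut H f)"
        unfolding p_def by (rule adjoint_ofD(2)[OF D(2) q c(1), symmetric])
      also have "\<dots> = l2_inner M (\<lambda>x. D q x - g x) (cut H f) + l2_inner M g (cut H f)"
        using l2_inner_diff_left[OF Dq gL c(1)] by simp
      also have "cmod \<dots> \<le> \<delta> * 1 + 1 * e"
      proof (rule norm_triangle_le, rule add_mono)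
        have "cmod (l2_inner M (\<lambda>x. D q x - g x) (cut H f)) \<le> l2_norm M (\<lambda>x. D q x - g x) * l2_norm M (cut H f)"
          by (rule l2_inner_le(3)[OF L2_diff[OF Dq gL] c(1)])
        also have "\<dots> \<le> \<delta> * 1" using g c(2) fL \<delta> by (intro mult_mono) auto
        finally show "cmod (l2_inner M (\<lambda>x. D q x - g x) (cut H f)) \<le> \<delta> * 1" .
        have "cmod (l2_inner M g (cut H f)) = cmod (l2_inner M (cut H f) g)"
          unfolding l2_inner_cnj[of M g "cut H f"] by simp
        also have "\<dots> \<le> l2_norm M f * l2_norm M (cut H g)" by (rule l2_inner_cut[OF H(1) fL(1) gL])
        also have "\<dots> \<le> 1 * e" using \<eta>(2)[OF H] g fL by (intro mult_mono) auto
        finally show "cmod (l2_inner M g (cut H f)) \<le> 1 * e" .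
      qed
      finally show ?thesis by (simp add: p_def)
    qed
  qed
  then show ?thesis using \<eta>(1) by blast
qed

text \<open>
  For \<open>f\<close> in the unit ball, \<open>H = {\<bar>f\<bar>\<^sup>2 > n h}\<close> has weight at most \<open>1/n\<close>, and off \<open>H\<close> the function \<open>f\<close>
  lies in the order interval of \<open>sqrt (n h)\<close>, which has a relatively compact image.
\<close>

lemma mnc_le_small_sets:
  assumes h: "weight M h" and T: "bounded_op M T" "am_compact M T" and d: "0 \<le> d" and \<eta>: "\<eta> > 0"
    and small: "\<And>H f. H \<in> sets M \<Longrightarrow> (\<integral>x. cut H h x \<partial>M) < \<eta> \<Longrightarrow> f \<in> l2_ball M \<Longrightarrow> l2_norm M (T (cut H f)) \<le> d"
  shows "hausdorff_mnc M T \<le> d"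
proof (rule field_le_epsilon)
  fix e :: real assume e: "e > 0"
  have [measurable]: "h \<in> borel_measurable M" and h0: "\<And>x. 0 < h x" and hi: "integrable M h"
    using h by (auto simp: weight_def)
  \<comment> \<open>The factor 2 makes \<open>1 / n\<close> strictly smaller than \<eta>.\<close>
  define n where "n = 2 / \<eta>"
  have n: "n > 0" "1 / n < \<eta>" using \<eta> by (auto simp: n_def)
  define u where "u = (\<lambda>x. sqrt (n * h x))"
  have u2: "(u x)\<^sup>2 = n * h x" for x using n h0[of x] by (simp add: u_def)
  have u: "u \<in> pL M" using hi n h0 unfolding pL_def mem_Collect_eq u2
    by (auto simp: u_def less_imp_le)
  obtain F where F: "finite F" "F \<subseteq> L2 M"
    "\<And>f. f \<in> L2 M \<Longrightarrow> AE x in M. cmod (f x) \<le> u x \<Longrightarrow> \<exists>g\<in>F. l2_norm M (\<lambda>x. T f x - g x) \<le> e"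
    using am_compactE[OF T(2) u e] by metis
  show "hausdorff_mnc M T \<le> d + e"
  proof (rule hausdorff_mnc_le[OF _ F(1,2)])
    show "0 < d + e" using d e by simp
    fix f assume f: "f \<in> l2_ball M"
    then have fL: "f \<in> L2 M" "l2_norm M f \<le> 1" by (auto simp: l2_ball_def)
    have [measurable]: "f \<in> borel_measurable M" using fL by (auto simp: L2_def)
    have fi: "integrable M (\<lambda>x. (cmod (f x))\<^sup>2)" using fL by (auto simp: L2_def)
    show Tf: "T f \<in> L2 M" by (rule bounded_op_L2[OF T(1) fL(1)])
    define H where "H = {x \<in> space M. u x < cmod (f x)}"
    have [measurable]: "u \<in> borel_measurable M" using u by (auto simp: pL_def)
    have H: "H \<in> sets M" unfolding H_def by measurable
    have "(\<integral>x. cut H h x \<partial>M) \<le> (\<integral>x. (cmod (f x))\<^sup>2 / n \<partial>M)"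
    proof (rule integral_mono_AE')
      show "AE x in M. cut H h x \<le> (cmod (f x))\<^sup>2 / n"
      proof (rule AE_I2)
        fix x
        have "n * h x \<le> (cmod (f x))\<^sup>2" if "x \<in> H"
          unfolding u2[symmetric] using that pLD(2)[OF u, of x] by (intro power_mono) (auto simp: H_def)
        then show "cut H h x \<le> (cmod (f x))\<^sup>2 / n" using n by (auto simp: cut_def field_simps)
      qed
    qed (use fi n in \<open>auto simp: cut_def h0 less_imp_le\<close>)
    also have "\<dots> = (l2_norm M f)\<^sup>2 / n" by (simp add: l2_norm_sq)
    also have "\<dots> \<le> 1 / n" using fL n by (intro divide_right_mono) (auto simp: power_le_one)
    also have "\<dots> < \<eta>" by (rule n)
    finally have sm: "l2_norm M (T (cut H f)) \<le> d" by (rule small[OF H _ f])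
    note c = cut_L2(1)[OF H fL(1)]
    let ?r = "\<lambda>x. f x - cut H f x"
    have r: "?r \<in> L2 M" by (rule cut_compl_L2[OF H fL(1)])
    have "AE x in M. cmod (?r x) \<le> u x"
      using pLD(2)[OF u] by (intro AE_I2) (auto simp: cut_def H_def)
    then obtain g where g: "g \<in> F" "l2_norm M (\<lambda>x. T ?r x - g x) \<le> e" using F(3)[OF r] by blast
    have gL: "g \<in> L2 M" using g F by auto
    have L: "T (cut H f) \<in> L2 M" "T ?r \<in> L2 M" using bounded_op_L2[OF T(1)] c r by auto
    have "l2_norm M (\<lambda>x. T f x - g x) = l2_norm M (\<lambda>x. T (cut H f) x + (T ?r x - g x))"
    proof (rule l2_norm_cong_AE[OF L2D(1)[OF L2_diff[OF Tf gL]] L2D(1)[OF L2_add[OF L(1) L2_diff[OF L(2) gL]]]])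
      show "AE x in M. T f x - g x = T (cut H f) x + (T ?r x - g x)"
        using linear_op_diff[OF bounded_op_linear[OF T(1)] fL(1) c] by eventually_elim simp
    qed
    also have "\<dots> \<le> l2_norm M (T (cut H f)) + l2_norm M (\<lambda>x. T ?r x - g x)"
      by (rule l2_norm_triangle[OF L(1) L2_diff[OF L(2) gL]])
    also have "\<dots> \<le> d + e" using sm g by simp
    finally show "\<exists>g\<in>F. l2_norm M (\<lambda>x. T f x - g x) \<le> d + e" using g(1) by blast
  qed
qed

lemma tendsto_powr_pos_exponent:
  fixes f :: "'b \<Rightarrow> real"
  assumes "(f \<longlongrightarrow> a) F" "0 < \<theta>" "\<forall>\<^sub>F x in F. 0 \<le> f x"
  shows "((\<lambda>x. f x powr \<theta>) \<longlongrightarrow> a powr \<theta>) F"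
  by (rule tendsto_powr'[OF assms(1) tendsto_const]) (use assms in auto)

lemma le_powr_mult_epsilon:
  fixes a b x :: real
  assumes \<theta>: "0 < \<theta>" "\<theta> < 1" and ab: "0 \<le> a" "0 \<le> b"
    and le: "\<And>e. e > 0 \<Longrightarrow> x \<le> (a + e) powr \<theta> * (b + e) powr (1-\<theta>)"
  shows "x \<le> a powr \<theta> * b powr (1-\<theta>)"
proof (rule tendsto_lowerbound)
  have ev: "\<forall>\<^sub>F e in at_right 0. (0::real) < e" by (simp add: eventually_at_right_less)
  show "((\<lambda>e. (a + e) powr \<theta> * (b + e) powr (1-\<theta>)) \<longlongrightarrow> a powr \<theta> * b powr (1-\<theta>)) (at_right 0)"
  proof (intro tendsto_mult tendsto_powr_pos_exponent)
    show "((\<lambda>e. a + e) \<longlongrightarrow> a) (at_right 0)" "((\<lambda>e. b + e) \<longlongrightarrow> b) (at_right 0)"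
      by (auto intro!: tendsto_eq_intros)
    show "\<forall>\<^sub>F e in at_right 0. 0 \<le> a + e" "\<forall>\<^sub>F e in at_right 0. 0 \<le> b + e"
      using ab by (auto intro: eventually_mono[OF ev])
  qed (use \<theta> in auto)
  show "\<forall>\<^sub>F e in at_right 0. x \<le> (a + e) powr \<theta> * (b + e) powr (1-\<theta>)"
    using ev by (rule eventually_mono) (rule le)
qed simp

text \<open>On functions cut to a set of small weight, \<open>E\<close> and \<open>G\<close> have
  norms close to the two measures of non-compactness; the norm inequality for domination transfers
  this to \<open>T\<close>, and AM-compactness of \<open>T\<close> converts it back.\<close>

lemma mdom_hausdorff_mnc:
  assumes \<theta>: "0 < \<theta>" "\<theta> < 1" and h: "weight M h" and d: "mdom M \<theta> T E G"
    and T: "pos_op M T" "am_compact M T" and E: "pos_op M E" "adjoint_of M E E'"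
    and G: "pos_op M G" and D: "bounded_op M D" "adjoint_of M D G"
  shows "hausdorff_mnc M T \<le> hausdorff_mnc M E powr \<theta> * hausdorff_mnc M D powr (1-\<theta>)"
proof -
  let ?a = "hausdorff_mnc M E" and ?b = "hausdorff_mnc M D"
  note bE = pos_opD(1)[OF E(1)]
  have ab: "0 \<le> ?a" "0 \<le> ?b" using hausdorff_mnc_nonneg bE D by auto
  \<comment> \<open>One \<open>e\<close> makes the net radius strictly larger than the infimum, the
    other is the loss in the small-set estimate.\<close>
  have le: "hausdorff_mnc M T \<le> (?a + 2 * e) powr \<theta> * (?b + 2 * e) powr (1-\<theta>)" if e: "e > 0" for e
  proof -
    obtain \<eta> where \<eta>: "\<eta> > 0" "\<And>H f. H \<in> sets M \<Longrightarrow> (\<integral>x. cut H h x \<partial>M) < \<eta> \<Longrightarrow> f \<in> l2_ball M \<Longrightarrow>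
        l2_norm M (E (cut H f)) \<le> ?a + 2 * e"
      using mnc_small_sets[OF h bE E(2), of "?a + e" e] e by (auto simp: add.assoc)
    obtain \<eta>' where \<eta>': "\<eta>' > 0" "\<And>H f. H \<in> sets M \<Longrightarrow> (\<integral>x. cut H h x \<partial>M) < \<eta>' \<Longrightarrow> f \<in> l2_ball M \<Longrightarrow>
        l2_norm M (G (cut H f)) \<le> ?b + 2 * e"
      using mnc_small_sets_adjoint[OF h D, of "?b + e" e] e by (auto simp: add.assoc)
    show ?thesis
    proof (rule mnc_le_small_sets[OF h pos_opD(1)[OF T(1)] T(2), of _ "min \<eta> \<eta>'"])
      show "0 < min \<eta> \<eta>'" using \<eta> \<eta>' by simp
      fix H f assume H: "H \<in> sets M" "(\<integral>x. cut H h x \<partial>M) < min \<eta> \<eta>'" and f: "f \<in> l2_ball M"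
      have fL: "f \<in> L2 M" using f by (simp add: l2_ball_def)
      have eq: "(\<lambda>x. complex_of_real (cmod (cut H f x))) = cut H (\<lambda>x. complex_of_real (cmod (f x)))"
        by (auto simp: cut_def fun_eq_iff)
      have cf: "(\<lambda>x. complex_of_real (cmod (f x))) \<in> l2_ball M"
        using f cr_L2[OF cmod_pL[OF fL]] by (simp add: l2_ball_def l2_norm_cmod)
      have "l2_norm M (T (cut H f)) \<le> l2_norm M (E (cut H (\<lambda>x. complex_of_real (cmod (f x))))) powr \<theta> *
           l2_norm M (G (cut H (\<lambda>x. complex_of_real (cmod (f x))))) powr (1-\<theta>)"
        using mdom_l2_norm[OF \<theta> d T(1) E(1) G cut_L2(1)[OF H(1) fL]] unfolding eq .
      also have "\<dots> \<le> (?a + 2 * e) powr \<theta> * (?b + 2 * e) powr (1-\<theta>)"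
        using \<eta>(2)[OF H(1) _ cf] \<eta>'(2)[OF H(1) _ cf] H(2) by (intro powr_mult_mono \<theta>) auto
      finally show "l2_norm M (T (cut H f)) \<le> (?a + 2 * e) powr \<theta> * (?b + 2 * e) powr (1-\<theta>)" .
    qed simp
  qed
  show ?thesis
    by (rule le_powr_mult_epsilon[OF \<theta> ab]) (use le[of "e/2" for e] in simp)
qed

section \<open>Sets of operators\<close>

text \<open>
  Domination of \<open>T\<close> by a geometric mean of \<open>C\<close> and the adjoint of \<open>D\<close>. The order of the operators
  \<open>D\<close> is reversed under composition.
\<close>

definition interp :: "'a measure \<Rightarrow> real \<Rightarrow> 'a l2op \<Rightarrow> 'a l2op \<Rightarrow> 'a l2op \<Rightarrow> bool" where
  "interp M \<theta> T C D \<longleftrightarrow> pos_op M T \<and> pos_op M C \<and> pos_op M D \<and>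
     (\<exists>C' D'. adjoint_of M C C' \<and> adjoint_of M D D' \<and> pos_op M D' \<and> mdom M \<theta> T C D')"

lemma interpE:
  assumes "interp M \<theta> T C D"
  obtains C' D' where "pos_op M T" "pos_op M C" "pos_op M D" "adjoint_of M C C'" "adjoint_of M D D'"
    "pos_op M D'" "mdom M \<theta> T C D'"
  using assms unfolding interp_def by blast

lemma interp_comp:
  assumes \<theta>: "0 < \<theta>" "\<theta> < 1" and "interp M \<theta> T1 C1 D1" "interp M \<theta> T2 C2 D2"
  shows "interp M \<theta> (T1 \<circ> T2) (C1 \<circ> C2) (D2 \<circ> D1)"
proof -
  obtain C1' D1' where 1: "pos_op M T1" "pos_op M C1" "pos_op M D1" "adjoint_of M C1 C1'" "adjoint_of M D1 D1'"
    "pos_op M D1'" "mdom M \<theta> T1 C1 D1'" using interpE[OF assms(3)] by metis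
  obtain C2' D2' where 2: "pos_op M T2" "pos_op M C2" "pos_op M D2" "adjoint_of M C2 C2'" "adjoint_of M D2 D2'"
    "pos_op M D2'" "mdom M \<theta> T2 C2 D2'" using interpE[OF assms(4)] by metis
  have "adjoint_of M (C1 \<circ> C2) (C2' \<circ> C1')" "adjoint_of M (D2 \<circ> D1) (D1' \<circ> D2')"
    using adjoint_of_comp 1 2 pos_opD(1) by metis+
  moreover have "mdom M \<theta> (T1 \<circ> T2) (C1 \<circ> C2) (D1' \<circ> D2')"
    by (rule mdom_comp[OF \<theta> 1(1) 2(1) 1(2) 2(2) 1(6) 2(6) 1(7) 2(7)])
  ultimately show ?thesis
    unfolding interp_def using pos_op_comp 1 2 by metis
qed

lemma adjoint_of_id: "adjoint_of M id id"
  by (simp add: adjoint_of_def bounded_op_id)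

lemma interp_id: "interp M \<theta> id id id"
  unfolding interp_def using pos_op_id mdom_id adjoint_of_id by metis

text \<open>For powers of a single operator the reversal of the order is invisible, because
  \<open>D\<close> commutes with \<open>D ^^ k\<close>.\<close>

lemma interp_funpow:
  assumes "0 < \<theta>" "\<theta> < 1" "interp M \<theta> T C D"
  shows "interp M \<theta> (T ^^ k) (C ^^ k) (D ^^ k)"
proof (induction k)
  case 0
  show ?case using interp_id by (simp add: id_def[symmetric])
next
  case (Suc k)
  have "interp M \<theta> (T \<circ> T ^^ k) (C \<circ> C ^^ k) (D ^^ k \<circ> D)" by (rule interp_comp[OF assms Suc.IH])
  then show ?case unfolding funpow_Suc_right[of k D] by (simp add: comp_def)
qed

lemma interp_op_norm:
  assumes "0 < \<theta>" "\<theta> < 1" "interp M \<theta> T C D"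
  shows "op_norm M T \<le> op_norm M C powr \<theta> * op_norm M D powr (1-\<theta>)"
proof -
  obtain C' D' where 1: "pos_op M T" "pos_op M C" "pos_op M D" "adjoint_of M C C'" "adjoint_of M D D'"
    "pos_op M D'" "mdom M \<theta> T C D'" using interpE[OF assms(3)] by metis
  show ?thesis
    using mdom_op_norm[OF assms(1,2) 1(7,1,2,6)] op_norm_adjoint[OF pos_opD(1)[OF 1(3)] 1(5)] by simp
qed

lemma interp_numerical_radius:
  assumes "0 < \<theta>" "\<theta> < 1" "interp M \<theta> T C D"
  shows "numerical_radius M T \<le> numerical_radius M C powr \<theta> * numerical_radius M D powr (1-\<theta>)"
proof -
  obtain C' D' where 1: "pos_op M T" "pos_op M C" "pos_op M D" "adjoint_of M C C'" "adjoint_of M D D'"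
    "pos_op M D'" "mdom M \<theta> T C D'" using interpE[OF assms(3)] by metis
  show ?thesis
    by (rule mdom_numerical_radius[OF assms(1,2) 1(7,1,2,6) pos_opD(1)[OF 1(3)] 1(5)])
qed

lemma interp_hausdorff_mnc:
  assumes "0 < \<theta>" "\<theta> < 1" "weight M h" "interp M \<theta> T C D" "am_compact M T"
  shows "hausdorff_mnc M T \<le> hausdorff_mnc M C powr \<theta> * hausdorff_mnc M D powr (1-\<theta>)"
proof -
  obtain C' D' where 1: "pos_op M T" "pos_op M C" "pos_op M D" "adjoint_of M C C'" "adjoint_of M D D'"
    "pos_op M D'" "mdom M \<theta> T C D'" using interpE[OF assms(4)] by metis
  show ?thesis
    by (rule mdom_hausdorff_mnc[OF assms(1-3) 1(7,1) assms(5) 1(2,4,6) pos_opD(1)[OF 1(3)] 1(5)])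
qed

text \<open>Inequalities between powers become inequalities between radii. They are demanded from
  index 1 on, because \<open>T ^^ 0\<close> is the identity, which is in general not
  AM-compact.\<close>

lemma tendsto_root_powr_le:
  fixes a b c :: "nat \<Rightarrow> real"
  assumes \<theta>: "0 < \<theta>" "\<theta> < 1"
    and nn: "\<And>k. k \<ge> 1 \<Longrightarrow> 0 \<le> b k" "\<And>k. k \<ge> 1 \<Longrightarrow> 0 \<le> c k"
    and le: "\<And>k. k \<ge> 1 \<Longrightarrow> a k \<le> b k powr \<theta> * c k powr (1-\<theta>)"
    and lim: "(\<lambda>k. root k (a k)) \<longlonglongrightarrow> A" "(\<lambda>k. root k (b k)) \<longlonglongrightarrow> B" "(\<lambda>k. root k (c k)) \<longlonglongrightarrow> C"
  shows "A \<le> B powr \<theta> * C powr (1-\<theta>)"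
proof (rule tendsto_le[OF sequentially_bot _ lim(1)])
  have ev: "\<forall>\<^sub>F k in sequentially. 0 \<le> root k (b k)" "\<forall>\<^sub>F k in sequentially. 0 \<le> root k (c k)"
    using nn by (auto intro!: eventually_sequentiallyI[of 1])
  show "(\<lambda>k. root k (b k) powr \<theta> * root k (c k) powr (1-\<theta>)) \<longlonglongrightarrow> B powr \<theta> * C powr (1-\<theta>)"
    by (intro tendsto_mult tendsto_powr_pos_exponent lim ev) (use \<theta> in auto)
  show "\<forall>\<^sub>F k in sequentially. root k (a k) \<le> root k (b k) powr \<theta> * root k (c k) powr (1-\<theta>)"
  proof (rule eventually_sequentiallyI[of 1])
    fix k :: nat assume k: "1 \<le> k"
    then show "root k (a k) \<le> root k (b k) powr \<theta> * root k (c k) powr (1-\<theta>)"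
      using le[OF k] nn[OF k] by (simp add: root_powr_mult[symmetric])
  qed
qed

lemma interp_spectral_rad:
  assumes "0 < \<theta>" "\<theta> < 1" "interp M \<theta> T C D"
  shows "spectral_rad M T \<le> spectral_rad M C powr \<theta> * spectral_rad M D powr (1-\<theta>)"
proof -
  have p: "pos_op M T" "pos_op M C" "pos_op M D" using interpE[OF assms(3)] by metis+
  show ?thesis
    by (rule tendsto_root_powr_le[OF assms(1,2) _ _ _ spectral_radius_formula(1)[OF p(1)]
          spectral_radius_formula(1)[OF p(2)] spectral_radius_formula(1)[OF p(3)]])
      (use p op_norm_nonneg bounded_op_funpow pos_opD(1) interp_op_norm[OF assms(1,2) interp_funpow[OF assms]] in metis)+
qed

text \<open>Submultiplicativity gives convergence by Fekete's lemma; only then does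
  \<open>lim\<close> in the definition denote the intended number.\<close>

lemma ess_spectral_rad_lim:
  assumes "bounded_op M A"
  shows "(\<lambda>j. root j (hausdorff_mnc M (A ^^ j))) \<longlonglongrightarrow> ess_spectral_rad M A"
    and "0 \<le> ess_spectral_rad M A"
proof -
  obtain L where L: "0 \<le> L" "(\<lambda>j. root j (hausdorff_mnc M (A ^^ j))) \<longlonglongrightarrow> L"
  proof (rule Fekete_root[of "\<lambda>j. hausdorff_mnc M (A ^^ j)"])
    show "0 \<le> hausdorff_mnc M (A ^^ j)" for j
      by (rule hausdorff_mnc_nonneg[OF bounded_op_funpow[OF assms]])
    show "hausdorff_mnc M (A ^^ (m + k)) \<le> hausdorff_mnc M (A ^^ m) * hausdorff_mnc M (A ^^ k)" for m k
      unfolding funpow_add by (rule hausdorff_mnc_comp[OF bounded_op_funpow bounded_op_funpow]) (rule assms)+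
  qed
  then show "(\<lambda>j. root j (hausdorff_mnc M (A ^^ j))) \<longlonglongrightarrow> ess_spectral_rad M A"
    "0 \<le> ess_spectral_rad M A"
    unfolding ess_spectral_rad_def using limI[OF L(2)] by auto
qed

lemma am_compact_funpow:
  assumes "pos_op M T" "am_compact M T" "k \<ge> 1"
  shows "am_compact M (T ^^ k)"
proof -
  obtain j where "k = Suc j" using assms(3) by (cases k) auto
  then show ?thesis using am_compact_comp[OF assms(2) pos_op_funpow[OF assms(1)]] by simp
qed

lemma interp_ess_spectral_rad:
  assumes "0 < \<theta>" "\<theta> < 1" "weight M h" "interp M \<theta> T C D" "am_compact M T"
  shows "ess_spectral_rad M T \<le> ess_spectral_rad M C powr \<theta> * ess_spectral_rad M D powr (1-\<theta>)"
proof -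
  have p: "pos_op M T" "pos_op M C" "pos_op M D" using interpE[OF assms(4)] by metis+
  note b = pos_opD(1)[OF p(1)] pos_opD(1)[OF p(2)] pos_opD(1)[OF p(3)]
  show ?thesis
    by (rule tendsto_root_powr_le[OF assms(1,2) _ _ _ ess_spectral_rad_lim(1)[OF b(1)]
          ess_spectral_rad_lim(1)[OF b(2)] ess_spectral_rad_lim(1)[OF b(3)]])
      (use b hausdorff_mnc_nonneg bounded_op_funpow am_compact_funpow[OF p(1) assms(5)]
        interp_hausdorff_mnc[OF assms(1-3) interp_funpow[OF assms(1,2,4)]] in metis)+
qed

lemma root_le_of_power_le:
  fixes a :: "nat \<Rightarrow> real"
  assumes "\<And>k. a k \<le> c ^ k" "0 \<le> c" "(\<lambda>k. root k (a k)) \<longlonglongrightarrow> L"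
  shows "L \<le> c"
proof (rule tendsto_upperbound[OF assms(3) eventually_sequentiallyI[of 1]])
  fix k :: nat assume "1 \<le> k"
  then have "root k (a k) \<le> root k (c ^ k)" using assms(1) by simp
  then show "root k (a k) \<le> c" using assms(2) \<open>1 \<le> k\<close> by (simp add: real_root_power_cancel)
qed simp

lemma op_norm_funpow_le:
  assumes "bounded_op M A"
  shows "op_norm M (A ^^ k) \<le> op_norm M A ^ k"
proof (induction k)
  case 0
  show ?case by (rule op_norm_least) auto
next
  case (Suc k)
  show ?case using op_norm_comp[OF assms bounded_op_funpow[OF assms], of k]
      mult_left_mono[OF Suc.IH op_norm_nonneg[OF assms]] by (simp add: comp_def)
qed

lemma spectral_rad_bounds:
  assumes "pos_op M T"
  shows "0 \<le> spectral_rad M T" "spectral_rad M T \<le> op_norm M T"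
proof -
  note b = pos_opD(1)[OF assms]
  show "0 \<le> spectral_rad M T"
    unfolding spectral_rad_def by (rule sup0_nonneg[OF spectral_radius_formula(2)[OF assms]])
  show "spectral_rad M T \<le> op_norm M T"
    by (rule root_le_of_power_le[OF op_norm_funpow_le[OF b] op_norm_nonneg[OF b] spectral_radius_formula(1)[OF assms]])
qed

lemma ess_spectral_rad_le_norm:
  assumes "bounded_op M T"
  shows "ess_spectral_rad M T \<le> op_norm M T"
proof (rule root_le_of_power_le[OF _ op_norm_nonneg[OF assms] ess_spectral_rad_lim(1)[OF assms]])
  show "hausdorff_mnc M (T ^^ k) \<le> op_norm M T ^ k" for k
    using hausdorff_mnc_le_norm[OF bounded_op_funpow[OF assms]] op_norm_funpow_le[OF assms] by (rule order_trans)
qed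

section \<open>Products and powers of sets of operators\<close>

definition pos_ops :: "'a measure \<Rightarrow> 'a l2op set \<Rightarrow> bool" where
  "pos_ops M S \<longleftrightarrow> (\<forall>A\<in>S. pos_op M A) \<and> bdd_above (op_norm M ` S)"

definition interp_set :: "'a measure \<Rightarrow> real \<Rightarrow> 'a l2op set \<Rightarrow> 'a l2op set \<Rightarrow> 'a l2op set \<Rightarrow> bool" where
  "interp_set M \<theta> S P Q \<longleftrightarrow> (\<forall>T\<in>S. \<exists>C\<in>P. \<exists>D\<in>Q. interp M \<theta> T C D)"

lemma ops_prod_append:
  "ops_prod (xs @ ys) = {A \<circ> B | A B. A \<in> ops_prod xs \<and> B \<in> ops_prod ys}"
proof (induction xs)
  case (Cons x xs)
  show ?case
  proof safe
    fix T assume "T \<in> ops_prod ((x # xs) @ ys)"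
    then obtain A R where "A \<in> x" "R \<in> ops_prod (xs @ ys)" "T = A \<circ> R" by auto
    moreover then obtain B C where "B \<in> ops_prod xs" "C \<in> ops_prod ys" "R = B \<circ> C"
      using Cons.IH by blast
    ultimately have "A \<in> x" "B \<in> ops_prod xs" "C \<in> ops_prod ys" "T = A \<circ> (B \<circ> C)" by simp_all
    then show "\<exists>A B. T = A \<circ> B \<and> A \<in> ops_prod (x # xs) \<and> B \<in> ops_prod ys"
      by (intro exI[of _ "A \<circ> B"] exI[of _ C]) (auto simp: comp_assoc)
  next
    fix T A B assume "A \<in> ops_prod (x # xs)" "B \<in> ops_prod ys"
    then obtain A1 A2 where "A1 \<in> x" "A2 \<in> ops_prod xs" "A = A1 \<circ> A2" by auto
    moreover then have "A2 \<circ> B \<in> ops_prod (xs @ ys)"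
      using \<open>B \<in> ops_prod ys\<close> Cons.IH by blast
    ultimately show "A \<circ> B \<in> ops_prod ((x # xs) @ ys)"
      unfolding \<open>A = A1 \<circ> A2\<close> comp_assoc append_Cons ops_prod.simps by blast
  qed
qed simp

lemma pos_ops_prod:
  assumes "\<And>S. S \<in> set Ss \<Longrightarrow> pos_ops M S"
  shows "pos_ops M (ops_prod Ss)"
  using assms
proof (induction Ss)
  case Nil
  then show ?case by (simp add: pos_ops_def pos_op_id)
next
  case (Cons S Ss)
  have S: "pos_ops M S" and Ss: "pos_ops M (ops_prod Ss)" using Cons by auto
  obtain a b where a: "\<And>A. A \<in> S \<Longrightarrow> op_norm M A \<le> a" and b: "\<And>B. B \<in> ops_prod Ss \<Longrightarrow> op_norm M B \<le> b"
    using S Ss unfolding pos_ops_def bdd_above_def by (metis imageI)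
  have pos: "pos_op M A" if "A \<in> S" for A using S that by (simp add: pos_ops_def)
  have pos': "pos_op M B" if "B \<in> ops_prod Ss" for B using Ss that by (simp add: pos_ops_def)
  have "op_norm M (A \<circ> B) \<le> a * b" if A: "A \<in> S" and B: "B \<in> ops_prod Ss" for A B
  proof -
    note bd = pos_opD(1)[OF pos[OF A]] pos_opD(1)[OF pos'[OF B]]
    have "op_norm M (A \<circ> B) \<le> op_norm M A * op_norm M B" by (rule op_norm_comp[OF bd])
    also have "\<dots> \<le> a * b"
      using a[OF A] b[OF B] op_norm_nonneg[OF bd(1)] op_norm_nonneg[OF bd(2)] by (intro mult_mono) auto
    finally show ?thesis .
  qed
  then show ?case
    unfolding pos_ops_def using pos_op_comp[OF pos pos'] by (auto intro!: bdd_aboveI[of _ "a * b"])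
qed

text \<open>The leftmost factor carries the compactness; the empty product would be the
  identity.\<close>

lemma am_compact_prod:
  assumes "Ss \<noteq> []" "\<And>S A. S \<in> set Ss \<Longrightarrow> A \<in> S \<Longrightarrow> am_compact M A" "\<And>S. S \<in> set Ss \<Longrightarrow> pos_ops M S"
    "T \<in> ops_prod Ss"
  shows "am_compact M T"
proof -
  obtain S Ss' where Ss: "Ss = S # Ss'" using assms(1) by (cases Ss) auto
  then obtain A B where "A \<in> S" "B \<in> ops_prod Ss'" "T = A \<circ> B" using assms(4) by auto
  moreover have "pos_ops M (ops_prod Ss')" using assms(3) Ss by (intro pos_ops_prod) auto
  ultimately show ?thesis using am_compact_comp assms(2)[of S A] Ss by (auto simp: pos_ops_def)
qed

text \<open>In the induction the new \<open>D1\<close> is appended on the right of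
  \<open>D2\<close>, so the list on the \<open>Q\<close> side is reversed.\<close>

lemma interp_set_prod:
  assumes \<theta>: "0 < \<theta>" "\<theta> < 1" and "\<And>i. i \<in> set L \<Longrightarrow> interp_set M \<theta> (S i) (P i) (Q i)"
  shows "interp_set M \<theta> (ops_prod (map S L)) (ops_prod (map P L)) (ops_prod (map Q (rev L)))"
  using assms(3)
proof (induction L)
  case Nil
  show ?case by (simp add: interp_set_def interp_id)
next
  case (Cons i L)
  have IH: "interp_set M \<theta> (ops_prod (map S L)) (ops_prod (map P L)) (ops_prod (map Q (rev L)))"
    and i: "interp_set M \<theta> (S i) (P i) (Q i)" using Cons by auto
  show ?case
    unfolding interp_set_def
  proof
    fix T assume "T \<in> ops_prod (map S (i # L))"
    then obtain T1 T2 where T: "T1 \<in> S i" "T2 \<in> ops_prod (map S L)" "T = T1 \<circ> T2" by auto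
    obtain C1 D1 where 1: "C1 \<in> P i" "D1 \<in> Q i" "interp M \<theta> T1 C1 D1"
      using i T(1) unfolding interp_set_def by blast
    obtain C2 D2 where 2: "C2 \<in> ops_prod (map P L)" "D2 \<in> ops_prod (map Q (rev L))" "interp M \<theta> T2 C2 D2"
      using IH T(2) unfolding interp_set_def by blast
    have "D2 \<circ> D1 \<in> ops_prod (map Q (rev (i # L)))"
    proof -
      have "D1 \<in> ops_prod [Q i]" using 1(2) by (auto intro: exI[of _ D1])
      then show ?thesis using 2(2) unfolding rev.simps map_append ops_prod_append by auto
    qed
    moreover have "C1 \<circ> C2 \<in> ops_prod (map P (i # L))" using 1 2 by auto
    ultimately show "\<exists>C\<in>ops_prod (map P (i # L)). \<exists>D\<in>ops_prod (map Q (rev (i # L))). interp M \<theta> T C D"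
      unfolding T(3) using interp_comp[OF \<theta> 1(3) 2(3)] by blast
  qed
qed

text \<open>A constant list equals its reversal, so powers keep the roles of \<open>P\<close> and
  \<open>Q\<close> without any change of order.\<close>

lemma interp_set_power:
  assumes "0 < \<theta>" "\<theta> < 1" "interp_set M \<theta> S P Q"
  shows "interp_set M \<theta> (ops_power S m) (ops_power P m) (ops_power Q m)"
  using interp_set_prod[OF assms(1,2), of "[0..<m]" M "\<lambda>_. S" "\<lambda>_. P" "\<lambda>_. Q"] assms(3)
  by (simp add: ops_power_def map_replicate_const)

lemma pos_ops_power: "pos_ops M S \<Longrightarrow> pos_ops M (ops_power S m)"
  unfolding ops_power_def by (rule pos_ops_prod) auto

lemma ops_power_add: "ops_power S (m + k) = {A \<circ> B | A B. A \<in> ops_power S m \<and> B \<in> ops_power S k}"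
  by (simp add: ops_power_def replicate_add ops_prod_append)

lemma am_compact_power:
  assumes "pos_ops M S" "\<And>A. A \<in> S \<Longrightarrow> am_compact M A" "m \<ge> 1" "T \<in> ops_power S m"
  shows "am_compact M T"
  by (rule am_compact_prod[of "replicate m S"]) (use assms in \<open>auto simp: ops_power_def\<close>)

lemma interp_set_sup:
  assumes \<theta>: "0 < \<theta>" "\<theta> < 1" and rel: "interp_set M \<theta> S P Q"
    and bdd: "bdd_above (\<phi> ` P)" "bdd_above (\<phi> ` Q)"
    and nn: "\<And>C. C \<in> P \<Longrightarrow> 0 \<le> \<phi> C" "\<And>D. D \<in> Q \<Longrightarrow> 0 \<le> \<phi> D"
    and le: "\<And>T C D. T \<in> S \<Longrightarrow> interp M \<theta> T C D \<Longrightarrow> \<phi> T \<le> \<phi> C powr \<theta> * \<phi> D powr (1-\<theta>)"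
  shows "sup0 (\<phi> ` S) \<le> sup0 (\<phi> ` P) powr \<theta> * sup0 (\<phi> ` Q) powr (1-\<theta>)"
proof (rule sup0_least)
  fix x assume "x \<in> \<phi> ` S"
  then obtain T where T: "T \<in> S" "x = \<phi> T" by auto
  obtain C D where CD: "C \<in> P" "D \<in> Q" "interp M \<theta> T C D" using rel T(1) unfolding interp_set_def by blast
  have "\<phi> T \<le> \<phi> C powr \<theta> * \<phi> D powr (1-\<theta>)" by (rule le[OF T(1) CD(3)])
  also have "\<dots> \<le> sup0 (\<phi> ` P) powr \<theta> * sup0 (\<phi> ` Q) powr (1-\<theta>)"
    by (intro powr_mult_mono \<theta> nn CD sup0_upper bdd imageI)
  finally show "x \<le> sup0 (\<phi> ` P) powr \<theta> * sup0 (\<phi> ` Q) powr (1-\<theta>)" using T by simp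
qed simp

lemma pos_ops_bdd:
  assumes "pos_ops M S" "\<And>A. pos_op M A \<Longrightarrow> \<phi> A \<le> op_norm M A"
  shows "bdd_above (\<phi> ` S)"
proof -
  obtain c where "\<And>A. A \<in> S \<Longrightarrow> op_norm M A \<le> c" "\<And>A. A \<in> S \<Longrightarrow> pos_op M A"
    using assms(1) by (auto simp: pos_ops_def bdd_above_def)
  then show ?thesis using assms(2) by (intro bdd_aboveI2[of _ _ c]) (meson order_trans)
qed

text \<open>Every product of length \<open>m + k\<close> splits into factors of lengths
  \<open>m\<close> and \<open>k\<close>, so the suprema are submultiplicative.\<close>

lemma sup0_power_Fekete:
  assumes S: "pos_ops M S" and \<phi>: "\<And>A. pos_op M A \<Longrightarrow> 0 \<le> \<phi> A" "\<And>A. pos_op M A \<Longrightarrow> \<phi> A \<le> op_norm M A"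
    and sub: "\<And>A B. pos_op M A \<Longrightarrow> pos_op M B \<Longrightarrow> \<phi> (A \<circ> B) \<le> \<phi> A * \<phi> B"
  obtains L where "0 \<le> L" "(\<lambda>m. root m (sup0 (\<phi> ` ops_power S m))) \<longlonglongrightarrow> L"
proof -
  have P: "pos_op M A" if "A \<in> ops_power S m" for A m
    using pos_ops_power[OF S] that by (auto simp: pos_ops_def)
  have bdd: "bdd_above (\<phi> ` ops_power S m)" for m by (rule pos_ops_bdd[OF pos_ops_power[OF S] \<phi>(2)])
  show ?thesis
  proof (rule Fekete_root[of "\<lambda>m. sup0 (\<phi> ` ops_power S m)"])
    show "0 \<le> sup0 (\<phi> ` ops_power S m)" for m by (rule sup0_nonneg[OF bdd])
    show "sup0 (\<phi> ` ops_power S (m + k)) \<le> sup0 (\<phi> ` ops_power S m) * sup0 (\<phi> ` ops_power S k)" for m k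
    proof (rule sup0_least)
      fix x assume "x \<in> \<phi> ` ops_power S (m + k)"
      then obtain A B where AB: "A \<in> ops_power S m" "B \<in> ops_power S k" "x = \<phi> (A \<circ> B)"
        by (auto simp: ops_power_add)
      have "x \<le> \<phi> A * \<phi> B" unfolding AB(3) by (rule sub[OF P P]) (rule AB)+
      also have "\<dots> \<le> sup0 (\<phi> ` ops_power S m) * sup0 (\<phi> ` ops_power S k)"
        using AB by (intro mult_mono sup0_upper bdd imageI \<phi>(1) P[of _ k] sup0_nonneg) auto
      finally show "x \<le> sup0 (\<phi> ` ops_power S m) * sup0 (\<phi> ` ops_power S k)" .
    qed (intro mult_nonneg_nonneg sup0_nonneg bdd)
  qed (rule that)
qed

text \<open>\<open>real_of_ereal\<close> sends infinite values to 0; the eventual bounds guarantee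
  that no information is lost in this way.\<close>

lemma bounded_limsup_real:
  fixes a :: "nat \<Rightarrow> real"
  assumes "\<forall>\<^sub>F m in sequentially. 0 \<le> a m" "\<forall>\<^sub>F m in sequentially. a m \<le> K"
  shows "limsup (\<lambda>m. ereal (a m)) = ereal (real_of_ereal (limsup (\<lambda>m. ereal (a m))))"
    and "0 \<le> real_of_ereal (limsup (\<lambda>m. ereal (a m)))"
proof -
  have u: "limsup (\<lambda>m. ereal (a m)) \<le> ereal K"
    by (rule Limsup_bounded) (use assms(2) in simp)
  have "0 \<le> liminf (\<lambda>m. ereal (a m))"
    by (rule Liminf_bounded) (use assms(1) in simp)
  also have "\<dots> \<le> limsup (\<lambda>m. ereal (a m))" by (rule Liminf_le_Limsup) simp
  finally have l: "0 \<le> limsup (\<lambda>m. ereal (a m))" .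
  show "limsup (\<lambda>m. ereal (a m)) = ereal (real_of_ereal (limsup (\<lambda>m. ereal (a m))))"
    "0 \<le> real_of_ereal (limsup (\<lambda>m. ereal (a m)))"
    using u l by (cases "limsup (\<lambda>m. ereal (a m))"; auto)+
qed

text \<open>Eventually \<open>b m\<close> and \<open>c m\<close> lie below their upper limits plus
  \<open>e\<close>. This bounds the product of powers eventually, and \<open>e\<close> tends to 0 at
  the end.\<close>

lemma limsup_powr_le:
  fixes a b c :: "nat \<Rightarrow> real"
  assumes \<theta>: "0 < \<theta>" "\<theta> < 1"
    and a: "\<forall>\<^sub>F m in sequentially. 0 \<le> a m"
    and b: "\<forall>\<^sub>F m in sequentially. 0 \<le> b m" "\<forall>\<^sub>F m in sequentially. b m \<le> K"
    and c: "\<forall>\<^sub>F m in sequentially. 0 \<le> c m" "\<forall>\<^sub>F m in sequentially. c m \<le> K'"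
    and le: "\<forall>\<^sub>F m in sequentially. a m \<le> b m powr \<theta> * c m powr (1-\<theta>)"
  shows "real_of_ereal (limsup (\<lambda>m. ereal (a m)))
    \<le> real_of_ereal (limsup (\<lambda>m. ereal (b m))) powr \<theta> * real_of_ereal (limsup (\<lambda>m. ereal (c m))) powr (1-\<theta>)"
proof -
  define B where "B = real_of_ereal (limsup (\<lambda>m. ereal (b m)))"
  define C where "C = real_of_ereal (limsup (\<lambda>m. ereal (c m)))"
  note B = bounded_limsup_real[OF b, folded B_def] and C = bounded_limsup_real[OF c, folded C_def]
  have "real_of_ereal (limsup (\<lambda>m. ereal (a m))) \<le> (B + e) powr \<theta> * (C + e) powr (1-\<theta>)" if e: "e > 0" for e
  proof -
    have "limsup (\<lambda>m. ereal (b m)) < ereal (B + e)" "limsup (\<lambda>m. ereal (c m)) < ereal (C + e)"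
      using B(1) C(1) e by auto
    from Limsup_lessD[OF this(1)] Limsup_lessD[OF this(2)] le b(1) c(1)
    have ev: "\<forall>\<^sub>F m in sequentially. a m \<le> (B + e) powr \<theta> * (C + e) powr (1-\<theta>)"
    proof eventually_elim
      case (elim m)
      have "b m powr \<theta> * c m powr (1-\<theta>) \<le> (B + e) powr \<theta> * (C + e) powr (1-\<theta>)"
        using elim by (intro powr_mult_mono \<theta>) auto
      then show ?case using elim by simp
    qed
    have "limsup (\<lambda>m. ereal (a m)) \<le> ereal ((B + e) powr \<theta> * (C + e) powr (1-\<theta>))"
      by (rule Limsup_bounded) (use ev in simp)
    then show ?thesis using bounded_limsup_real(1)[OF a ev] by (metis ereal_less_eq(3))
  qed
  then show ?thesis unfolding B_def[symmetric] C_def[symmetric]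
    by (rule le_powr_mult_epsilon[OF \<theta> B(2) C(2)])
qed

section \<open>Interpolation of the functionals\<close>

lemma sup0_mono:
  assumes "bdd_above (\<psi> ` S)" "\<And>A. A \<in> S \<Longrightarrow> \<phi> A \<le> \<psi> A"
  shows "sup0 (\<phi> ` S) \<le> sup0 (\<psi> ` S)"
proof (rule sup0_least[OF sup0_nonneg[OF assms(1)]])
  fix x assume "x \<in> \<phi> ` S"
  then obtain A where A: "A \<in> S" "x = \<phi> A" by auto
  then show "x \<le> sup0 (\<psi> ` S)" using assms(2)[OF A(1)] sup0_upper[OF assms(1), of "\<psi> A"] by simp
qed

text \<open>The corresponding sequence for the operator norm converges and majorises the one for
  \<phi>.\<close>

lemma root_sup0_bounded:
  assumes S: "pos_ops M S" and \<phi>: "\<And>A. pos_op M A \<Longrightarrow> 0 \<le> \<phi> A" "\<And>A. pos_op M A \<Longrightarrow> \<phi> A \<le> op_norm M A"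
  shows "\<forall>\<^sub>F m in sequentially. 0 \<le> root m (sup0 (\<phi> ` ops_power S m))"
    and "\<exists>K. \<forall>\<^sub>F m in sequentially. root m (sup0 (\<phi> ` ops_power S m)) \<le> K"
proof -
  have bdd: "bdd_above (\<phi> ` ops_power S m)" "bdd_above (op_norm M ` ops_power S m)" for m
    using pos_ops_bdd[OF pos_ops_power[OF S] \<phi>(2)] pos_ops_power[OF S, of m] by (auto simp: pos_ops_def)
  show "\<forall>\<^sub>F m in sequentially. 0 \<le> root m (sup0 (\<phi> ` ops_power S m))"
    using sup0_nonneg[OF bdd(1)] by (simp add: real_root_ge_zero)
  obtain L where L: "(\<lambda>m. root m (sup0 (op_norm M ` ops_power S m))) \<longlonglongrightarrow> L"
    by (rule sup0_power_Fekete[OF S, of "op_norm M"])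
      (use op_norm_nonneg[OF pos_opD(1)] op_norm_comp[OF pos_opD(1) pos_opD(1)] in auto)
  have "\<forall>\<^sub>F m in sequentially. root m (sup0 (op_norm M ` ops_power S m)) < L + 1"
    by (rule order_tendstoD(2)[OF L]) simp
  then have "\<forall>\<^sub>F m in sequentially. root m (sup0 (\<phi> ` ops_power S m)) \<le> L + 1"
    using eventually_gt_at_top[of 0]
  proof eventually_elim
    case (elim m)
    have "sup0 (\<phi> ` ops_power S m) \<le> sup0 (op_norm M ` ops_power S m)"
      by (rule sup0_mono[OF bdd(2)]) (use pos_ops_power[OF S, of m] \<phi>(2) in \<open>auto simp: pos_ops_def\<close>)
    then have "root m (sup0 (\<phi> ` ops_power S m)) \<le> root m (sup0 (op_norm M ` ops_power S m))"
      using elim by simp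
    then show ?case using elim(1) by linarith
  qed
  then show "\<exists>K. \<forall>\<^sub>F m in sequentially. root m (sup0 (\<phi> ` ops_power S m)) \<le> K" by blast
qed

lemma interp_set_power_sup:
  assumes \<theta>: "0 < \<theta>" "\<theta> < 1" and rel: "interp_set M \<theta> S P Q"
    and S: "pos_ops M S" "\<And>A. A \<in> S \<Longrightarrow> am_compact M A" and P: "pos_ops M P" and Q: "pos_ops M Q"
    and \<phi>: "\<And>A. pos_op M A \<Longrightarrow> 0 \<le> \<phi> A" "\<And>A. pos_op M A \<Longrightarrow> \<phi> A \<le> op_norm M A"
    and le: "\<And>T C D. am_compact M T \<Longrightarrow> interp M \<theta> T C D \<Longrightarrow> \<phi> T \<le> \<phi> C powr \<theta> * \<phi> D powr (1-\<theta>)"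
    and m: "m \<ge> 1"
  shows "sup0 (\<phi> ` ops_power S m) \<le> sup0 (\<phi> ` ops_power P m) powr \<theta> * sup0 (\<phi> ` ops_power Q m) powr (1-\<theta>)"
  by (rule interp_set_sup[OF \<theta> interp_set_power[OF \<theta> rel]])
    (use pos_ops_bdd[OF pos_ops_power[OF P] \<phi>(2)] pos_ops_bdd[OF pos_ops_power[OF Q] \<phi>(2)]
      \<phi>(1) pos_ops_power[OF P, of m] pos_ops_power[OF Q, of m] le am_compact_power[OF S m]
      in \<open>auto simp: pos_ops_def\<close>)

text \<open>This handles the two generalized radii; \<open>lim_sup_interp\<close> does the same for
  the joint radii, where submultiplicativity of \<phi> gives a genuine limit, and
  \<open>sup_interp\<close> for the three plain suprema. All functionals share the bounds between 0
  and the operator norm.\<close>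

lemma limsup_sup_interp:
  assumes \<theta>: "0 < \<theta>" "\<theta> < 1" and rel: "interp_set M \<theta> S P Q"
    and S: "pos_ops M S" "\<And>A. A \<in> S \<Longrightarrow> am_compact M A" and P: "pos_ops M P" and Q: "pos_ops M Q"
    and \<phi>: "\<And>A. pos_op M A \<Longrightarrow> 0 \<le> \<phi> A" "\<And>A. pos_op M A \<Longrightarrow> \<phi> A \<le> op_norm M A"
    and le: "\<And>T C D. am_compact M T \<Longrightarrow> interp M \<theta> T C D \<Longrightarrow> \<phi> T \<le> \<phi> C powr \<theta> * \<phi> D powr (1-\<theta>)"
  defines "\<rho> \<equiv> \<lambda>S. real_of_ereal (limsup (\<lambda>m. ereal (root m (sup0 (\<phi> ` ops_power S m)))))"
  shows "\<rho> S \<le> \<rho> P powr \<theta> * \<rho> Q powr (1-\<theta>)" "0 \<le> \<rho> P"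
proof -
  obtain K where K: "\<forall>\<^sub>F m in sequentially. root m (sup0 (\<phi> ` ops_power P m)) \<le> K"
    using root_sup0_bounded(2)[OF P \<phi>] by blast
  obtain K' where K': "\<forall>\<^sub>F m in sequentially. root m (sup0 (\<phi> ` ops_power Q m)) \<le> K'"
    using root_sup0_bounded(2)[OF Q \<phi>] by blast
  have nn: "0 \<le> sup0 (\<phi> ` ops_power P m)" "0 \<le> sup0 (\<phi> ` ops_power Q m)" for m
    by (rule sup0_nonneg[OF pos_ops_bdd[OF pos_ops_power \<phi>(2)]], rule P Q, assumption)+
  have "\<forall>\<^sub>F m in sequentially. root m (sup0 (\<phi> ` ops_power S m))
      \<le> root m (sup0 (\<phi> ` ops_power P m)) powr \<theta> * root m (sup0 (\<phi> ` ops_power Q m)) powr (1-\<theta>)"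
  proof (rule eventually_sequentiallyI[of 1])
    fix m :: nat assume m: "1 \<le> m"
    then show "root m (sup0 (\<phi> ` ops_power S m))
      \<le> root m (sup0 (\<phi> ` ops_power P m)) powr \<theta> * root m (sup0 (\<phi> ` ops_power Q m)) powr (1-\<theta>)"
      using interp_set_power_sup[OF \<theta> rel S P Q \<phi> le m] nn by (simp add: root_powr_mult[symmetric])
  qed
  then show "\<rho> S \<le> \<rho> P powr \<theta> * \<rho> Q powr (1-\<theta>)"
    unfolding \<rho>_def
    by (intro limsup_powr_le[OF \<theta> root_sup0_bounded(1)[OF S(1) \<phi>] root_sup0_bounded(1)[OF P \<phi>] K
          root_sup0_bounded(1)[OF Q \<phi>] K'])
  show "0 \<le> \<rho> P" unfolding \<rho>_def
    by (rule bounded_limsup_real(2)[OF root_sup0_bounded(1)[OF P \<phi>] K])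
qed

lemma lim_sup_interp:
  assumes \<theta>: "0 < \<theta>" "\<theta> < 1" and rel: "interp_set M \<theta> S P Q"
    and S: "pos_ops M S" "\<And>A. A \<in> S \<Longrightarrow> am_compact M A" and P: "pos_ops M P" and Q: "pos_ops M Q"
    and \<phi>: "\<And>A. pos_op M A \<Longrightarrow> 0 \<le> \<phi> A" "\<And>A. pos_op M A \<Longrightarrow> \<phi> A \<le> op_norm M A"
    and le: "\<And>T C D. am_compact M T \<Longrightarrow> interp M \<theta> T C D \<Longrightarrow> \<phi> T \<le> \<phi> C powr \<theta> * \<phi> D powr (1-\<theta>)"
    and sub: "\<And>A B. pos_op M A \<Longrightarrow> pos_op M B \<Longrightarrow> \<phi> (A \<circ> B) \<le> \<phi> A * \<phi> B"
  defines "\<rho> \<equiv> \<lambda>S. lim (\<lambda>m. root m (sup0 (\<phi> ` ops_power S m)))"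
  shows "\<rho> S \<le> \<rho> P powr \<theta> * \<rho> Q powr (1-\<theta>)" "0 \<le> \<rho> P"
proof -
  have conv: "(\<lambda>m. root m (sup0 (\<phi> ` ops_power X m))) \<longlonglongrightarrow> \<rho> X \<and> 0 \<le> \<rho> X" if X: "pos_ops M X" for X
  proof -
    obtain L where "0 \<le> L" "(\<lambda>m. root m (sup0 (\<phi> ` ops_power X m))) \<longlonglongrightarrow> L"
      by (rule sup0_power_Fekete[OF X, of \<phi>]) (use \<phi> sub in auto)
    then show ?thesis unfolding \<rho>_def by (simp add: limI)
  qed
  have nn: "0 \<le> sup0 (\<phi> ` ops_power P m)" "0 \<le> sup0 (\<phi> ` ops_power Q m)" for m
    by (rule sup0_nonneg[OF pos_ops_bdd[OF pos_ops_power \<phi>(2)]], rule P Q, assumption)+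
  show "\<rho> S \<le> \<rho> P powr \<theta> * \<rho> Q powr (1-\<theta>)"
    by (rule tendsto_root_powr_le[OF \<theta> nn interp_set_power_sup[OF \<theta> rel S P Q \<phi> le]])
      (use conv S P Q in auto)
  show "0 \<le> \<rho> P" using conv[OF P] by simp
qed

lemma sup_interp:
  assumes \<theta>: "0 < \<theta>" "\<theta> < 1" and rel: "interp_set M \<theta> S P Q"
    and S: "\<And>A. A \<in> S \<Longrightarrow> am_compact M A" and P: "pos_ops M P" and Q: "pos_ops M Q"
    and \<phi>: "\<And>A. pos_op M A \<Longrightarrow> 0 \<le> \<phi> A" "\<And>A. pos_op M A \<Longrightarrow> \<phi> A \<le> op_norm M A"
    and le: "\<And>T C D. am_compact M T \<Longrightarrow> interp M \<theta> T C D \<Longrightarrow> \<phi> T \<le> \<phi> C powr \<theta> * \<phi> D powr (1-\<theta>)"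
  shows "sup0 (\<phi> ` S) \<le> sup0 (\<phi> ` P) powr \<theta> * sup0 (\<phi> ` Q) powr (1-\<theta>)" "0 \<le> sup0 (\<phi> ` P)"
proof -
  note bdd = pos_ops_bdd[OF P \<phi>(2)] pos_ops_bdd[OF Q \<phi>(2)]
  show "sup0 (\<phi> ` S) \<le> sup0 (\<phi> ` P) powr \<theta> * sup0 (\<phi> ` Q) powr (1-\<theta>)"
    by (rule interp_set_sup[OF \<theta> rel bdd]) (use \<phi> P Q S le in \<open>auto simp: pos_ops_def\<close>)
  show "0 \<le> sup0 (\<phi> ` P)" by (rule sup0_nonneg[OF bdd(1)])
qed

text \<open>Nonnegativity of \<open>\<rho> P\<close> is carried along because recombining powers of
  it by \<open>powr_split\<close> requires a nonnegative base.\<close>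

lemma functional_interp:
  assumes \<theta>: "0 < \<theta>" "\<theta> < 1" and h: "weight M h" and rel: "interp_set M \<theta> S P Q"
    and S: "pos_ops M S" "\<And>A. A \<in> S \<Longrightarrow> am_compact M A" and P: "pos_ops M P" and Q: "pos_ops M Q"
    and \<rho>: "\<rho> \<in> {gen_spectral_rad M, joint_spectral_rad M,
               gen_ess_spectral_rad M, joint_ess_spectral_rad M,
               set_norm M, set_mnc M, set_numerical_radius M}"
  shows "\<rho> S \<le> \<rho> P powr \<theta> * \<rho> Q powr (1-\<theta>)" "0 \<le> \<rho> P"
proof -
  note b = pos_opD(1)
  have norm: "pos_op M A \<Longrightarrow> 0 \<le> op_norm M A" "pos_op M A \<Longrightarrow> op_norm M A \<le> op_norm M A"
    "am_compact M T \<Longrightarrow> interp M \<theta> T C D \<Longrightarrow>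
       op_norm M T \<le> op_norm M C powr \<theta> * op_norm M D powr (1-\<theta>)" for A T C D
    by (rule op_norm_nonneg[OF b], assumption) (rule order_refl interp_op_norm[OF \<theta>]; assumption)+
  have mnc: "pos_op M A \<Longrightarrow> 0 \<le> hausdorff_mnc M A" "pos_op M A \<Longrightarrow> hausdorff_mnc M A \<le> op_norm M A"
    "am_compact M T \<Longrightarrow> interp M \<theta> T C D \<Longrightarrow>
       hausdorff_mnc M T \<le> hausdorff_mnc M C powr \<theta> * hausdorff_mnc M D powr (1-\<theta>)" for A T C D
    by (rule hausdorff_mnc_nonneg[OF b], assumption) (rule hausdorff_mnc_le_norm[OF b] interp_hausdorff_mnc[OF \<theta> h]; assumption)+
  have num: "pos_op M A \<Longrightarrow> 0 \<le> numerical_radius M A" "pos_op M A \<Longrightarrow> numerical_radius M A \<le> op_norm M A"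
    "am_compact M T \<Longrightarrow> interp M \<theta> T C D \<Longrightarrow>
       numerical_radius M T \<le> numerical_radius M C powr \<theta> * numerical_radius M D powr (1-\<theta>)" for A T C D
    by (rule numerical_radius_nonneg[OF b], assumption) (rule numerical_radius_le_norm[OF b] interp_numerical_radius[OF \<theta>]; assumption)+
  have spec: "pos_op M A \<Longrightarrow> 0 \<le> spectral_rad M A" "pos_op M A \<Longrightarrow> spectral_rad M A \<le> op_norm M A"
    "am_compact M T \<Longrightarrow> interp M \<theta> T C D \<Longrightarrow>
       spectral_rad M T \<le> spectral_rad M C powr \<theta> * spectral_rad M D powr (1-\<theta>)" for A T C D
    by (rule spectral_rad_bounds(1), assumption) (rule spectral_rad_bounds(2) interp_spectral_rad[OF \<theta>]; assumption)+
  have ess: "pos_op M A \<Longrightarrow> 0 \<le> ess_spectral_rad M A" "pos_op M A \<Longrightarrow> ess_spectral_rad M A \<le> op_norm M A"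
    "am_compact M T \<Longrightarrow> interp M \<theta> T C D \<Longrightarrow>
       ess_spectral_rad M T \<le> ess_spectral_rad M C powr \<theta> * ess_spectral_rad M D powr (1-\<theta>)" for A T C D
    by (rule ess_spectral_rad_lim(2)[OF b], assumption) (rule ess_spectral_rad_le_norm[OF b] interp_ess_spectral_rad[OF \<theta> h]; assumption)+
  have "\<rho> S \<le> \<rho> P powr \<theta> * \<rho> Q powr (1-\<theta>) \<and> 0 \<le> \<rho> P"
    using \<rho>
  proof (elim insertE emptyE)
    assume "\<rho> = gen_spectral_rad M"
    show ?thesis
      using limsup_sup_interp[where \<phi>="spectral_rad M", OF \<theta> rel S P Q spec]
      unfolding \<open>\<rho> = gen_spectral_rad M\<close> gen_spectral_rad_def by (intro conjI)
  next
    assume "\<rho> = joint_spectral_rad M"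
    show ?thesis
      using lim_sup_interp[where \<phi>="op_norm M", OF \<theta> rel S P Q norm op_norm_comp[OF b b]]
      unfolding \<open>\<rho> = joint_spectral_rad M\<close> joint_spectral_rad_def by (intro conjI)
  next
    assume "\<rho> = gen_ess_spectral_rad M"
    show ?thesis
      using limsup_sup_interp[where \<phi>="ess_spectral_rad M", OF \<theta> rel S P Q ess]
      unfolding \<open>\<rho> = gen_ess_spectral_rad M\<close> gen_ess_spectral_rad_def by (intro conjI)
  next
    assume "\<rho> = joint_ess_spectral_rad M"
    show ?thesis
      using lim_sup_interp[where \<phi>="hausdorff_mnc M", OF \<theta> rel S P Q mnc hausdorff_mnc_comp[OF b b]]
      unfolding \<open>\<rho> = joint_ess_spectral_rad M\<close> joint_ess_spectral_rad_def by (intro conjI)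
  next
    assume "\<rho> = set_norm M"
    show ?thesis
      using sup_interp[where \<phi>="op_norm M", OF \<theta> rel S(2) P Q norm]
      unfolding \<open>\<rho> = set_norm M\<close> set_norm_def by (intro conjI)
  next
    assume "\<rho> = set_mnc M"
    show ?thesis
      using sup_interp[where \<phi>="hausdorff_mnc M", OF \<theta> rel S(2) P Q mnc]
      unfolding \<open>\<rho> = set_mnc M\<close> set_mnc_def by (intro conjI)
  next
    assume "\<rho> = set_numerical_radius M"
    show ?thesis
      using sup_interp[where \<phi>="numerical_radius M", OF \<theta> rel S(2) P Q num]
      unfolding \<open>\<rho> = set_numerical_radius M\<close> set_numerical_radius_def by (intro conjI)
  qed
  then show "\<rho> S \<le> \<rho> P powr \<theta> * \<rho> Q powr (1-\<theta>)" "0 \<le> \<rho> P" by auto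
qed

section \<open>Nonnegative kernels\<close>

context sigma_finite_measure
begin

interpretation P: pair_sigma_finite M M ..

text \<open>
  A nonnegative kernel of a bounded operator, with a bound \<open>C\<close> on the norm; the bilinear formulation
  is symmetric under transposition of the kernel.
\<close>

definition bker :: "real \<Rightarrow> ('a \<times> 'a \<Rightarrow> real) \<Rightarrow> bool" where
  "bker C a \<longleftrightarrow> a \<in> borel_measurable (M \<Otimes>\<^sub>M M) \<and> (\<forall>z. 0 \<le> a z) \<and> 0 \<le> C \<and>
     (\<forall>u\<in>pL M. \<forall>v\<in>pL M. (\<integral>\<^sup>+x. (\<integral>\<^sup>+y. ennreal (a (x, y) * u y * v x) \<partial>M) \<partial>M)
        \<le> ennreal (C * (l2_norm M (cr u) * l2_norm M (cr v))))"

lemma bkerD: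
  assumes "bker C a"
  shows "a \<in> borel_measurable (M \<Otimes>\<^sub>M M)" "0 \<le> a z" "0 \<le> C"
    and "u \<in> pL M \<Longrightarrow> v \<in> pL M \<Longrightarrow> (\<integral>\<^sup>+x. (\<integral>\<^sup>+y. ennreal (a (x, y) * u y * v x) \<partial>M) \<partial>M)
        \<le> ennreal (C * (l2_norm M (cr u) * l2_norm M (cr v)))"
  using assms unfolding bker_def by blast+

lemma obtain_weight:
  obtains h where "weight M h"
proof -
  obtain h :: "'a \<Rightarrow> real" where "h \<in> borel_measurable M" "\<And>x. 0 < h x" "integrable M h"
    by (rule obtain_positive_integrable_function) blast
  then show ?thesis using that by (auto simp: weight_def)
qed

lemma weight_sqrt_pL: "weight M h \<Longrightarrow> (\<lambda>x. sqrt (h x)) \<in> pL M"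
  by (auto simp: weight_def pL_def less_imp_le)

text \<open>A single strictly positive test function, \<open>sqrt (h x)\<close>, gives finiteness
  a.e. The truncations of \<open>w\<close> by multiples of it are admissible test functions; testing
  \<open>w\<close> against its own truncation bounds the norm of the truncation by \<open>K\<close>,
  and Fatou's lemma passes to \<open>w\<close>.\<close>

lemma L2_duality:
  assumes w[measurable]: "w \<in> borel_measurable M" and K: "0 \<le> K"
    and le: "\<And>v. v \<in> pL M \<Longrightarrow> (\<integral>\<^sup>+x. w x * ennreal (v x) \<partial>M) \<le> ennreal (K * l2_norm M (cr v))"
  shows "AE x in M. w x < top" "(\<lambda>x. enn2real (w x)) \<in> pL M" "l2_norm M (cr (\<lambda>x. enn2real (w x))) \<le> K"
proof -
  obtain h where h: "weight M h" by (rule obtain_weight)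
  have [measurable]: "h \<in> borel_measurable M" and h0: "\<And>x. 0 < h x"
    using h by (auto simp: weight_def)
  note s = weight_sqrt_pL[OF h]
  have "(\<integral>\<^sup>+x. w x * ennreal (sqrt (h x)) \<partial>M) \<noteq> \<infinity>"
    using le[OF s] by (metis ennreal_neq_top infinity_ennreal_def neq_top_trans)
  then have "AE x in M. w x * ennreal (sqrt (h x)) \<noteq> \<infinity>"
    by (intro nn_integral_PInf_AE) measurable
  then show fin: "AE x in M. w x < top"
  proof eventually_elim
    case (elim x)
    moreover have "ennreal (sqrt (h x)) \<noteq> 0" using h0[of x] by simp
    ultimately show ?case by (auto simp: ennreal_mult_eq_top_iff less_top)
  qed
  define v where "v = (\<lambda>(n::nat) x. min (enn2real (w x)) (real n * sqrt (h x)))"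
  have v0: "0 \<le> v n x" for n x unfolding v_def using h0[of x] by simp
  have [measurable]: "v n \<in> borel_measurable M" for n unfolding v_def by measurable
  have nsp: "(\<lambda>x. real n * sqrt (h x)) \<in> pL M" for n
    using pLD[OF s] by (auto simp: pL_def power_mult_distrib h0 less_imp_le)
  have v: "v n \<in> pL M" for n
    by (rule pL_dominated(1)[OF nsp[of n]]) (use v0 in \<open>auto simp: v_def\<close>)
  have vn: "l2_norm M (cr (v n)) \<le> K" for n
  proof -
    have "ennreal ((l2_norm M (cr (v n)))\<^sup>2) = ennreal (\<integral>x. (v n x)\<^sup>2 \<partial>M)" by (simp add: l2_norm_sq)
    also have "\<dots> = (\<integral>\<^sup>+x. ennreal ((v n x)\<^sup>2) \<partial>M)"
      using pLD(3)[OF v] by (intro nn_integral_eq_integral[symmetric]) auto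
    also have "\<dots> \<le> (\<integral>\<^sup>+x. w x * ennreal (v n x) \<partial>M)"
    proof (rule nn_integral_mono_AE)
      show "AE x in M. ennreal ((v n x)\<^sup>2) \<le> w x * ennreal (v n x)"
        using fin
      proof eventually_elim
        case (elim x)
        have "ennreal (v n x) \<le> ennreal (enn2real (w x))" by (rule ennreal_leI) (simp add: v_def)
        then have "ennreal (v n x) \<le> w x" using elim by simp
        then show ?case using v0[of n x] by (simp add: power2_eq_square ennreal_mult mult_right_mono)
      qed
    qed
    also have "\<dots> \<le> ennreal (K * l2_norm M (cr (v n)))" by (rule le[OF v])
    finally have "l2_norm M (cr (v n)) * l2_norm M (cr (v n)) \<le> K * l2_norm M (cr (v n))"
      using K by (simp add: power2_eq_square)
    then show ?thesis using K l2_norm_nonneg[of M "cr (v n)"]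
      by (cases "l2_norm M (cr (v n)) = 0") (auto simp: mult_le_cancel_right)
  qed
  have lim: "(\<lambda>n. v n x) \<longlonglongrightarrow> enn2real (w x)" for x
  proof -
    obtain N :: nat where N: "enn2real (w x) / sqrt (h x) \<le> N" using real_arch_simple by blast
    have "v n x = enn2real (w x)" if "n \<ge> N" for n
    proof -
      have "enn2real (w x) / sqrt (h x) \<le> real n" using N that by (meson of_nat_le_iff order_trans)
      then have "enn2real (w x) \<le> real n * sqrt (h x)" using h0[of x] by (simp add: pos_divide_le_eq)
      then show ?thesis by (simp add: v_def)
    qed
    then show ?thesis by (intro tendsto_eventually eventually_sequentiallyI[of N]) auto
  qed
  have m: "cr (\<lambda>x. enn2real (w x)) \<in> borel_measurable M" by measurable
  have "AE x in M. (\<lambda>n. complex_of_real (v n x)) \<longlonglongrightarrow> complex_of_real (enn2real (w x))"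
    by (intro AE_I2 tendsto_of_real lim)
  note F = L2_Fatou[OF cr_L2[OF v] vn m this]
  show "(\<lambda>x. enn2real (w x)) \<in> pL M" using cmod_pL[OF F(1)] by simp
  show "l2_norm M (cr (\<lambda>x. enn2real (w x))) \<le> K" by (rule F(2))
qed

text \<open>By duality the bilinear bound, applied to the modulus of \<open>f\<close>, places the
  absolute section integrals \<open>w\<close> in the space with norm at most \<open>C\<close> times
  that of \<open>f\<close>. Being finite a.e., they make the kernel integral converge
  absolutely.\<close>

lemma bker_section:
  assumes a: "bker C a" and f: "f \<in> L2 M"
  defines "w \<equiv> \<lambda>x. \<integral>\<^sup>+y. ennreal (a (x, y) * cmod (f y)) \<partial>M"
  shows "AE x in M. integrable M (\<lambda>y. complex_of_real (a (x, y)) * f y)"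
    and "AE x in M. cmod (kernel_integral M (cr a) f x) \<le> enn2real (w x)"
    and "(\<lambda>x. enn2real (w x)) \<in> pL M" "l2_norm M (cr (\<lambda>x. enn2real (w x))) \<le> C * l2_norm M f"
proof -
  have [measurable]: "a \<in> borel_measurable (M \<Otimes>\<^sub>M M)" "f \<in> borel_measurable M" using bkerD[OF a] f by (auto simp: L2_def)
  have a0: "0 \<le> a z" for z by (rule bkerD(2)[OF a])
  have [measurable]: "w \<in> borel_measurable M" unfolding w_def by measurable
  have dual: "(\<integral>\<^sup>+x. w x * ennreal (v x) \<partial>M) \<le> ennreal (C * l2_norm M f * l2_norm M (cr v))" if v: "v \<in> pL M" for v
  proof -
    have [measurable]: "v \<in> borel_measurable M" using v by (auto simp: pL_def)
    have "(\<integral>\<^sup>+x. w x * ennreal (v x) \<partial>M) = (\<integral>\<^sup>+x. (\<integral>\<^sup>+y. ennreal (a (x, y) * cmod (f y) * v x) \<partial>M) \<partial>M)"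
      unfolding w_def using a0 pLD(2)[OF v]
      by (intro nn_integral_cong) (simp add: ennreal_mult nn_integral_multc)
    also have "\<dots> \<le> ennreal (C * l2_norm M f * l2_norm M (cr v))"
      using bkerD(4)[OF a cmod_pL[OF f] v] by (simp add: l2_norm_cmod mult.assoc)
    finally show ?thesis .
  qed
  have C: "0 \<le> C * l2_norm M f" using bkerD(3)[OF a] by simp
  note D = L2_duality[OF _ C dual]
  show "(\<lambda>x. enn2real (w x)) \<in> pL M" "l2_norm M (cr (\<lambda>x. enn2real (w x))) \<le> C * l2_norm M f"
    using D by simp_all
  have fin: "AE x in M. w x < top" using D by simp
  show int: "AE x in M. integrable M (\<lambda>y. complex_of_real (a (x, y)) * f y)"
    using fin
  proof (rule AE_mp, intro AE_I2 impI)
    fix x assume x: "x \<in> space M" and "w x < top"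
    then show "integrable M (\<lambda>y. complex_of_real (a (x, y)) * f y)"
      unfolding w_def using a0 by (intro integrableI_bounded) (auto simp: norm_mult top.not_eq_extremum less_top)
  qed
  show "AE x in M. cmod (kernel_integral M (cr a) f x) \<le> enn2real (w x)"
    using int fin
  proof eventually_elim
    case (elim x)
    have "ennreal (cmod (kernel_integral M (cr a) f x)) \<le> (\<integral>\<^sup>+y. ennreal (cmod (complex_of_real (a (x, y)) * f y)) \<partial>M)"
      unfolding kernel_integral_def by (rule integral_norm_bound_ennreal[OF elim(1)])
    also have "\<dots> = w x" unfolding w_def using a0 by (simp add: norm_mult)
    finally show ?case using elim(2) by (metis enn2real_ennreal enn2real_mono norm_ge_zero)
  qed
qed

lemma kernel_integral_measurable:
  assumes "k \<in> borel_measurable (M \<Otimes>\<^sub>M M)" "f \<in> borel_measurable M"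
  shows "kernel_integral M k f \<in> borel_measurable M"
proof -
  note [measurable] = assms
  show ?thesis unfolding kernel_integral_def by measurable
qed

lemma absop_kernel:
  assumes "\<And>z. 0 \<le> a z" "\<And>y. 0 \<le> u y"
  shows "kernel_integral M (cr a) (cr u) x = complex_of_real (\<integral>y. a (x, y) * u y \<partial>M)"
    and "absop (kernel_integral M (cr a)) u x = (\<integral>y. a (x, y) * u y \<partial>M)"
proof -
  have "kernel_integral M (cr a) (cr u) x = (\<integral>y. complex_of_real (a (x, y) * u y) \<partial>M)"
    by (simp add: kernel_integral_def)
  then show *: "kernel_integral M (cr a) (cr u) x = complex_of_real (\<integral>y. a (x, y) * u y \<partial>M)"
    by (simp only: integral_complex_of_real)
  show "absop (kernel_integral M (cr a)) u x = (\<integral>y. a (x, y) * u y \<partial>M)"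
    unfolding absop_def * using assms by simp
qed

lemma bker_integrable:
  assumes a: "bker C a" and u: "u \<in> pL M"
  shows "AE x in M. integrable M (\<lambda>y. a (x, y) * u y)"
  using bker_section(1)[OF a cr_L2[OF u]]
proof eventually_elim
  case (elim x)
  then have "integrable M (\<lambda>y. complex_of_real (a (x, y) * u y))" by simp
  then show ?case by (simp only: complex_of_real_integrable_eq)
qed

lemma bker_pos_op:
  assumes a: "bker C a"
  shows "pos_op M (kernel_integral M (cr a))" "op_norm M (kernel_integral M (cr a)) \<le> C"
    "has_kernel M (kernel_integral M (cr a)) (cr a)"
proof -
  let ?K = "kernel_integral M (cr a)"
  have [measurable]: "a \<in> borel_measurable (M \<Otimes>\<^sub>M M)" by (rule bkerD(1)[OF a])
  have am: "cr a \<in> borel_measurable (M \<Otimes>\<^sub>M M)" by measurable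
  have a0: "0 \<le> a z" for z by (rule bkerD(2)[OF a])
  have KL: "?K f \<in> L2 M" and Kn: "l2_norm M (?K f) \<le> C * l2_norm M f" if f: "f \<in> L2 M" for f
  proof -
    note B = bker_section[OF a f]
    note L = L2_dominated[OF B(3) kernel_integral_measurable[OF am L2D(1)[OF f]] B(2)]
    show "?K f \<in> L2 M" by (rule L(1))
    show "l2_norm M (?K f) \<le> C * l2_norm M f" using L(2) B(4) by simp
  qed
  have "linear_op M ?K"
    unfolding linear_op_def
  proof (intro conjI ballI allI impI)
    fix f g assume f: "f \<in> L2 M" and g: "g \<in> L2 M"
    have [measurable]: "f \<in> borel_measurable M" "g \<in> borel_measurable M" using f g by (auto simp: L2_def)
    show "?K f \<in> L2 M" by (rule KL[OF f])
    show "AE x in M. ?K f x = ?K g x" if eq: "AE x in M. f x = g x"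
    proof (rule AE_I2)
      fix x assume x: "x \<in> space M"
      show "?K f x = ?K g x"
        unfolding kernel_integral_def by (rule integral_cong_AE) (use x eq in \<open>auto simp: \<close>)
    qed
    show "AE x in M. ?K (\<lambda>t. f t + g t) x = ?K f x + ?K g x"
      using bker_section(1)[OF a f] bker_section(1)[OF a g]
      by eventually_elim (simp add: kernel_integral_def distrib_left)
  next
    fix c f assume f: "f \<in> L2 M"
    show "AE x in M. ?K (\<lambda>t. c * f t) x = c * ?K f x"
      by (simp add: kernel_integral_def mult.left_commute)
  qed
  then have bK: "bounded_op M ?K" unfolding bounded_op_def using Kn by blast
  show "op_norm M ?K \<le> C" by (rule op_norm_least[OF bkerD(3)[OF a] Kn])
  show "has_kernel M ?K (cr a)"
    unfolding has_kernel_def using am bker_section(1)[OF a] by auto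
  show "pos_op M ?K"
    unfolding pos_op_def
  proof (intro conjI ballI impI bK)
    fix u assume u: "u \<in> pL M"
    show "AE x in M. ?K (cr u) x = complex_of_real (absop ?K u x)"
      using absop_kernel[of a u, OF a0 pLD(2)[OF u]] by simp
    fix f assume f: "f \<in> L2 M" and le: "AE x in M. cmod (f x) \<le> u x"
    have [measurable]: "f \<in> borel_measurable M" "u \<in> borel_measurable M" using f u by (auto simp: L2_def pL_def)
    show "AE x in M. cmod (?K f x) \<le> absop ?K u x"
      using bker_section(1)[OF a f] bker_integrable[OF a u]
    proof (rule AE_mp[OF AE_conjI], intro AE_I2 impI, elim conjE)
      fix x assume x: "x \<in> space M" and i: "integrable M (\<lambda>y. complex_of_real (a (x, y)) * f y)"
        "integrable M (\<lambda>y. a (x, y) * u y)"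
      have "cmod (?K f x) \<le> (\<integral>y. cmod (complex_of_real (a (x, y)) * f y) \<partial>M)"
        unfolding kernel_integral_def by (rule integral_norm_bound)
      also have "\<dots> \<le> (\<integral>y. a (x, y) * u y \<partial>M)"
      proof (rule integral_mono_AE[OF integrable_norm[OF i(1)] i(2)])
        show "AE y in M. cmod (complex_of_real (a (x, y)) * f y) \<le> a (x, y) * u y"
          using le by eventually_elim (use a0 in \<open>simp add: norm_mult mult_left_mono\<close>)
      qed
      finally show "cmod (?K f x) \<le> absop ?K u x"
        using absop_kernel(2)[of a u, OF a0 pLD(2)[OF u]] by simp
    qed
  qed
qed

text \<open>Converse of \<open>bker_pos_op\<close>: for nonnegative \<open>u\<close> the inner
  integral is \<open>A u\<close> a.e., and Cauchy-Schwarz yields the bilinear bound with the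
  operator norm.\<close>

lemma has_kernel_bker:
  assumes A: "bounded_op M A" and k: "has_kernel M A (cr a)" and a0: "\<And>z. 0 \<le> a z"
  shows "bker (op_norm M A) a"
  unfolding bker_def
proof (intro conjI ballI allI a0 op_norm_nonneg[OF A])
  have "cr a \<in> borel_measurable (M \<Otimes>\<^sub>M M)" using k by (simp add: has_kernel_def)
  then show am[measurable]: "a \<in> borel_measurable (M \<Otimes>\<^sub>M M)" by (simp add: borel_measurable_complex_iff)
  fix u v assume u: "u \<in> pL M" and v: "v \<in> pL M"
  have [measurable]: "u \<in> borel_measurable M" "v \<in> borel_measurable M" using u v by (auto simp: pL_def)
  have Au: "A (cr u) \<in> L2 M" by (rule bounded_op_L2[OF A cr_L2[OF u]])
  have ae: "AE x in M. integrable M (\<lambda>y. complex_of_real (a (x, y)) * complex_of_real (u y)) \<and>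
     A (cr u) x = kernel_integral M (cr a) (cr u) x"
    by (rule bspec[OF conjunct2[OF k[unfolded has_kernel_def]] cr_L2[OF u]])
  have "(\<integral>\<^sup>+x. (\<integral>\<^sup>+y. ennreal (a (x, y) * u y * v x) \<partial>M) \<partial>M) = (\<integral>\<^sup>+x. ennreal (cmod (A (cr u) x) * v x) \<partial>M)"
  proof (rule nn_integral_cong_AE)
    show "AE x in M. (\<integral>\<^sup>+y. ennreal (a (x, y) * u y * v x) \<partial>M) = ennreal (cmod (A (cr u) x) * v x)"
      using ae
    proof eventually_elim
      case (elim x)
      have "integrable M (\<lambda>y. complex_of_real (a (x, y) * u y))" using elim by simp
      then have i: "integrable M (\<lambda>y. a (x, y) * u y)" by (simp only: complex_of_real_integrable_eq)
      have n: "cmod (A (cr u) x) = (\<integral>y. a (x, y) * u y \<partial>M)"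
        using absop_kernel(2)[of a u x, OF a0 pLD(2)[OF u]] elim by (simp add: absop_def)
      have "(\<integral>\<^sup>+y. ennreal (a (x, y) * u y * v x) \<partial>M) = ennreal (\<integral>y. a (x, y) * u y * v x \<partial>M)"
        using i a0 pLD(2)[OF u] pLD(2)[OF v] by (intro nn_integral_eq_integral) auto
      then show ?case using n by simp
    qed
  qed
  also have "\<dots> = ennreal (\<integral>x. cmod (A (cr u) x) * v x \<partial>M)"
    using pL_Cauchy_Schwarz(1)[OF cmod_pL[OF Au] v] pLD(2)[OF v] by (intro nn_integral_eq_integral) auto
  also have "\<dots> \<le> ennreal (op_norm M A * (l2_norm M (cr u) * l2_norm M (cr v)))"
  proof (rule ennreal_leI)
    have "(\<integral>x. cmod (A (cr u) x) * v x \<partial>M) \<le> l2_norm M (A (cr u)) * l2_norm M (cr v)"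
      using pL_Cauchy_Schwarz(2)[OF cmod_pL[OF Au] v] by (simp only: l2_norm_cmod)
    also have "\<dots> \<le> (op_norm M A * l2_norm M (cr u)) * l2_norm M (cr v)"
      by (intro mult_right_mono l2_norm_apply_le A cr_L2 u) simp
    finally show "(\<integral>x. cmod (A (cr u) x) * v x \<partial>M) \<le> op_norm M A * (l2_norm M (cr u) * l2_norm M (cr v))"
      by (simp add: mult.assoc)
  qed
  finally show "(\<integral>\<^sup>+x. (\<integral>\<^sup>+y. ennreal (a (x, y) * u y * v x) \<partial>M) \<partial>M)
        \<le> ennreal (op_norm M A * (l2_norm M (cr u) * l2_norm M (cr v)))" .
qed

abbreviation (input) flip :: "('a \<times> 'a \<Rightarrow> 'b) \<Rightarrow> 'a \<times> 'a \<Rightarrow> 'b" where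
  "flip a \<equiv> \<lambda>z. a (snd z, fst z)"

lemma bker_flip:
  assumes a: "bker C a"
  shows "bker C (flip a)"
proof -
  have [measurable]: "a \<in> borel_measurable (M \<Otimes>\<^sub>M M)" by (rule bkerD(1)[OF a])
  have "(\<integral>\<^sup>+x. (\<integral>\<^sup>+y. ennreal (a (y, x) * u y * v x) \<partial>M) \<partial>M)
        \<le> ennreal (C * (l2_norm M (cr u) * l2_norm M (cr v)))" if u: "u \<in> pL M" and v: "v \<in> pL M" for u v
  proof -
    have [measurable]: "u \<in> borel_measurable M" "v \<in> borel_measurable M" using u v by (auto simp: pL_def)
    have "(\<integral>\<^sup>+x. (\<integral>\<^sup>+y. ennreal (a (y, x) * u y * v x) \<partial>M) \<partial>M)
      = (\<integral>\<^sup>+y. (\<integral>\<^sup>+x. ennreal (a (y, x) * u y * v x) \<partial>M) \<partial>M)"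
      by (rule P.Fubini') measurable
    also have "\<dots> \<le> ennreal (C * (l2_norm M (cr v) * l2_norm M (cr u)))"
      using bkerD(4)[OF a v u] by (simp add: mult_ac)
    finally show ?thesis by (simp add: mult_ac)
  qed
  then show ?thesis unfolding bker_def using bkerD(2,3)[OF a] by auto
qed

text \<open>Fubini's theorem; absolute integrability of \<open>F\<close> is exactly the bilinear
  bound for the moduli of \<open>f\<close> and \<open>g\<close>.\<close>

lemma bker_adjoint:
  assumes a: "bker C a"
  shows "adjoint_of M (kernel_integral M (cr a)) (kernel_integral M (cr (flip a)))"
  unfolding adjoint_of_def
proof (intro conjI ballI)
  note a' = bker_flip[OF a]
  show "bounded_op M (kernel_integral M (cr (flip a)))" by (rule pos_opD(1)[OF bker_pos_op(1)[OF a']])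
  fix f g assume f: "f \<in> L2 M" and g: "g \<in> L2 M"
  have [measurable]: "a \<in> borel_measurable (M \<Otimes>\<^sub>M M)" "f \<in> borel_measurable M" "g \<in> borel_measurable M"
    using bkerD(1)[OF a] f g by (auto simp: L2_def)
  have a0: "0 \<le> a z" for z by (rule bkerD(2)[OF a])
  define F where "F = (\<lambda>(x, y). complex_of_real (a (x, y)) * f y * cnj (g x))"
  have [measurable]: "F \<in> borel_measurable (M \<Otimes>\<^sub>M M)" unfolding F_def by measurable
  have Fi: "integrable (M \<Otimes>\<^sub>M M) F"
  proof (rule integrableI_bounded)
    have "(\<integral>\<^sup>+z. ennreal (norm (F z)) \<partial>(M \<Otimes>\<^sub>M M)) = (\<integral>\<^sup>+x. (\<integral>\<^sup>+y. ennreal (norm (F (x, y))) \<partial>M) \<partial>M)"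
      by (rule nn_integral_fst[symmetric]) measurable
    also have "\<dots> = (\<integral>\<^sup>+x. (\<integral>\<^sup>+y. ennreal (a (x, y) * cmod (f y) * cmod (g x)) \<partial>M) \<partial>M)"
      using a0 by (simp add: F_def norm_mult)
    also have "\<dots> \<le> ennreal (C * (l2_norm M (\<lambda>x. complex_of_real (cmod (f x))) * l2_norm M (\<lambda>x. complex_of_real (cmod (g x)))))"
      by (rule bkerD(4)[OF a cmod_pL[OF f] cmod_pL[OF g]])
    finally show "(\<integral>\<^sup>+z. ennreal (norm (F z)) \<partial>(M \<Otimes>\<^sub>M M)) < \<infinity>" by (simp add: le_less_trans)
  qed measurable
  have Fi': "integrable (M \<Otimes>\<^sub>M M) (\<lambda>(x, y). F (x, y))" using Fi by (simp add: case_prod_beta)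
  have "l2_inner M (kernel_integral M (cr a) f) g = (\<integral>x. (\<integral>y. F (x, y) \<partial>M) \<partial>M)"
    unfolding l2_inner_def kernel_integral_def F_def by (simp flip: integral_mult_left_zero)
  also have "\<dots> = (\<integral>y. (\<integral>x. F (x, y) \<partial>M) \<partial>M)" by (rule P.Fubini_integral[OF Fi', symmetric])
  also have "\<dots> = (\<integral>y. f y * cnj (\<integral>x. complex_of_real (a (x, y)) * g x \<partial>M) \<partial>M)"
  proof (rule Bochner_Integration.integral_cong[OF refl])
    fix y
    have "cnj (\<integral>x. complex_of_real (a (x, y)) * g x \<partial>M) = (\<integral>x. complex_of_real (a (x, y)) * cnj (g x) \<partial>M)"
      using Bochner_Integration.integral_cnj[of M "\<lambda>x. complex_of_real (a (x, y)) * g x"] by simp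
    then show "(\<integral>x. F (x, y) \<partial>M) = f y * cnj (\<integral>x. complex_of_real (a (x, y)) * g x \<partial>M)"
      by (simp add: F_def mult_ac flip: integral_mult_right_zero)
  qed
  also have "\<dots> = l2_inner M f (kernel_integral M (cr (flip a)) g)"
    unfolding l2_inner_def kernel_integral_def by simp
  finally show "l2_inner M (kernel_integral M (cr a) f) g = l2_inner M f (kernel_integral M (cr (flip a)) g)" .
qed

end

section \<open>Positivity and uniqueness of kernels\<close>

text \<open>The sets that can be approximated in measure by members of the algebra form a
  sigma-algebra; finiteness of the measure enters for countable unions, through continuity from
  above.\<close>

lemma algebra_approximation:
  assumes "finite_measure N" and alg: "algebra (space N) \<A>" and gen: "sets N = sigma_sets (space N) \<A>"
    and Q: "Q \<in> sets N"
  shows "\<forall>e>0. \<exists>P\<in>\<A>. measure N ((Q - P) \<union> (P - Q)) < e"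
proof -
  interpret finite_measure N by fact
  interpret A: algebra "space N" \<A> by fact
  have AN: "P \<in> sets N" if "P \<in> \<A>" for P unfolding gen using that by (rule sigma_sets.Basic)
  show ?thesis
    using Q unfolding gen
  proof induction
    case (Basic a)
    then show ?case by (intro allI impI bexI[of _ a]) auto
  next
    case Empty
    show ?case by (intro allI impI bexI[of _ "{}"]) auto
  next
    case (Compl a)
    have aN: "a \<subseteq> space N" using Compl.hyps gen sets.sets_into_space by auto
    show ?case
    proof (intro allI impI)
      fix e :: real assume "e > 0"
      then obtain P where P: "P \<in> \<A>" "measure N ((a - P) \<union> (P - a)) < e" using Compl.IH by blast
      have "P \<subseteq> space N" using AN[OF P(1)] sets.sets_into_space by auto
      then have "(space N - a - (space N - P)) \<union> (space N - P - (space N - a)) = (a - P) \<union> (P - a)"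
        using aN by auto
      then show "\<exists>P\<in>\<A>. measure N ((space N - a - P) \<union> (P - (space N - a))) < e"
        using P by (intro bexI[of _ "space N - P"]) auto
    qed
  next
    case (Union a)
    have aN: "a i \<in> sets N" for i unfolding gen by (rule Union.hyps)
    show ?case
    proof (intro allI impI)
      fix e :: real assume e: "e > 0"
      \<comment> \<open>\<open>D n\<close> is the part of the union missed by the first
        \<open>n\<close> sets. It costs less than \<open>e/2\<close>, and the \<open>n\<close>
        approximations together at most another \<open>e/2\<close>.\<close>
      define D where "D = (\<lambda>n. (\<Union>i. a i) - (\<Union>i<n. a i))"
      have "(\<lambda>n. measure N (D n)) \<longlonglongrightarrow> measure N (\<Inter>n. D n)"
        by (rule finite_Lim_measure_decseq) (use aN in \<open>auto simp: D_def decseq_def\<close>)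
      also have "(\<Inter>n. D n) = {}" unfolding D_def by auto
      finally have "(\<lambda>n. measure N (D n)) \<longlonglongrightarrow> 0" by simp
      from order_tendstoD(2)[OF this, of "e/2"] e obtain n where n: "measure N (D n) < e/2"
        by (auto simp: eventually_sequentially)
      have "\<exists>P\<in>\<A>. measure N ((a i - P) \<union> (P - a i)) < e / (2 * (real n + 1))" for i
        using Union.IH[of i] e by auto
      then obtain P where P: "\<And>i. P i \<in> \<A>" "\<And>i. measure N ((a i - P i) \<union> (P i - a i)) < e / (2 * (real n + 1))"
        by metis
      let ?R = "\<Union>i<n. P i"
      have R: "?R \<in> \<A>" using P(1) by (intro A.finite_UN) auto
      have "((\<Union>i. a i) - ?R) \<union> (?R - (\<Union>i. a i)) \<subseteq> D n \<union> (\<Union>i<n. (a i - P i) \<union> (P i - a i))"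
        unfolding D_def by auto
      then have "measure N (((\<Union>i. a i) - ?R) \<union> (?R - (\<Union>i. a i)))
          \<le> measure N (D n \<union> (\<Union>i<n. (a i - P i) \<union> (P i - a i)))"
        by (intro finite_measure_mono) (use aN AN[OF P(1)] in \<open>auto simp: D_def\<close>)
      also have "\<dots> \<le> measure N (D n) + measure N (\<Union>i<n. (a i - P i) \<union> (P i - a i))"
        by (intro measure_Un_le) (use aN AN[OF P(1)] in \<open>auto simp: D_def\<close>)
      also have "measure N (\<Union>i<n. (a i - P i) \<union> (P i - a i)) \<le> (\<Sum>i<n. measure N ((a i - P i) \<union> (P i - a i)))"
        by (intro finite_measure_subadditive_finite) (use aN AN[OF P(1)] in auto)
      also have "\<dots> \<le> (\<Sum>i<n. e / (2 * (real n + 1)))"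
        using P(2) by (intro sum_mono) (auto simp: less_imp_le)
      also have "\<dots> \<le> e / 2" using e by (simp add: field_simps)
      finally have "measure N (((\<Union>i. a i) - ?R) \<union> (?R - (\<Union>i. a i))) < e" using n by simp
      then show "\<exists>P\<in>\<A>. measure N (((\<Union>i. a i) - P) \<union> (P - (\<Union>i. a i))) < e" using R by blast
    qed
  qed
qed

lemma integral_nonneg_Reals:
  fixes f :: "'b \<Rightarrow> complex"
  assumes "AE x in N. f x \<in> \<real>\<^sub>\<ge>\<^sub>0"
  shows "integral\<^sup>L N f \<in> \<real>\<^sub>\<ge>\<^sub>0"
proof (cases "integrable N f")
  case True
  have "(\<integral>x. Im (f x) \<partial>N) = (\<integral>x. 0 \<partial>N)"
    by (rule integral_cong_AE) (use True assms in \<open>auto simp: complex_nonneg_Reals_iff\<close>)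
  moreover have "0 \<le> (\<integral>x. Re (f x) \<partial>N)"
    by (rule integral_nonneg_AE) (use assms in \<open>auto simp: complex_nonneg_Reals_iff\<close>)
  ultimately show ?thesis using True by (simp add: complex_nonneg_Reals_iff)
qed (simp add: not_integrable_integral_eq)

context sigma_finite_measure
begin

interpretation P: pair_sigma_finite M M ..

text \<open>
  Measurable sets with countably many different vertical sections. They form an algebra, and a
  kernel of a positive operator has nonnegative integrals over them because only countably many
  null sets are involved.
\<close>

definition column_sets :: "('a \<times> 'a) set set" where
  "column_sets = {{z \<in> space (M \<Otimes>\<^sub>M M). snd z \<in> F (s (fst z))} | (s :: 'a \<Rightarrow> nat) F.
     s \<in> measurable M (count_space UNIV) \<and> range F \<subseteq> sets M}"

lemma column_setsI:
  fixes s :: "'a \<Rightarrow> nat"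
  assumes "s \<in> measurable M (count_space UNIV)" "\<And>i. F i \<in> sets M"
    "X = {z \<in> space (M \<Otimes>\<^sub>M M). snd z \<in> F (s (fst z))}"
  shows "X \<in> column_sets"
  using assms unfolding column_sets_def by blast

lemma column_setsE:
  assumes "X \<in> column_sets"
  obtains s :: "'a \<Rightarrow> nat" and F where "s \<in> measurable M (count_space UNIV)" "\<And>i. F i \<in> sets M"
    "X = {z \<in> space (M \<Otimes>\<^sub>M M). snd z \<in> F (s (fst z))}"
proof -
  from assms obtain s :: "'a \<Rightarrow> nat" and F where "s \<in> measurable M (count_space UNIV)" "range F \<subseteq> sets M"
    "X = {z \<in> space (M \<Otimes>\<^sub>M M). snd z \<in> F (s (fst z))}"
    unfolding column_sets_def mem_Collect_eq by (elim exE conjE)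
  then show ?thesis by (intro that[of s F]) auto
qed

lemma column_sets_measurable: "X \<in> column_sets \<Longrightarrow> X \<in> sets (M \<Otimes>\<^sub>M M)"
proof -
  assume "X \<in> column_sets"
  then obtain s :: "'a \<Rightarrow> nat" and F where [measurable]: "s \<in> measurable M (count_space UNIV)" "\<And>i. F i \<in> sets M"
    and X: "X = {z \<in> space (M \<Otimes>\<^sub>M M). snd z \<in> F (s (fst z))}" by (rule column_setsE) blast
  have FS: "F i \<subseteq> space M" for i by (rule sets.sets_into_space) measurable
  have "X = (\<Union>i. (s -` {i} \<inter> space M) \<times> F i)"
    unfolding X using FS by (auto simp: space_pair_measure)
  also have "\<dots> \<in> sets (M \<Otimes>\<^sub>M M)" by measurable
  finally show ?thesis .
qed

lemma algebra_column_sets: "algebra (space (M \<Otimes>\<^sub>M M)) column_sets"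
  unfolding algebra_iff_Un
proof (intro conjI ballI)
  show "column_sets \<subseteq> Pow (space (M \<Otimes>\<^sub>M M))" unfolding column_sets_def by auto
  show "{} \<in> column_sets" by (rule column_setsI[of "\<lambda>_. 0" "\<lambda>_. {}"]) auto
  fix X assume "X \<in> column_sets"
  then obtain s :: "'a \<Rightarrow> nat" and F where s: "s \<in> measurable M (count_space UNIV)" "\<And>i. F i \<in> sets M"
    and X: "X = {z \<in> space (M \<Otimes>\<^sub>M M). snd z \<in> F (s (fst z))}" by (rule column_setsE) blast
  show "space (M \<Otimes>\<^sub>M M) - X \<in> column_sets"
    by (rule column_setsI[OF s(1), of "\<lambda>i. space M - F i"]) (use s(2) in \<open>auto simp: X space_pair_measure\<close>)
  fix Y assume "Y \<in> column_sets"
  then obtain t :: "'a \<Rightarrow> nat" and G where t: "t \<in> measurable M (count_space UNIV)" "\<And>i. G i \<in> sets M"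
    and Y: "Y = {z \<in> space (M \<Otimes>\<^sub>M M). snd z \<in> G (t (fst z))}" by (rule column_setsE) blast
  have [measurable]: "s \<in> measurable M (count_space UNIV)" "t \<in> measurable M (count_space UNIV)" by fact+
  show "X \<union> Y \<in> column_sets"
  \<comment> \<open>The two column indices are coded into one natural number.\<close>
  proof (rule column_setsI[of "\<lambda>x. prod_encode (s x, t x)" "\<lambda>n. F (fst (prod_decode n)) \<union> G (snd (prod_decode n))"])
    show "(\<lambda>x. prod_encode (s x, t x)) \<in> measurable M (count_space UNIV)" by measurable
  qed (use s(2) t(2) in \<open>auto simp: X Y\<close>)
qed

lemma sigma_sets_column_sets: "sets (M \<Otimes>\<^sub>M M) = sigma_sets (space (M \<Otimes>\<^sub>M M)) column_sets"
proof
  have "{a \<times> b | a b. a \<in> sets M \<and> b \<in> sets M} \<subseteq> column_sets"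
  proof safe
    fix a b assume [measurable]: "a \<in> sets M" "b \<in> sets M"
    show "a \<times> b \<in> column_sets"
    proof (rule column_setsI[of "\<lambda>x. if x \<in> a then 1 else 0" "\<lambda>n. if n = 1 then b else {}"])
      show "a \<times> b = {z \<in> space (M \<Otimes>\<^sub>M M). snd z \<in> (if (if fst z \<in> a then 1 else 0) = (1::nat) then b else {})}"
        using sets.sets_into_space[of a M] sets.sets_into_space[of b M]
        by (auto simp: space_pair_measure split: if_splits)
    qed auto
  qed
  then show "sets (M \<Otimes>\<^sub>M M) \<subseteq> sigma_sets (space (M \<Otimes>\<^sub>M M)) column_sets"
    unfolding sets_pair_measure space_pair_measure by (rule sigma_sets_mono')
  show "sigma_sets (space (M \<Otimes>\<^sub>M M)) column_sets \<subseteq> sets (M \<Otimes>\<^sub>M M)"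
    by (rule sets.sigma_sets_subset) (auto intro: column_sets_measurable)
qed

text \<open>Over a column set the integral is an integral of nonnegative section integrals.
  Approximation in the measure with density \<open>cmod (\<kappa> z)\<close> extends nonnegativity
  to every measurable set, and averages in a closed set force the values into it a.e.\<close>

lemma integrable_nonneg_if_columns:
  fixes \<kappa> :: "'a \<times> 'a \<Rightarrow> complex"
  assumes \<kappa>: "integrable (M \<Otimes>\<^sub>M M) \<kappa>"
    and sec: "\<And>F. F \<in> sets M \<Longrightarrow> AE x in M. (\<integral>y. indicator F y *\<^sub>R \<kappa> (x, y) \<partial>M) \<in> \<real>\<^sub>\<ge>\<^sub>0"
  shows "AE z in M \<Otimes>\<^sub>M M. \<kappa> z \<in> \<real>\<^sub>\<ge>\<^sub>0"
proof -
  have [measurable]: "\<kappa> \<in> borel_measurable (M \<Otimes>\<^sub>M M)" using \<kappa> by auto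
  let ?I = "\<lambda>Q. \<integral>z. indicator Q z *\<^sub>R \<kappa> z \<partial>(M \<Otimes>\<^sub>M M)"
  have ind: "integrable (M \<Otimes>\<^sub>M M) (\<lambda>z. indicator Q z *\<^sub>R \<kappa> z)" if "Q \<in> sets (M \<Otimes>\<^sub>M M)" for Q
    by (rule integrable_mult_indicator[OF that \<kappa>])
  have col: "?I X \<in> \<real>\<^sub>\<ge>\<^sub>0" if X: "X \<in> column_sets" for X
  proof -
    obtain s :: "'a \<Rightarrow> nat" and F where s: "s \<in> measurable M (count_space UNIV)" "\<And>i. F i \<in> sets M"
      and eq: "X = {z \<in> space (M \<Otimes>\<^sub>M M). snd z \<in> F (s (fst z))}" using X by (rule column_setsE) blast
    have "AE x in M. \<forall>i. (\<integral>y. indicator (F i) y *\<^sub>R \<kappa> (x, y) \<partial>M) \<in> \<real>\<^sub>\<ge>\<^sub>0"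
      unfolding AE_all_countable using sec[OF s(2)] by blast
    then have "AE x in M. (\<integral>y. indicator X (x, y) *\<^sub>R \<kappa> (x, y) \<partial>M) \<in> \<real>\<^sub>\<ge>\<^sub>0"
    proof (rule AE_mp, intro AE_I2 impI)
      fix x assume x: "x \<in> space M" and n: "\<forall>i. (\<integral>y. indicator (F i) y *\<^sub>R \<kappa> (x, y) \<partial>M) \<in> \<real>\<^sub>\<ge>\<^sub>0"
      have "(\<integral>y. indicator X (x, y) *\<^sub>R \<kappa> (x, y) \<partial>M) = (\<integral>y. indicator (F (s x)) y *\<^sub>R \<kappa> (x, y) \<partial>M)"
        by (rule Bochner_Integration.integral_cong[OF refl])
          (use x in \<open>auto simp: eq space_pair_measure indicator_def\<close>)
      then show "(\<integral>y. indicator X (x, y) *\<^sub>R \<kappa> (x, y) \<partial>M) \<in> \<real>\<^sub>\<ge>\<^sub>0" using n by simp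
    qed
    from integral_nonneg_Reals[OF this] show ?thesis
      using P.integral_fst'[OF ind[OF column_sets_measurable[OF X]]] by simp
  qed
  \<comment> \<open>In this finite measure a small symmetric difference of two sets means nearly
    equal integrals of \<kappa> over them.\<close>
  define N where "N = density (M \<Otimes>\<^sub>M M) (\<lambda>z. ennreal (cmod (\<kappa> z)))"
  have Nsets: "sets N = sets (M \<Otimes>\<^sub>M M)" "space N = space (M \<Otimes>\<^sub>M M)" by (auto simp: N_def)
  have mN: "measure N X = (\<integral>z. indicator X z * cmod (\<kappa> z) \<partial>(M \<Otimes>\<^sub>M M))" if [measurable]: "X \<in> sets (M \<Otimes>\<^sub>M M)" for X
  proof -
    have "emeasure N X = (\<integral>\<^sup>+z. ennreal (indicator X z * cmod (\<kappa> z)) \<partial>(M \<Otimes>\<^sub>M M))"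
      unfolding N_def by (subst emeasure_density) (auto simp: indicator_def intro!: nn_integral_cong)
    also have "\<dots> = ennreal (\<integral>z. indicator X z * cmod (\<kappa> z) \<partial>(M \<Otimes>\<^sub>M M))"
      by (rule nn_integral_eq_integral) (use integrable_norm[OF ind[OF that]] in \<open>auto simp: indicator_def if_distrib cong: if_cong\<close>)
    finally show ?thesis by (simp add: measure_def)
  qed
  have "emeasure N (space N) \<noteq> \<infinity>"
  proof -
    have "emeasure N (space N) = (\<integral>\<^sup>+z. ennreal (norm (\<kappa> z)) \<partial>(M \<Otimes>\<^sub>M M))"
      unfolding N_def by (subst emeasure_density) (auto intro!: nn_integral_cong simp: space_pair_measure)
    then show ?thesis using \<kappa> unfolding integrable_iff_bounded by auto
  qed
  then have fin: "finite_measure N" by (rule finite_measureI)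
  have all: "?I Q \<in> \<real>\<^sub>\<ge>\<^sub>0" if Q: "Q \<in> sets (M \<Otimes>\<^sub>M M)" for Q
  proof -
    have "\<exists>y\<in>\<real>\<^sub>\<ge>\<^sub>0. dist y (?I Q) < e" if e: "e > 0" for e
    proof -
      have "\<forall>e>0. \<exists>X\<in>column_sets. measure N ((Q - X) \<union> (X - Q)) < e"
        by (rule algebra_approximation[OF fin])
          (use algebra_column_sets sigma_sets_column_sets Q Nsets in auto)
      then obtain X where X: "X \<in> column_sets" "measure N ((Q - X) \<union> (X - Q)) < e" using e by blast
      note Xm = column_sets_measurable[OF X(1)]
      have "dist (?I X) (?I Q) = norm (\<integral>z. indicator X z *\<^sub>R \<kappa> z - indicator Q z *\<^sub>R \<kappa> z \<partial>(M \<Otimes>\<^sub>M M))"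
        unfolding dist_norm by (subst Bochner_Integration.integral_diff[OF ind[OF Xm] ind[OF Q]]) simp
      also have "\<dots> \<le> (\<integral>z. norm (indicator X z *\<^sub>R \<kappa> z - indicator Q z *\<^sub>R \<kappa> z) \<partial>(M \<Otimes>\<^sub>M M))"
        by (rule integral_norm_bound)
      also have "\<dots> = (\<integral>z. indicator ((Q - X) \<union> (X - Q)) z * cmod (\<kappa> z) \<partial>(M \<Otimes>\<^sub>M M))"
        by (rule Bochner_Integration.integral_cong) (auto simp: indicator_def)
      also have "\<dots> = measure N ((Q - X) \<union> (X - Q))" by (rule mN[symmetric]) (use Xm Q in auto)
      finally show ?thesis using X(2) col[OF X(1)] by (intro bexI[of _ "?I X"]) auto
    qed
    then have "?I Q \<in> closure \<real>\<^sub>\<ge>\<^sub>0" unfolding closure_approachable by blast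
    then show ?thesis unfolding closure_closed[OF closed_nonneg_Reals_complex] .
  qed
  show ?thesis
  proof (rule sigma_finite_measure.averaging_theorem[OF _ \<kappa> closed_nonneg_Reals_complex])
    show "sigma_finite_measure (M \<Otimes>\<^sub>M M)" by (rule sigma_finite_pair_measure) unfold_locales
    fix Q assume "Q \<in> sets (M \<Otimes>\<^sub>M M)"
    from all[OF this]
    show "(1 / measure (M \<Otimes>\<^sub>M M) Q) *\<^sub>R set_lebesgue_integral (M \<Otimes>\<^sub>M M) Q \<kappa> \<in> \<real>\<^sub>\<ge>\<^sub>0"
      unfolding set_lebesgue_integral_def scaleR_conv_of_real
      by (intro nonneg_Reals_mult_I) auto
  qed
qed

lemma has_kernelD:
  assumes "has_kernel M A k"
  shows "k \<in> borel_measurable (M \<Otimes>\<^sub>M M)"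
    and "f \<in> L2 M \<Longrightarrow> AE x in M. integrable M (\<lambda>y. k (x, y) * f y)"
    and "f \<in> L2 M \<Longrightarrow> AE x in M. A f x = kernel_integral M k f x"
proof -
  show "k \<in> borel_measurable (M \<Otimes>\<^sub>M M)" using assms by (simp add: has_kernel_def)
  have *: "AE x in M. integrable M (\<lambda>y. k (x, y) * f y) \<and> A f x = kernel_integral M k f x" if "f \<in> L2 M" for f
    by (rule bspec[OF conjunct2[OF assms[unfolded has_kernel_def]] that])
  show "AE x in M. integrable M (\<lambda>y. k (x, y) * f y)" if "f \<in> L2 M" using *[OF that] by eventually_elim simp
  show "AE x in M. A f x = kernel_integral M k f x" if "f \<in> L2 M" using *[OF that] by eventually_elim simp
qed

lemma has_kernelI:
  assumes "k \<in> borel_measurable (M \<Otimes>\<^sub>M M)"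
    and "\<And>f. f \<in> L2 M \<Longrightarrow> AE x in M. integrable M (\<lambda>y. k (x, y) * f y)"
    and "\<And>f. f \<in> L2 M \<Longrightarrow> AE x in M. A f x = kernel_integral M k f x"
  shows "has_kernel M A k"
  using assms by (simp add: has_kernel_def)

text \<open>The kernel need not be integrable, so it is multiplied by the positive weights
  \<open>w\<close> in the second and \<open>c\<close> in the first variable. Square integrability of
  \<open>w\<close> makes the section integrals \<open>G\<close> finite a.e., and dividing by
  \<open>1 + G\<close> keeps the total below the integral of \<open>h\<close>. Testing
  \<open>A\<close> on \<open>w\<close> restricted to a set \<open>F\<close> supplies the section
  condition.\<close>

lemma kernel_nonneg_Reals:
  assumes A: "positive_op M A" and k: "has_kernel M A k"
  shows "AE z in M \<Otimes>\<^sub>M M. k z \<in> \<real>\<^sub>\<ge>\<^sub>0"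
proof -
  have [measurable]: "k \<in> borel_measurable (M \<Otimes>\<^sub>M M)" by (rule has_kernelD(1)[OF k])
  obtain h where h: "weight M h" by (rule obtain_weight)
  have [measurable]: "h \<in> borel_measurable M" and h0: "\<And>x. 0 < h x" and hi: "integrable M h"
    using h by (auto simp: weight_def)
  define w where "w = (\<lambda>x. sqrt (h x))"
  have w: "w \<in> pL M" unfolding w_def by (rule weight_sqrt_pL[OF h])
  have [measurable]: "w \<in> borel_measurable M" using w by (auto simp: pL_def)
  have w0: "0 < w x" for x using h0 by (simp add: w_def)
  define G where "G = (\<lambda>x. \<integral>y. cmod (k (x, y)) * w y \<partial>M)"
  have [measurable]: "G \<in> borel_measurable M" unfolding G_def by measurable
  have G0: "0 \<le> G x" for x unfolding G_def using w0 by (intro Bochner_Integration.integral_nonneg) (auto simp: less_imp_le)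
  define c where "c = (\<lambda>x. h x / (1 + G x))"
  have [measurable]: "c \<in> borel_measurable M" unfolding c_def by measurable
  have c0: "0 < c x" for x unfolding c_def using h0[of x] G0[of x] by simp
  define \<kappa> where "\<kappa> = (\<lambda>z. k z * complex_of_real (w (snd z) * c (fst z)))"
  have [measurable]: "\<kappa> \<in> borel_measurable (M \<Otimes>\<^sub>M M)" unfolding \<kappa>_def by measurable
  have wi: "AE x in M. integrable M (\<lambda>y. cmod (k (x, y)) * w y)"
    using has_kernelD(2)[OF k cr_L2[OF w]]
  proof eventually_elim
    case (elim x)
    from integrable_norm[OF elim] show ?case using w0 by (simp add: norm_mult less_imp_le)
  qed
  have \<kappa>i: "integrable (M \<Otimes>\<^sub>M M) \<kappa>"
  proof (rule integrableI_bounded)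
    have "(\<integral>\<^sup>+z. ennreal (norm (\<kappa> z)) \<partial>(M \<Otimes>\<^sub>M M)) = (\<integral>\<^sup>+x. (\<integral>\<^sup>+y. ennreal (norm (\<kappa> (x, y))) \<partial>M) \<partial>M)"
      by (rule nn_integral_fst[symmetric]) measurable
    also have "\<dots> \<le> (\<integral>\<^sup>+x. ennreal (h x) \<partial>M)"
    proof (rule nn_integral_mono_AE)
      show "AE x in M. (\<integral>\<^sup>+y. ennreal (norm (\<kappa> (x, y))) \<partial>M) \<le> ennreal (h x)"
        using wi
      proof eventually_elim
        case (elim x)
        have "(\<integral>\<^sup>+y. ennreal (norm (\<kappa> (x, y))) \<partial>M) = (\<integral>\<^sup>+y. ennreal (cmod (k (x, y)) * w y * c x) \<partial>M)"
          using w0 c0 by (simp add: \<kappa>_def norm_mult less_imp_le mult.assoc)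
        also have "\<dots> = ennreal (\<integral>y. cmod (k (x, y)) * w y * c x \<partial>M)"
          using elim w0 c0 by (intro nn_integral_eq_integral) (auto simp: less_imp_le)
        also have "(\<integral>y. cmod (k (x, y)) * w y * c x \<partial>M) = G x * c x" by (simp add: G_def)
        also have "\<dots> \<le> h x"
          unfolding c_def using h0[of x] G0[of x] by (simp add: field_simps)
        finally show ?case by (simp add: ennreal_leI)
      qed
    qed
    also have "\<dots> < \<infinity>" using hi h0 by (simp add: nn_integral_eq_integral less_imp_le)
    finally show "(\<integral>\<^sup>+z. ennreal (norm (\<kappa> z)) \<partial>(M \<Otimes>\<^sub>M M)) < \<infinity>" .
  qed measurable
  have "AE z in M \<Otimes>\<^sub>M M. \<kappa> z \<in> \<real>\<^sub>\<ge>\<^sub>0"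
  proof (rule integrable_nonneg_if_columns[OF \<kappa>i])
    fix F assume F[measurable]: "F \<in> sets M"
    define f where "f = (\<lambda>y. w y * indicator F y)"
    have f: "f \<in> pL M"
      by (rule pL_dominated(1)[OF w]) (use w0 in \<open>auto simp: f_def indicator_def less_imp_le\<close>)
    have "AE x in M. complex_of_real (f x) \<in> \<real>\<^sub>\<ge>\<^sub>0" using pLD(2)[OF f] by simp
    then have "AE x in M. A (cr f) x \<in> \<real>\<^sub>\<ge>\<^sub>0"
      by (rule A[unfolded positive_op_def, rule_format, OF cr_L2[OF f]])
    with has_kernelD(3)[OF k cr_L2[OF f]]
    show "AE x in M. (\<integral>y. indicator F y *\<^sub>R \<kappa> (x, y) \<partial>M) \<in> \<real>\<^sub>\<ge>\<^sub>0"
    proof eventually_elim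
      case (elim x)
      have "(\<integral>y. indicator F y *\<^sub>R \<kappa> (x, y) \<partial>M) = (\<integral>y. complex_of_real (c x) * (k (x, y) * complex_of_real (f y)) \<partial>M)"
        by (rule Bochner_Integration.integral_cong) (auto simp: \<kappa>_def f_def scaleR_conv_of_real mult_ac indicator_def)
      also have "\<dots> = complex_of_real (c x) * A (cr f) x"
        using elim(1) by (simp add: kernel_integral_def)
      finally show ?case using elim(2) c0[of x] by (simp add: nonneg_Reals_mult_I less_imp_le)
    qed
  qed
  then show ?thesis
  proof eventually_elim
    case (elim z)
    let ?r = "w (snd z) * c (fst z)"
    have r: "?r > 0" using w0 c0 by simp
    have "w (snd z) \<noteq> 0" "c (fst z) \<noteq> 0" using w0[of "snd z"] c0[of "fst z"] by auto
    then have "k z = \<kappa> z * complex_of_real (1 / ?r)" unfolding \<kappa>_def by simp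
    moreover have "complex_of_real (1 / ?r) \<in> \<real>\<^sub>\<ge>\<^sub>0"
      unfolding nonneg_Reals_of_real_iff using r by simp
    ultimately show ?case using nonneg_Reals_mult_I[OF elim] by metis
  qed
qed

lemma has_kernel_cong_AE:
  assumes A: "has_kernel M A k" and k': "k' \<in> borel_measurable (M \<Otimes>\<^sub>M M)"
    and ae: "AE z in M \<Otimes>\<^sub>M M. k z = k' z"
  shows "has_kernel M A k'"
proof (rule has_kernelI[OF k'])
  note [measurable] = has_kernelD(1)[OF A] k'
  fix f assume f: "f \<in> L2 M"
  have [measurable]: "f \<in> borel_measurable M" using f by (auto simp: L2_def)
  have eq: "AE x in M. integrable M (\<lambda>y. k (x, y) * f y) = integrable M (\<lambda>y. k' (x, y) * f y) \<and>
    kernel_integral M k f x = kernel_integral M k' f x"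
    using P.AE_pair[OF ae]
  proof (rule AE_mp, intro AE_I2 impI conjI)
    fix x assume x: "x \<in> space M" and e: "AE y in M. k (x, y) = k' (x, y)"
    show "integrable M (\<lambda>y. k (x, y) * f y) = integrable M (\<lambda>y. k' (x, y) * f y)"
      by (rule integrable_cong_AE) (use x e in auto)
    show "kernel_integral M k f x = kernel_integral M k' f x"
      unfolding kernel_integral_def by (rule integral_cong_AE) (use x e in auto)
  qed
  show "AE x in M. integrable M (\<lambda>y. k' (x, y) * f y)"
    using eq has_kernelD(2)[OF A f] by eventually_elim simp
  show "AE x in M. A f x = kernel_integral M k' f x"
    using eq has_kernelD(3)[OF A f] by eventually_elim simp
qed

text \<open>The difference of two kernels of \<open>A\<close> is a kernel of the zero operator, which is positive.\<close>

lemma kernel_unique: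
  assumes "has_kernel M A k" "has_kernel M A k'"
  shows "AE z in M \<Otimes>\<^sub>M M. k z = k' z"
proof -
  let ?Z = "\<lambda>(f :: 'a \<Rightarrow> complex) (x :: 'a). 0 :: complex"
  have Z: "positive_op M ?Z" by (simp add: positive_op_def)
  have diff: "has_kernel M ?Z (\<lambda>z. k z - k' z)" if k: "has_kernel M A k" "has_kernel M A k'" for k k'
  proof (rule has_kernelI)
    note [measurable] = has_kernelD(1)[OF k(1)] has_kernelD(1)[OF k(2)]
    show "(\<lambda>z. k z - k' z) \<in> borel_measurable (M \<Otimes>\<^sub>M M)" by measurable
    fix f assume f: "f \<in> L2 M"
    note i = has_kernelD(2)[OF k(1) f] has_kernelD(2)[OF k(2) f]
    show "AE x in M. integrable M (\<lambda>y. (k (x, y) - k' (x, y)) * f y)"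
      using i by eventually_elim (simp add: left_diff_distrib)
    show "AE x in M. 0 = kernel_integral M (\<lambda>z. k z - k' z) f x"
      using i has_kernelD(3)[OF k(1) f] has_kernelD(3)[OF k(2) f]
      by eventually_elim (simp add: kernel_integral_def left_diff_distrib)
  qed
  from kernel_nonneg_Reals[OF Z diff[OF assms]] kernel_nonneg_Reals[OF Z diff[OF assms(2,1)]]
  show ?thesis
    by eventually_elim (auto simp: complex_nonneg_Reals_iff complex_eq_iff)
qed

text \<open>\<open>max 0 (Re (k z))\<close> is a version of any kernel \<open>k\<close>, so the
  choice in the definition has a witness.\<close>

lemma nonneg_kernel:
  assumes "positive_kernel_op M A"
  shows "0 \<le> nonneg_kernel M A z" "has_kernel M A (cr (nonneg_kernel M A))"
proof -
  obtain k where k: "has_kernel M A k" and pos: "positive_op M A"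
    using assms by (auto simp: positive_kernel_op_def)
  have [measurable]: "k \<in> borel_measurable (M \<Otimes>\<^sub>M M)" by (rule has_kernelD(1)[OF k])
  have "AE z in M \<Otimes>\<^sub>M M. k z = complex_of_real (max 0 (Re (k z)))"
    using kernel_nonneg_Reals[OF pos k]
    by eventually_elim (auto simp: complex_nonneg_Reals_iff complex_eq_iff)
  then have "has_kernel M A (\<lambda>z. complex_of_real (max 0 (Re (k z))))"
    by (intro has_kernel_cong_AE[OF k]) auto
  then have "\<exists>a. (\<forall>z. 0 \<le> a z) \<and> has_kernel M A (cr a)" by (intro exI[of _ "\<lambda>z. max 0 (Re (k z))"]) auto
  from someI_ex[OF this] show "0 \<le> nonneg_kernel M A z" "has_kernel M A (cr (nonneg_kernel M A))"
    unfolding nonneg_kernel_def by blast+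
qed

end

section \<open>Kernel operators map order intervals to totally bounded sets\<close>

context sigma_finite_measure
begin

interpretation P: pair_sigma_finite M M ..

definition unit_functions :: "('a \<Rightarrow> complex) set" where
  "unit_functions = {\<phi> \<in> borel_measurable M. \<forall>y. cmod (\<phi> y) \<le> 1}"

definition kernel_L1 :: "('a \<times> 'a \<Rightarrow> real) \<Rightarrow> ('a \<Rightarrow> complex) \<Rightarrow> ennreal" where
  "kernel_L1 \<kappa> \<psi> = (\<integral>\<^sup>+x. ennreal (cmod (\<integral>y. complex_of_real (\<kappa> (x, y)) * \<psi> y \<partial>M)) \<partial>M)"

text \<open>
  Total boundedness of the image of the unit functions in \<open>L\<^sup>1\<close>, as a finite cover by sets of small
  diameter. The class of such kernels is linear and closed in \<open>L\<^sup>1\<close>, so rectangles suffice.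
\<close>

definition L1_compact :: "('a \<times> 'a \<Rightarrow> real) \<Rightarrow> bool" where
  "L1_compact \<kappa> \<longleftrightarrow> (\<forall>e>0. \<exists>\<C>. finite \<C> \<and> unit_functions \<subseteq> \<Union>\<C> \<and>
     (\<forall>X\<in>\<C>. \<forall>\<phi>\<in>X \<inter> unit_functions. \<forall>\<phi>'\<in>X \<inter> unit_functions. kernel_L1 \<kappa> (\<lambda>y. \<phi> y - \<phi>' y) \<le> ennreal e))"

lemma L1_compactE:
  assumes "L1_compact \<kappa>" "0 < e"
  obtains \<C> where "finite \<C>" "unit_functions \<subseteq> \<Union>\<C>"
    "\<forall>X\<in>\<C>. \<forall>\<phi>\<in>X \<inter> unit_functions. \<forall>\<phi>'\<in>X \<inter> unit_functions. kernel_L1 \<kappa> (\<lambda>y. \<phi> y - \<phi>' y) \<le> ennreal e"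
proof -
  from assms(1)[unfolded L1_compact_def, rule_format, OF assms(2)]
  show ?thesis by (elim exE conjE) (rule that)
qed

lemma unit_functions_diff:
  assumes "\<phi> \<in> unit_functions" "\<phi>' \<in> unit_functions"
  shows "(\<lambda>y. \<phi> y - \<phi>' y) \<in> borel_measurable M" "cmod (\<phi> y - \<phi>' y) \<le> 2"
proof -
  show "(\<lambda>y. \<phi> y - \<phi>' y) \<in> borel_measurable M" using assms by (auto simp: unit_functions_def)
  have "cmod (\<phi> y) \<le> 1" "cmod (\<phi>' y) \<le> 1" using assms by (auto simp: unit_functions_def)
  then show "cmod (\<phi> y - \<phi>' y) \<le> 2" using norm_triangle_ineq4[of "\<phi> y" "\<phi>' y"] by linarith
qed

lemma section_integrable:
  assumes \<kappa>: "integrable (M \<Otimes>\<^sub>M M) \<kappa>" and \<psi>: "\<psi> \<in> borel_measurable M" "\<And>y. cmod (\<psi> y) \<le> 2"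
  shows "AE x in M. integrable M (\<lambda>y. complex_of_real (\<kappa> (x, y)) * \<psi> y)"
  using P.AE_integrable_fst'[OF \<kappa>]
proof (rule AE_mp, intro AE_I2 impI)
  fix x assume x: "x \<in> space M" and i: "integrable M (\<lambda>y. \<kappa> (x, y))"
  show "integrable M (\<lambda>y. complex_of_real (\<kappa> (x, y)) * \<psi> y)"
  proof (rule Bochner_Integration.integrable_bound[OF integrable_mult_right[OF integrable_abs[OF i], of 2]])
    show "(\<lambda>y. complex_of_real (\<kappa> (x, y)) * \<psi> y) \<in> borel_measurable M"
      using borel_measurable_integrable[OF i] \<psi>(1) by measurable
    show "AE y in M. norm (complex_of_real (\<kappa> (x, y)) * \<psi> y) \<le> norm (2 * \<bar>\<kappa> (x, y)\<bar>)"
    proof (rule AE_I2)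
      fix y
      have "\<bar>\<kappa> (x, y)\<bar> * cmod (\<psi> y) \<le> \<bar>\<kappa> (x, y)\<bar> * 2" by (rule mult_left_mono[OF \<psi>(2)]) simp
      then show "norm (complex_of_real (\<kappa> (x, y)) * \<psi> y) \<le> norm (2 * \<bar>\<kappa> (x, y)\<bar>)"
        by (simp add: norm_mult)
    qed
  qed
qed

lemma kernel_L1_le:
  assumes \<kappa>: "integrable (M \<Otimes>\<^sub>M M) \<kappa>" and \<psi>: "\<psi> \<in> borel_measurable M" "\<And>y. cmod (\<psi> y) \<le> 2"
  shows "kernel_L1 \<kappa> \<psi> \<le> ennreal (2 * (\<integral>z. \<bar>\<kappa> z\<bar> \<partial>(M \<Otimes>\<^sub>M M)))"
proof -
  have [measurable]: "\<kappa> \<in> borel_measurable (M \<Otimes>\<^sub>M M)" using \<kappa> by auto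
  have "kernel_L1 \<kappa> \<psi> \<le> (\<integral>\<^sup>+x. (\<integral>\<^sup>+y. ennreal (2 * \<bar>\<kappa> (x, y)\<bar>) \<partial>M) \<partial>M)"
    unfolding kernel_L1_def
  proof (rule nn_integral_mono_AE)
    show "AE x in M. ennreal (cmod (\<integral>y. complex_of_real (\<kappa> (x, y)) * \<psi> y \<partial>M)) \<le> (\<integral>\<^sup>+y. ennreal (2 * \<bar>\<kappa> (x, y)\<bar>) \<partial>M)"
      using section_integrable[OF assms]
    proof eventually_elim
      case (elim x)
      have "ennreal (cmod (\<integral>y. complex_of_real (\<kappa> (x, y)) * \<psi> y \<partial>M))
          \<le> (\<integral>\<^sup>+y. ennreal (cmod (complex_of_real (\<kappa> (x, y)) * \<psi> y)) \<partial>M)"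
        by (rule integral_norm_bound_ennreal[OF elim])
      also have "\<dots> \<le> (\<integral>\<^sup>+y. ennreal (2 * \<bar>\<kappa> (x, y)\<bar>) \<partial>M)"
      proof (intro nn_integral_mono ennreal_leI)
        fix y
        have "\<bar>\<kappa> (x, y)\<bar> * cmod (\<psi> y) \<le> \<bar>\<kappa> (x, y)\<bar> * 2" by (rule mult_left_mono[OF \<psi>(2)]) simp
        then show "cmod (complex_of_real (\<kappa> (x, y)) * \<psi> y) \<le> 2 * \<bar>\<kappa> (x, y)\<bar>" by (simp add: norm_mult)
      qed
      finally show ?case .
    qed
  qed
  also have "\<dots> = (\<integral>\<^sup>+z. ennreal (2 * \<bar>\<kappa> z\<bar>) \<partial>(M \<Otimes>\<^sub>M M))"
    by (rule nn_integral_fst) measurable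
  also have "\<dots> = ennreal (\<integral>z. 2 * \<bar>\<kappa> z\<bar> \<partial>(M \<Otimes>\<^sub>M M))"
    using \<kappa> by (intro nn_integral_eq_integral) auto
  finally show ?thesis by simp
qed

lemma kernel_L1_add:
  assumes \<kappa>: "integrable (M \<Otimes>\<^sub>M M) \<kappa>" "integrable (M \<Otimes>\<^sub>M M) \<kappa>'"
    and \<psi>: "\<psi> \<in> borel_measurable M" "\<And>y. cmod (\<psi> y) \<le> 2"
  shows "kernel_L1 (\<lambda>z. \<kappa> z + \<kappa>' z) \<psi> \<le> kernel_L1 \<kappa> \<psi> + kernel_L1 \<kappa>' \<psi>"
proof -
  have [measurable]: "\<kappa> \<in> borel_measurable (M \<Otimes>\<^sub>M M)" "\<kappa>' \<in> borel_measurable (M \<Otimes>\<^sub>M M)" "\<psi> \<in> borel_measurable M"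
    using \<kappa> \<psi> by auto
  have "kernel_L1 (\<lambda>z. \<kappa> z + \<kappa>' z) \<psi> \<le> (\<integral>\<^sup>+x. ennreal (cmod (\<integral>y. complex_of_real (\<kappa> (x, y)) * \<psi> y \<partial>M)) +
      ennreal (cmod (\<integral>y. complex_of_real (\<kappa>' (x, y)) * \<psi> y \<partial>M)) \<partial>M)"
    unfolding kernel_L1_def
  proof (rule nn_integral_mono_AE)
    show "AE x in M. ennreal (cmod (\<integral>y. complex_of_real (\<kappa> (x, y) + \<kappa>' (x, y)) * \<psi> y \<partial>M))
      \<le> ennreal (cmod (\<integral>y. complex_of_real (\<kappa> (x, y)) * \<psi> y \<partial>M)) +
        ennreal (cmod (\<integral>y. complex_of_real (\<kappa>' (x, y)) * \<psi> y \<partial>M))"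
      using section_integrable[OF \<kappa>(1) \<psi>] section_integrable[OF \<kappa>(2) \<psi>]
    proof eventually_elim
      case (elim x)
      have "(\<integral>y. complex_of_real (\<kappa> (x, y) + \<kappa>' (x, y)) * \<psi> y \<partial>M)
        = (\<integral>y. complex_of_real (\<kappa> (x, y)) * \<psi> y \<partial>M) + (\<integral>y. complex_of_real (\<kappa>' (x, y)) * \<psi> y \<partial>M)"
        using elim by (simp add: distrib_right)
      then show ?case
        by (simp add: norm_triangle_ineq flip: ennreal_plus)
    qed
  qed
  also have "\<dots> = kernel_L1 \<kappa> \<psi> + kernel_L1 \<kappa>' \<psi>"
    unfolding kernel_L1_def by (rule nn_integral_add) measurable
  finally show ?thesis .
qed

lemma kernel_L1_scale:
  assumes "\<psi> \<in> borel_measurable M" "\<kappa> \<in> borel_measurable (M \<Otimes>\<^sub>M M)"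
  shows "kernel_L1 (\<lambda>z. c * \<kappa> z) \<psi> = ennreal \<bar>c\<bar> * kernel_L1 \<kappa> \<psi>"
proof -
  note [measurable] = assms
  have "kernel_L1 (\<lambda>z. c * \<kappa> z) \<psi> = (\<integral>\<^sup>+x. ennreal \<bar>c\<bar> * ennreal (cmod (\<integral>y. complex_of_real (\<kappa> (x, y)) * \<psi> y \<partial>M)) \<partial>M)"
    unfolding kernel_L1_def by (simp add: mult.assoc norm_mult ennreal_mult)
  then show ?thesis unfolding kernel_L1_def by (subst (asm) nn_integral_cmult) auto
qed

lemma L1_compact_approx:
  assumes \<kappa>: "integrable (M \<Otimes>\<^sub>M M) \<kappa>"
    and ap: "\<And>e. e > 0 \<Longrightarrow> \<exists>\<kappa>'. integrable (M \<Otimes>\<^sub>M M) \<kappa>' \<and> L1_compact \<kappa>' \<and> (\<integral>z. \<bar>\<kappa> z - \<kappa>' z\<bar> \<partial>(M \<Otimes>\<^sub>M M)) < e"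
  shows "L1_compact \<kappa>"
  unfolding L1_compact_def
proof (intro allI impI)
  fix e :: real assume e: "e > 0"
  \<comment> \<open>A quarter, since \<open>kernel_L1_le\<close> loses a factor 2 for differences of
    unit functions.\<close>
  obtain \<kappa>' where \<kappa>': "integrable (M \<Otimes>\<^sub>M M) \<kappa>'" "L1_compact \<kappa>'" "(\<integral>z. \<bar>\<kappa> z - \<kappa>' z\<bar> \<partial>(M \<Otimes>\<^sub>M M)) < e/4"
    using ap[of "e/4"] e by auto
  have e2: "e/2 > 0" using e by simp
  obtain \<C> where C: "finite \<C>" "unit_functions \<subseteq> \<Union>\<C>"
    "\<forall>X\<in>\<C>. \<forall>\<phi>\<in>X \<inter> unit_functions. \<forall>\<phi>'\<in>X \<inter> unit_functions. kernel_L1 \<kappa>' (\<lambda>y. \<phi> y - \<phi>' y) \<le> ennreal (e/2)"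
    by (rule L1_compactE[OF \<kappa>'(2) e2])
  have d: "integrable (M \<Otimes>\<^sub>M M) (\<lambda>z. \<kappa> z - \<kappa>' z)" using \<kappa> \<kappa>'(1) by auto
  have "kernel_L1 \<kappa> (\<lambda>y. \<phi> y - \<phi>' y) \<le> ennreal e"
    if X: "X \<in> \<C>" "\<phi> \<in> X \<inter> unit_functions" "\<phi>' \<in> X \<inter> unit_functions" for X \<phi> \<phi>'
  proof -
    let ?\<psi> = "\<lambda>y. \<phi> y - \<phi>' y"
    have \<psi>: "?\<psi> \<in> borel_measurable M" "\<And>y. cmod (?\<psi> y) \<le> 2" using unit_functions_diff X by auto
    have "kernel_L1 \<kappa> ?\<psi> \<le> kernel_L1 \<kappa>' ?\<psi> + kernel_L1 (\<lambda>z. \<kappa> z - \<kappa>' z) ?\<psi>"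
      using kernel_L1_add[OF \<kappa>'(1) d \<psi>] by simp
    also have "\<dots> \<le> ennreal (e/2) + ennreal (2 * (\<integral>z. \<bar>\<kappa> z - \<kappa>' z\<bar> \<partial>(M \<Otimes>\<^sub>M M)))"
      using C(3)[rule_format, OF X] by (intro add_mono kernel_L1_le[OF d \<psi>]) auto
    also have "\<dots> \<le> ennreal (e/2) + ennreal (e/2)"
      using \<kappa>'(3) by (intro add_mono ennreal_leI) auto
    also have "\<dots> = ennreal e" using e by (simp flip: ennreal_plus)
    finally show ?thesis .
  qed
  note le = this
  show "\<exists>\<C>. finite \<C> \<and> unit_functions \<subseteq> \<Union>\<C> \<and>
     (\<forall>X\<in>\<C>. \<forall>\<phi>\<in>X \<inter> unit_functions. \<forall>\<phi>'\<in>X \<inter> unit_functions. kernel_L1 \<kappa> (\<lambda>y. \<phi> y - \<phi>' y) \<le> ennreal e)"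
    by (intro exI[of _ \<C>] conjI ballI C(1,2) le)
qed

text \<open>The pairwise intersections of the two covers form a common refinement.\<close>

lemma L1_compact_add:
  assumes \<kappa>: "integrable (M \<Otimes>\<^sub>M M) \<kappa>" "integrable (M \<Otimes>\<^sub>M M) \<kappa>'" and c: "L1_compact \<kappa>" "L1_compact \<kappa>'"
  shows "L1_compact (\<lambda>z. \<kappa> z + \<kappa>' z)"
  unfolding L1_compact_def
proof (intro allI impI)
  fix e :: real assume e: "e > 0"
  have e2: "e/2 > 0" using e by simp
  obtain \<C> where C: "finite \<C>" "unit_functions \<subseteq> \<Union>\<C>"
    "\<forall>X\<in>\<C>. \<forall>\<phi>\<in>X \<inter> unit_functions. \<forall>\<phi>'\<in>X \<inter> unit_functions. kernel_L1 \<kappa> (\<lambda>y. \<phi> y - \<phi>' y) \<le> ennreal (e/2)"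
    by (rule L1_compactE[OF c(1) e2])
  obtain \<D> where D: "finite \<D>" "unit_functions \<subseteq> \<Union>\<D>"
    "\<forall>X\<in>\<D>. \<forall>\<phi>\<in>X \<inter> unit_functions. \<forall>\<phi>'\<in>X \<inter> unit_functions. kernel_L1 \<kappa>' (\<lambda>y. \<phi> y - \<phi>' y) \<le> ennreal (e/2)"
    by (rule L1_compactE[OF c(2) e2])
  show "\<exists>\<C>. finite \<C> \<and> unit_functions \<subseteq> \<Union>\<C> \<and>
     (\<forall>X\<in>\<C>. \<forall>\<phi>\<in>X \<inter> unit_functions. \<forall>\<phi>'\<in>X \<inter> unit_functions.
        kernel_L1 (\<lambda>z. \<kappa> z + \<kappa>' z) (\<lambda>y. \<phi> y - \<phi>' y) \<le> ennreal e)"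
  proof (intro exI[of _ "(\<lambda>(X, Y). X \<inter> Y) ` (\<C> \<times> \<D>)"] conjI ballI)
    show "finite ((\<lambda>(X, Y). X \<inter> Y) ` (\<C> \<times> \<D>))" using C(1) D(1) by auto
    show "unit_functions \<subseteq> \<Union>((\<lambda>(X, Y). X \<inter> Y) ` (\<C> \<times> \<D>))" using C(2) D(2) by fastforce
    fix Z \<phi> \<phi>' assume Z: "Z \<in> (\<lambda>(X, Y). X \<inter> Y) ` (\<C> \<times> \<D>)" and \<phi>: "\<phi> \<in> Z \<inter> unit_functions" "\<phi>' \<in> Z \<inter> unit_functions"
    then obtain X Y where XY: "X \<in> \<C>" "Y \<in> \<D>" "Z = X \<inter> Y" by auto
    let ?\<psi> = "\<lambda>y. \<phi> y - \<phi>' y"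
    have \<psi>: "?\<psi> \<in> borel_measurable M" "\<And>y. cmod (?\<psi> y) \<le> 2" using unit_functions_diff \<phi> by auto
    have "kernel_L1 (\<lambda>z. \<kappa> z + \<kappa>' z) ?\<psi> \<le> kernel_L1 \<kappa> ?\<psi> + kernel_L1 \<kappa>' ?\<psi>"
      by (rule kernel_L1_add[OF \<kappa> \<psi>])
    also have "\<dots> \<le> ennreal (e/2) + ennreal (e/2)"
      using C(3)[rule_format, OF XY(1), of \<phi> \<phi>'] D(3)[rule_format, OF XY(2), of \<phi> \<phi>'] \<phi> XY(3) by (intro add_mono) auto
    also have "\<dots> = ennreal e" using e by (simp flip: ennreal_plus)
    finally show "kernel_L1 (\<lambda>z. \<kappa> z + \<kappa>' z) ?\<psi> \<le> ennreal e" .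
  qed
qed

lemma L1_compact_scale:
  assumes \<kappa>: "\<kappa> \<in> borel_measurable (M \<Otimes>\<^sub>M M)" and c: "L1_compact \<kappa>"
  shows "L1_compact (\<lambda>z. c * \<kappa> z)"
  unfolding L1_compact_def
proof (intro allI impI)
  fix e :: real assume e: "e > 0"
  have e2: "e / (\<bar>c\<bar> + 1) > 0" using e by simp
  obtain \<C> where C: "finite \<C>" "unit_functions \<subseteq> \<Union>\<C>"
    "\<forall>X\<in>\<C>. \<forall>\<phi>\<in>X \<inter> unit_functions. \<forall>\<phi>'\<in>X \<inter> unit_functions. kernel_L1 \<kappa> (\<lambda>y. \<phi> y - \<phi>' y) \<le> ennreal (e / (\<bar>c\<bar> + 1))"
    by (rule L1_compactE[OF c e2])
  have "kernel_L1 (\<lambda>z. c * \<kappa> z) (\<lambda>y. \<phi> y - \<phi>' y) \<le> ennreal e"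
    if X: "X \<in> \<C>" "\<phi> \<in> X \<inter> unit_functions" "\<phi>' \<in> X \<inter> unit_functions" for X \<phi> \<phi>'
  proof -
    have "kernel_L1 (\<lambda>z. c * \<kappa> z) (\<lambda>y. \<phi> y - \<phi>' y) = ennreal \<bar>c\<bar> * kernel_L1 \<kappa> (\<lambda>y. \<phi> y - \<phi>' y)"
      using X unit_functions_diff by (intro kernel_L1_scale \<kappa>) auto
    also have "\<dots> \<le> ennreal \<bar>c\<bar> * ennreal (e / (\<bar>c\<bar> + 1))"
      using C(3)[rule_format, OF X] by (intro mult_left_mono) auto
    also have "\<dots> = ennreal (\<bar>c\<bar> * (e / (\<bar>c\<bar> + 1)))"
      by (rule ennreal_mult[symmetric]) (use e in auto)
    also have "\<dots> \<le> ennreal e" using e by (intro ennreal_leI) (simp add: field_simps)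
    finally show ?thesis .
  qed
  note le = this
  show "\<exists>\<C>. finite \<C> \<and> unit_functions \<subseteq> \<Union>\<C> \<and>
     (\<forall>X\<in>\<C>. \<forall>\<phi>\<in>X \<inter> unit_functions. \<forall>\<phi>'\<in>X \<inter> unit_functions. kernel_L1 (\<lambda>z. c * \<kappa> z) (\<lambda>y. \<phi> y - \<phi>' y) \<le> ennreal e)"
    by (intro exI[of _ \<C>] conjI ballI C(1,2) le)
qed

text \<open>The kernel has rank one: the image of \<open>\<phi>\<close> depends only on the number
  \<open>z \<phi>\<close>, which lies in a compact disc of radius \<open>H\<close>. Pulling back a
  finite cover of the disc by small balls gives the required cover.\<close>

lemma L1_compact_rectangle:
  assumes h: "weight M h" and E: "E \<in> sets M" and F: "F \<in> sets M"
  shows "L1_compact (\<lambda>z. indicator (E \<times> F) z * (h (fst z) * h (snd z)))"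
  unfolding L1_compact_def
proof (intro allI impI)
  fix e :: real assume e: "e > 0"
  note [measurable] = E F
  have [measurable]: "h \<in> borel_measurable M" and h0: "\<And>x. 0 < h x" and hi: "integrable M h"
    using h by (auto simp: weight_def)
  define H where "H = (\<integral>x. h x \<partial>M)"
  have H0: "0 \<le> H" unfolding H_def using h0 by (intro Bochner_Integration.integral_nonneg) (auto simp: less_imp_le)
  define z where "z = (\<lambda>\<phi>. \<integral>y. complex_of_real (indicator F y * h y) * \<phi> y \<partial>M)"
  have int: "integrable M (\<lambda>y. complex_of_real (indicator F y * h y) * \<phi> y)" if \<phi>: "\<phi> \<in> unit_functions" for \<phi>
  proof (rule Bochner_Integration.integrable_bound[OF hi])
    have [measurable]: "\<phi> \<in> borel_measurable M" using \<phi> by (simp add: unit_functions_def)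
    show "(\<lambda>y. complex_of_real (indicator F y * h y) * \<phi> y) \<in> borel_measurable M" by measurable
    show "AE y in M. norm (complex_of_real (indicator F y * h y) * \<phi> y) \<le> norm (h y)"
      using \<phi> h0 by (intro AE_I2) (auto simp: unit_functions_def norm_mult indicator_def less_imp_le mult_left_le)
  qed
  have zH: "z \<phi> \<in> cball 0 H" if \<phi>: "\<phi> \<in> unit_functions" for \<phi>
  proof -
    have "cmod (z \<phi>) \<le> (\<integral>y. cmod (complex_of_real (indicator F y * h y) * \<phi> y) \<partial>M)"
      unfolding z_def by (rule integral_norm_bound)
    also have "\<dots> \<le> H" unfolding H_def
      by (rule integral_mono_AE[OF integrable_norm[OF int[OF \<phi>]] hi], rule AE_I2)
        (use \<phi> h0 in \<open>auto simp: unit_functions_def norm_mult indicator_def less_imp_le mult_left_le\<close>)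
    finally show ?thesis by simp
  qed
  define \<delta> where "\<delta> = e / (2 * (H + 1))"
  have \<delta>: "\<delta> > 0" using e H0 by (simp add: \<delta>_def)
  have "\<forall>e>0. \<exists>k. finite k \<and> cball (0::complex) H \<subseteq> (\<Union>x\<in>k. ball x e)"
    by (rule conjunct2[OF compact_eq_totally_bounded[THEN iffD1, OF compact_cball]])
  from this[rule_format, OF \<delta>] obtain Z where Z: "finite Z" "cball (0::complex) H \<subseteq> (\<Union>x\<in>Z. ball x \<delta>)"
    by (elim exE conjE)
  let ?\<kappa> = "\<lambda>z. indicator (E \<times> F) z * (h (fst z) * h (snd z)) :: real"
  show "\<exists>\<C>. finite \<C> \<and> unit_functions \<subseteq> \<Union>\<C> \<and>
     (\<forall>X\<in>\<C>. \<forall>\<phi>\<in>X \<inter> unit_functions. \<forall>\<phi>'\<in>X \<inter> unit_functions. kernel_L1 ?\<kappa> (\<lambda>y. \<phi> y - \<phi>' y) \<le> ennreal e)"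
  proof (intro exI[of _ "(\<lambda>p. {\<phi>. z \<phi> \<in> ball p \<delta>}) ` Z"] conjI ballI)
    show "finite ((\<lambda>p. {\<phi>. z \<phi> \<in> ball p \<delta>}) ` Z)" using Z by simp
    show "unit_functions \<subseteq> \<Union>((\<lambda>p. {\<phi>. z \<phi> \<in> ball p \<delta>}) ` Z)"
      using Z(2) zH by blast
    fix X \<phi> \<phi>' assume "X \<in> (\<lambda>p. {\<phi>. z \<phi> \<in> ball p \<delta>}) ` Z" and \<phi>: "\<phi> \<in> X \<inter> unit_functions" "\<phi>' \<in> X \<inter> unit_functions"
    then obtain p where p: "dist p (z \<phi>) < \<delta>" "dist p (z \<phi>') < \<delta>" by auto
    have [measurable]: "\<phi> \<in> borel_measurable M" "\<phi>' \<in> borel_measurable M"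
      using \<phi> by (auto simp: unit_functions_def)
    have "dist (z \<phi>) (z \<phi>') < \<delta> + \<delta>"
      by (rule dist_triangle_less_add[of _ p]) (use p in \<open>auto simp: dist_commute\<close>)
    then have zd: "cmod (z \<phi> - z \<phi>') \<le> 2 * \<delta>" by (simp add: dist_norm)
    have "kernel_L1 ?\<kappa> (\<lambda>y. \<phi> y - \<phi>' y) = (\<integral>\<^sup>+x. ennreal (indicator E x * h x * cmod (z \<phi> - z \<phi>')) \<partial>M)"
      unfolding kernel_L1_def
    proof (rule nn_integral_cong)
      fix x
      have "(\<integral>y. complex_of_real (?\<kappa> (x, y)) * (\<phi> y - \<phi>' y) \<partial>M)
        = (\<integral>y. complex_of_real (indicator E x * h x) * (complex_of_real (indicator F y * h y) * \<phi> y - complex_of_real (indicator F y * h y) * \<phi>' y) \<partial>M)"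
        by (rule Bochner_Integration.integral_cong) (auto simp: indicator_def algebra_simps)
      also have "\<dots> = complex_of_real (indicator E x * h x) * (z \<phi> - z \<phi>')"
      proof -
        have "(\<integral>y. complex_of_real (indicator F y * h y) * \<phi> y - complex_of_real (indicator F y * h y) * \<phi>' y \<partial>M) = z \<phi> - z \<phi>'"
          unfolding z_def by (rule Bochner_Integration.integral_diff[OF int int]) (use \<phi> in auto)
        then show ?thesis by (simp only: integral_mult_right_zero)
      qed
      finally show "ennreal (cmod (\<integral>y. complex_of_real (?\<kappa> (x, y)) * (\<phi> y - \<phi>' y) \<partial>M))
        = ennreal (indicator E x * h x * cmod (z \<phi> - z \<phi>'))"
        using h0[of x] by (simp add: norm_mult less_imp_le)
    qed
    also have "\<dots> \<le> (\<integral>\<^sup>+x. ennreal (h x * (2 * \<delta>)) \<partial>M)"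
      using zd h0 \<delta> by (intro nn_integral_mono ennreal_leI mult_mono) (auto simp: indicator_def less_imp_le)
    also have "\<dots> = ennreal (\<integral>x. h x * (2 * \<delta>) \<partial>M)"
      using hi h0 \<delta> by (intro nn_integral_eq_integral) (auto simp: less_imp_le)
    also have "(\<integral>x. h x * (2 * \<delta>) \<partial>M) = H * (2 * \<delta>)" by (simp add: H_def)
    also have "\<dots> \<le> e" using e H0 by (simp add: \<delta>_def field_simps)
    finally show "kernel_L1 ?\<kappa> (\<lambda>y. \<phi> y - \<phi>' y) \<le> ennreal e" by (simp add: ennreal_leI)
  qed
qed

lemma weight_product_integrable:
  assumes "weight M h"
  shows "integrable (M \<Otimes>\<^sub>M M) (\<lambda>z. h (fst z) * h (snd z))"
proof (rule integrableI_bounded)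
  have [measurable]: "h \<in> borel_measurable M" and h0: "\<And>x. 0 < h x" and hi: "integrable M h"
    using assms by (auto simp: weight_def)
  show "(\<lambda>z. h (fst z) * h (snd z)) \<in> borel_measurable (M \<Otimes>\<^sub>M M)" by measurable
  have "(\<integral>\<^sup>+z. ennreal (norm (h (fst z) * h (snd z))) \<partial>(M \<Otimes>\<^sub>M M))
      = (\<integral>\<^sup>+x. (\<integral>\<^sup>+y. ennreal (norm (h (fst (x, y)) * h (snd (x, y)))) \<partial>M) \<partial>M)"
    by (rule nn_integral_fst[symmetric]) measurable
  also have "\<dots> = (\<integral>\<^sup>+x. ennreal (h x) * (\<integral>\<^sup>+y. ennreal (h y) \<partial>M) \<partial>M)"
    using h0 by (simp add: ennreal_mult less_imp_le abs_of_pos nn_integral_cmult)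
  also have "\<dots> = (\<integral>\<^sup>+x. ennreal (h x) \<partial>M) * (\<integral>\<^sup>+y. ennreal (h y) \<partial>M)"
    by (rule nn_integral_multc) measurable
  also have "\<dots> = ennreal (\<integral>x. h x \<partial>M) * ennreal (\<integral>x. h x \<partial>M)"
    using hi h0 by (simp add: nn_integral_eq_integral less_imp_le)
  also have "\<dots> < \<infinity>" by (simp add: ennreal_mult_less_top)
  finally show "(\<integral>\<^sup>+z. ennreal (norm (h (fst z) * h (snd z))) \<partial>(M \<Otimes>\<^sub>M M)) < \<infinity>" .
qed

lemma L1_compact_seq:
  fixes U :: "nat \<Rightarrow> 'a \<times> 'a \<Rightarrow> real"
  assumes \<kappa>: "integrable (M \<Otimes>\<^sub>M M) \<kappa>" and U: "\<And>i. integrable (M \<Otimes>\<^sub>M M) (U i)" "\<And>i. L1_compact (U i)"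
    and dom: "integrable (M \<Otimes>\<^sub>M M) w" "\<And>i z. z \<in> space (M \<Otimes>\<^sub>M M) \<Longrightarrow> \<bar>\<kappa> z - U i z\<bar> \<le> w z"
    and lim: "\<And>z. z \<in> space (M \<Otimes>\<^sub>M M) \<Longrightarrow> (\<lambda>i. U i z) \<longlonglongrightarrow> \<kappa> z"
  shows "L1_compact \<kappa>"
proof (rule L1_compact_approx[OF \<kappa>])
  fix e :: real assume e: "e > 0"
  have "(\<lambda>i. \<integral>z. \<bar>\<kappa> z - U i z\<bar> \<partial>(M \<Otimes>\<^sub>M M)) \<longlonglongrightarrow> (\<integral>z. 0 \<partial>(M \<Otimes>\<^sub>M M))"
  proof (rule integral_dominated_convergence[OF _ _ dom(1)])
    show "AE z in M \<Otimes>\<^sub>M M. (\<lambda>i. \<bar>\<kappa> z - U i z\<bar>) \<longlonglongrightarrow> 0"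
    proof (rule AE_I2)
      fix z assume "z \<in> space (M \<Otimes>\<^sub>M M)"
      from tendsto_diff[OF tendsto_const lim[OF this], of "\<kappa> z"]
      show "(\<lambda>i. \<bar>\<kappa> z - U i z\<bar>) \<longlonglongrightarrow> 0" by (simp add: tendsto_rabs_zero)
    qed
    show "(\<lambda>z. \<bar>\<kappa> z - U i z\<bar>) \<in> borel_measurable (M \<Otimes>\<^sub>M M)" for i
      using borel_measurable_integrable[OF \<kappa>] borel_measurable_integrable[OF U(1)] by measurable
  qed (use dom(2) in auto)
  then have "\<forall>\<^sub>F i in sequentially. (\<integral>z. \<bar>\<kappa> z - U i z\<bar> \<partial>(M \<Otimes>\<^sub>M M)) < e"
    using e by (auto dest: order_tendstoD(2))
  then obtain i where "(\<integral>z. \<bar>\<kappa> z - U i z\<bar> \<partial>(M \<Otimes>\<^sub>M M)) < e" by (auto simp: eventually_sequentially)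
  then show "\<exists>\<kappa>'. integrable (M \<Otimes>\<^sub>M M) \<kappa>' \<and> L1_compact \<kappa>' \<and> (\<integral>z. \<bar>\<kappa> z - \<kappa>' z\<bar> \<partial>(M \<Otimes>\<^sub>M M)) < e"
    using U by blast
qed

text \<open>A Dynkin class argument starting from rectangles. The factors \<open>h\<close> make the
  indicator of the whole space integrable, so that complements can be taken.\<close>

lemma L1_compact_set:
  assumes h: "weight M h" and Q: "Q \<in> sets (M \<Otimes>\<^sub>M M)"
  shows "L1_compact (\<lambda>z. indicator Q z * (h (fst z) * h (snd z)))"
proof -
  have [measurable]: "h \<in> borel_measurable M" and h0: "\<And>x. 0 < h x" using h by (auto simp: weight_def)
  let ?h = "\<lambda>z. h (fst z) * h (snd z)"
  note hh = weight_product_integrable[OF h]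
  have ind: "integrable (M \<Otimes>\<^sub>M M) (\<lambda>z. indicator X z * ?h z)" if "X \<in> sets (M \<Otimes>\<^sub>M M)" for X
    using integrable_mult_indicator[OF that hh] by simp
  let ?G = "{a \<times> b | a b. a \<in> sets M \<and> b \<in> sets M}"
  let ?S = "space M \<times> space M"
  have GS: "?G \<subseteq> Pow ?S" using sets.sets_into_space by fastforce
  have sg: "sets (M \<Otimes>\<^sub>M M) = sigma_sets ?S ?G" by (rule sets_pair_measure)
  show ?thesis
    using Int_stable_pair_measure_generator GS Q[unfolded sg]
  proof (induction rule: sigma_sets_induct_disjoint)
    case (basic A)
    then show ?case using L1_compact_rectangle[OF h] by auto
  next
    case empty
    show ?case using L1_compact_rectangle[OF h, of "{}" "{}"] by simp
  next
    case (compl A)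
    have A: "A \<in> sets (M \<Otimes>\<^sub>M M)" using compl.hyps unfolding sg .
    have S: "?S \<in> sets (M \<Otimes>\<^sub>M M)" by simp
    have AS: "A \<subseteq> ?S" using sets.sets_into_space[OF A] by (simp add: space_pair_measure)
    have "L1_compact (\<lambda>z. indicator ?S z * ?h z + -1 * (indicator A z * ?h z))"
    proof (rule L1_compact_add[OF ind[OF S]])
      show "integrable (M \<Otimes>\<^sub>M M) (\<lambda>z. -1 * (indicator A z * ?h z))" using ind[OF A] by simp
      show "L1_compact (\<lambda>z. indicator ?S z * ?h z)" by (rule L1_compact_rectangle[OF h]) auto
      show "L1_compact (\<lambda>z. -1 * (indicator A z * ?h z))"
        by (rule L1_compact_scale[OF borel_measurable_integrable[OF ind[OF A]] compl.IH])
    qed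
    also have "(\<lambda>z. indicator ?S z * ?h z + -1 * (indicator A z * ?h z)) = (\<lambda>z. indicator (?S - A) z * ?h z)"
      using AS by (auto simp: fun_eq_iff indicator_def)
    finally show ?case .
  next
    case (union A)
    have A: "A i \<in> sets (M \<Otimes>\<^sub>M M)" for i using union.hyps(2) unfolding sg by auto
    let ?U = "\<lambda>n. (\<Union>i<n. A i)"
    have U: "?U n \<in> sets (M \<Otimes>\<^sub>M M)" for n using A by auto
    have Un: "L1_compact (\<lambda>z. indicator (?U n) z * ?h z)" for n
    proof (induction n)
      case 0
      show ?case using L1_compact_rectangle[OF h, of "{}" "{}"] by simp
    next
      case (Suc n)
      have "L1_compact (\<lambda>z. indicator (?U n) z * ?h z + indicator (A n) z * ?h z)"
        by (rule L1_compact_add[OF ind[OF U] ind[OF A] Suc.IH union.IH])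
      also have "(\<lambda>z. indicator (?U n) z * ?h z + indicator (A n) z * ?h z) = (\<lambda>z. indicator (?U (Suc n)) z * ?h z)"
      proof
        fix z
        have "z \<notin> ?U n" if z: "z \<in> A n"
        proof
          assume "z \<in> ?U n"
          then obtain i where "i < n" "z \<in> A i" by auto
          then show False using z disjoint_family_onD[OF union.hyps(1), of i n] by auto
        qed
        then show "indicator (?U n) z * ?h z + indicator (A n) z * ?h z = indicator (?U (Suc n)) z * ?h z"
          by (auto simp: indicator_def lessThan_Suc)
      qed
      finally show ?case .
    qed
    show ?case
    proof (rule L1_compact_seq[OF ind ind[OF U] Un hh])
      show "(\<Union>i. A i) \<in> sets (M \<Otimes>\<^sub>M M)" using A by auto
      show "\<bar>indicator (\<Union>i. A i) z * ?h z - indicator (?U n) z * ?h z\<bar> \<le> ?h z" for n z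
        using h0[of "fst z"] h0[of "snd z"] by (auto simp: indicator_def)
      show "(\<lambda>n. indicator (?U n) z * ?h z) \<longlonglongrightarrow> indicator (\<Union>i. A i) z * ?h z" for z
      proof (cases "z \<in> (\<Union>i. A i)")
        case True
        then obtain i where i: "z \<in> A i" by auto
        then show ?thesis
          by (intro tendsto_eventually eventually_sequentiallyI[of "Suc i"]) (auto simp: indicator_def)
      qed (auto simp: indicator_def)
    qed
  qed
qed

text \<open>The kernel is written as \<open>g\<close> times the product weight \<open>H\<close>, and
  \<open>g\<close> is built up from indicators. Integrability appears as the premise of an
  implication, because at each stage it has to be inherited by the parts from the whole.\<close>

lemma L1_compact_integrable:
  assumes \<kappa>: "integrable (M \<Otimes>\<^sub>M M) \<kappa>" and \<kappa>0: "\<And>z. 0 \<le> \<kappa> z"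
  shows "L1_compact \<kappa>"
proof -
  obtain h where h: "weight M h" by (rule obtain_weight)
  have [measurable]: "h \<in> borel_measurable M" and h0: "\<And>x. 0 < h x" using h by (auto simp: weight_def)
  have [measurable]: "\<kappa> \<in> borel_measurable (M \<Otimes>\<^sub>M M)" using \<kappa> by auto
  define H where "H = (\<lambda>z. h (fst z) * h (snd z))"
  have [measurable]: "H \<in> borel_measurable (M \<Otimes>\<^sub>M M)" unfolding H_def by measurable
  have H0: "0 < H z" for z unfolding H_def using h0 by simp
  have bound: "integrable (M \<Otimes>\<^sub>M M) (\<lambda>z. u z * H z)"
    if "integrable (M \<Otimes>\<^sub>M M) (\<lambda>z. v z * H z)" "u \<in> borel_measurable (M \<Otimes>\<^sub>M M)"
      "\<And>z. z \<in> space (M \<Otimes>\<^sub>M M) \<Longrightarrow> 0 \<le> u z \<and> u z \<le> v z" for u v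
  proof (rule Bochner_Integration.integrable_bound[OF that(1)])
    show "(\<lambda>z. u z * H z) \<in> borel_measurable (M \<Otimes>\<^sub>M M)" using that(2) by measurable
    show "AE z in M \<Otimes>\<^sub>M M. norm (u z * H z) \<le> norm (v z * H z)"
      using that(3) H0 by (intro AE_I2) (force simp: abs_mult intro: mult_right_mono)
  qed
  have main: "integrable (M \<Otimes>\<^sub>M M) (\<lambda>z. g z * H z) \<longrightarrow> L1_compact (\<lambda>z. g z * H z)"
    if "g \<in> borel_measurable (M \<Otimes>\<^sub>M M)" "\<And>z. 0 \<le> g z" for g
    using that
  proof (induction rule: borel_measurable_induct_real)
    case (set A)
    show ?case using L1_compact_set[OF h set] by (simp add: H_def)
  next
    case (mult u c)
    note [measurable] = mult.hyps(2)
    show ?case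
    proof
      assume i: "integrable (M \<Otimes>\<^sub>M M) (\<lambda>z. c * u z * H z)"
      show "L1_compact (\<lambda>z. c * u z * H z)"
      \<comment> \<open>For \<open>c = 0\<close> integrability of the multiple says nothing about
        \<open>u\<close>.\<close>
      proof (cases "c = 0")
        case True
        then show ?thesis using L1_compact_set[OF h, of "{}"] by simp
      next
        case False
        have "integrable (M \<Otimes>\<^sub>M M) (\<lambda>z. (1 / c) * (c * u z * H z))" using i by (rule integrable_mult_right)
        then have "integrable (M \<Otimes>\<^sub>M M) (\<lambda>z. u z * H z)" using False by simp
        then have "L1_compact (\<lambda>z. u z * H z)" using mult.IH by simp
        from L1_compact_scale[OF _ this, of c] show ?thesis by (simp add: mult.assoc)
      qed
    qed
  next
    case (add u v)
    show ?case
    proof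
      assume i: "integrable (M \<Otimes>\<^sub>M M) (\<lambda>z. (v z + u z) * H z)"
      have uv: "integrable (M \<Otimes>\<^sub>M M) (\<lambda>z. u z * H z)" "integrable (M \<Otimes>\<^sub>M M) (\<lambda>z. v z * H z)"
        by (rule bound[OF i]; use add.hyps in simp)+
      have "L1_compact (\<lambda>z. v z * H z + u z * H z)"
        by (rule L1_compact_add) (use uv add.IH in auto)
      then show "L1_compact (\<lambda>z. (v z + u z) * H z)" by (simp add: distrib_right)
    qed
  next
    case (seq U)
    show ?case
    proof
      assume i: "integrable (M \<Otimes>\<^sub>M M) (\<lambda>z. g z * H z)"
      have le: "U n z \<le> g z" if "z \<in> space (M \<Otimes>\<^sub>M M)" for n z
      proof -
        have "incseq (\<lambda>n. U n z)" using seq.hyps(3) unfolding incseq_def le_fun_def by blast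
        then show ?thesis using seq.hyps(4)[OF that] by (rule incseq_le)
      qed
      have Ui: "integrable (M \<Otimes>\<^sub>M M) (\<lambda>z. U n z * H z)" for n
        by (rule bound[OF i]) (use seq.hyps le in auto)
      show "L1_compact (\<lambda>z. g z * H z)"
      proof (rule L1_compact_seq[OF i Ui _ i])
        show "L1_compact (\<lambda>z. U n z * H z)" for n using seq.IH Ui by simp
        fix z assume z: "z \<in> space (M \<Otimes>\<^sub>M M)"
        show "(\<lambda>n. U n z * H z) \<longlonglongrightarrow> g z * H z" by (intro tendsto_mult tendsto_const seq.hyps z)
        fix n
        have "U n z * H z \<le> g z * H z" "0 \<le> U n z * H z"
          using le[OF z] H0[of z] seq.hyps(2) by (auto intro: mult_right_mono simp: less_imp_le)
        then show "\<bar>g z * H z - U n z * H z\<bar> \<le> g z * H z" by simp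
      qed
    qed
  qed
  have Hn: "H z \<noteq> 0" for z using H0[of z] by simp
  have "(\<lambda>z. \<kappa> z / H z) \<in> borel_measurable (M \<Otimes>\<^sub>M M)" by measurable
  from main[OF this] show ?thesis using \<kappa> \<kappa>0 H0 Hn by (simp add: less_imp_le)
qed

text \<open>
  For \<open>\<bar>f\<bar>, \<bar>g\<bar> \<le> u\<close> and \<open>W = K u\<close>, the bound \<open>\<bar>K f - K g\<bar>\<^sup>2 \<le> 2 W \<bar>K f - K g\<bar>\<close> turns the distance in
  \<open>L\<^sup>2\<close> into a distance in \<open>L\<^sup>1\<close> for the integrable kernel \<open>k(x,y) u(y) W(x)\<close>.
\<close>

lemma bker_am_compact:
  assumes a: "bker C a"
  shows "am_compact M (kernel_integral M (cr a))"
  unfolding am_compact_def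
proof (intro ballI allI impI)
  fix u and e :: real assume u: "u \<in> pL M" and e: "e > 0"
  let ?K = "kernel_integral M (cr a)"
  have [measurable]: "a \<in> borel_measurable (M \<Otimes>\<^sub>M M)" "u \<in> borel_measurable M"
    using bkerD(1)[OF a] u by (auto simp: pL_def)
  have a0: "0 \<le> a z" for z by (rule bkerD(2)[OF a])
  note u0 = pLD(2)[OF u]
  note pK = bker_pos_op(1)[OF a]
  define W where "W = absop ?K u"
  have W: "W \<in> pL M" unfolding W_def by (rule absop_pL[OF pK u])
  have [measurable]: "W \<in> borel_measurable M" using W by (auto simp: pL_def)
  note W0 = pLD(2)[OF W]
  define \<kappa> where "\<kappa> = (\<lambda>z. a z * u (snd z) * W (fst z))"
  have \<kappa>0: "0 \<le> \<kappa> z" for z unfolding \<kappa>_def using a0 u0 W0 by simp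
  have [measurable]: "\<kappa> \<in> borel_measurable (M \<Otimes>\<^sub>M M)" unfolding \<kappa>_def by measurable
  have \<kappa>i: "integrable (M \<Otimes>\<^sub>M M) \<kappa>"
  proof (rule integrableI_bounded)
    have "(\<integral>\<^sup>+z. ennreal (norm (\<kappa> z)) \<partial>(M \<Otimes>\<^sub>M M)) = (\<integral>\<^sup>+x. (\<integral>\<^sup>+y. ennreal (norm (\<kappa> (x, y))) \<partial>M) \<partial>M)"
      by (rule nn_integral_fst[symmetric]) measurable
    also have "\<dots> = (\<integral>\<^sup>+x. (\<integral>\<^sup>+y. ennreal (a (x, y) * u y * W x) \<partial>M) \<partial>M)"
      using \<kappa>0 by (simp add: abs_of_nonneg) (simp add: \<kappa>_def)
    also have "\<dots> \<le> ennreal (C * (l2_norm M (cr u) * l2_norm M (cr W)))" by (rule bkerD(4)[OF a u W])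
    finally show "(\<integral>\<^sup>+z. ennreal (norm (\<kappa> z)) \<partial>(M \<Otimes>\<^sub>M M)) < \<infinity>" by (simp add: le_less_trans)
  qed measurable
  \<comment> \<open>Half of \<open>e^2\<close>, because the passage from the square of the distance
    to the kernel with weight \<open>W\<close> costs a factor 2.\<close>
  have e2: "e\<^sup>2 / 2 > 0" using e by simp
  obtain \<C> where C: "finite \<C>" "unit_functions \<subseteq> \<Union>\<C>"
    "\<forall>X\<in>\<C>. \<forall>\<phi>\<in>X \<inter> unit_functions. \<forall>\<phi>'\<in>X \<inter> unit_functions. kernel_L1 \<kappa> (\<lambda>y. \<phi> y - \<phi>' y) \<le> ennreal (e\<^sup>2 / 2)"
    by (rule L1_compactE[OF L1_compact_integrable[OF \<kappa>i \<kappa>0] e2])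
  \<comment> \<open>The quotient of \<open>f\<close> by \<open>u\<close>, set to 0 where
    \<open>u\<close> vanishes or the bound fails, so that it is a unit function at every
    point.\<close>
  define phi where "phi = (\<lambda>f y. if cmod (f y) \<le> u y \<and> u y \<noteq> 0 then f y / complex_of_real (u y) else 0)"
  define D where "D = {f \<in> L2 M. AE x in M. cmod (f x) \<le> u x}"
  have phi: "phi f \<in> unit_functions" "AE y in M. f y = complex_of_real (u y) * phi f y" if f: "f \<in> D" for f
  proof -
    have [measurable]: "f \<in> borel_measurable M" using f by (auto simp: D_def L2_def)
    have "phi f \<in> borel_measurable M" unfolding phi_def by measurable
    moreover have "cmod (phi f y) \<le> 1" for y using u0[of y] by (auto simp: phi_def norm_divide divide_le_eq_1)
    ultimately show "phi f \<in> unit_functions" by (simp add: unit_functions_def)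
    have "AE y in M. cmod (f y) \<le> u y" using f by (simp add: D_def)
    then show "AE y in M. f y = complex_of_real (u y) * phi f y"
      by eventually_elim (auto simp: phi_def)
  qed
  have close: "l2_norm M (\<lambda>x. ?K f x - ?K g x) \<le> e"
    if X: "X \<in> \<C>" and f: "f \<in> D" "phi f \<in> X" and g: "g \<in> D" "phi g \<in> X" for X f g
  proof -
    have L: "f \<in> L2 M" "g \<in> L2 M" and b: "AE x in M. cmod (f x) \<le> u x" "AE x in M. cmod (g x) \<le> u x"
      using f g by (auto simp: D_def)
    have [measurable]: "f \<in> borel_measurable M" "g \<in> borel_measurable M" using L by (auto simp: L2_def)
    have [measurable]: "phi f \<in> borel_measurable M" "phi g \<in> borel_measurable M"
      using phi(1)[OF f(1)] phi(1)[OF g(1)] by (auto simp: unit_functions_def)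
    have KL: "(\<lambda>x. ?K f x - ?K g x) \<in> L2 M"
      by (intro L2_diff bounded_op_L2[OF pos_opD(1)[OF pK]] L)
    define d where "d = (\<lambda>y. phi f y - phi g y)"
    have [measurable]: "d \<in> borel_measurable M" unfolding d_def by measurable
    have aeq: "AE y in M. f y - g y = complex_of_real (u y) * d y"
      using phi(2)[OF f(1)] phi(2)[OF g(1)]
    proof eventually_elim
      case (elim y)
      have "f y - g y = complex_of_real (u y) * phi f y - complex_of_real (u y) * phi g y"
        using elim by (rule arg_cong2)
      then show ?case by (simp add: d_def right_diff_distrib)
    qed
    have "AE x in M. (cmod (?K f x - ?K g x))\<^sup>2 \<le> 2 * cmod (\<integral>y. complex_of_real (\<kappa> (x, y)) * d y \<partial>M)"
      using bker_section(1)[OF a L(1)] bker_section(1)[OF a L(2)]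
        pos_opD(3)[OF pK L(1) u b(1)] pos_opD(3)[OF pK L(2) u b(2)]
    proof (rule AE_mp[OF AE_conjI AE_mp[OF AE_conjI]], intro AE_I2 impI, elim conjE)
      fix x assume x: "x \<in> space M" and i: "integrable M (\<lambda>y. complex_of_real (a (x, y)) * f y)"
          "integrable M (\<lambda>y. complex_of_real (a (x, y)) * g y)"
        and le: "cmod (?K f x) \<le> absop ?K u x" "cmod (?K g x) \<le> absop ?K u x"
      have "?K f x - ?K g x = (\<integral>y. complex_of_real (a (x, y)) * (f y - g y) \<partial>M)"
        unfolding kernel_integral_def using i by (simp add: right_diff_distrib)
      also have "\<dots> = (\<integral>y. complex_of_real (a (x, y) * u y) * d y \<partial>M)"
        by (rule integral_cong_AE) (use x in measurable, use aeq in eventually_elim, simp)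
      finally have eq: "?K f x - ?K g x = (\<integral>y. complex_of_real (a (x, y) * u y) * d y \<partial>M)" .
      have "complex_of_real (W x) * (?K f x - ?K g x) = (\<integral>y. complex_of_real (\<kappa> (x, y)) * d y \<partial>M)"
        unfolding eq integral_mult_right_zero[symmetric]
        by (rule Bochner_Integration.integral_cong) (auto simp: \<kappa>_def)
      then have "cmod (\<integral>y. complex_of_real (\<kappa> (x, y)) * d y \<partial>M) = W x * cmod (?K f x - ?K g x)"
        using W0[of x] by (metis abs_of_nonneg norm_mult norm_of_real)
      moreover have "cmod (?K f x - ?K g x) \<le> 2 * W x"
        using le norm_triangle_ineq4[of "?K f x" "?K g x"] unfolding W_def by linarith
      then have "(cmod (?K f x - ?K g x))\<^sup>2 \<le> 2 * W x * cmod (?K f x - ?K g x)"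
        unfolding power2_eq_square by (rule mult_right_mono) simp
      ultimately show "(cmod (?K f x - ?K g x))\<^sup>2 \<le> 2 * cmod (\<integral>y. complex_of_real (\<kappa> (x, y)) * d y \<partial>M)" by simp
    qed
    then have "(\<integral>\<^sup>+x. ennreal ((cmod (?K f x - ?K g x))\<^sup>2) \<partial>M) \<le> (\<integral>\<^sup>+x. ennreal 2 * ennreal (cmod (\<integral>y. complex_of_real (\<kappa> (x, y)) * d y \<partial>M)) \<partial>M)"
      by (intro nn_integral_mono_AE) (auto simp: ennreal_mult[symmetric] ennreal_leI simp del: ennreal_numeral elim: eventually_mono)
    also have "\<dots> = ennreal 2 * kernel_L1 \<kappa> d"
      unfolding kernel_L1_def by (rule nn_integral_cmult) measurable
    also have "\<dots> \<le> ennreal 2 * ennreal (e\<^sup>2 / 2)"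
      unfolding d_def by (intro mult_left_mono C(3)[rule_format, OF X] IntI f(2) phi(1)[OF f(1)] g(2) phi(1)[OF g(1)]) simp
    also have "\<dots> = ennreal (e\<^sup>2)" by (simp add: ennreal_mult[symmetric] del: ennreal_numeral)
    finally have le: "(\<integral>\<^sup>+x. ennreal ((cmod (?K f x - ?K g x))\<^sup>2) \<partial>M) \<le> ennreal (e\<^sup>2)" .
    have "(\<integral>\<^sup>+x. ennreal ((cmod (?K f x - ?K g x))\<^sup>2) \<partial>M) = ennreal (\<integral>x. (cmod (?K f x - ?K g x))\<^sup>2 \<partial>M)"
      using L2D(2)[OF KL] by (intro nn_integral_eq_integral) auto
    with le have "(l2_norm M (\<lambda>x. ?K f x - ?K g x))\<^sup>2 \<le> e\<^sup>2" by (simp add: l2_norm_sq)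
    then show ?thesis by (rule power2_le_imp_le) (use e in simp)
  qed
  \<comment> \<open>The cover has no centres; a representative is chosen in each of its sets that is
    met, and its image serves as a point of the net.\<close>
  define rep where "rep = (\<lambda>X. SOME f. f \<in> D \<and> phi f \<in> X)"
  define N where "N = (\<lambda>X. ?K (rep X)) ` {X \<in> \<C>. \<exists>f. f \<in> D \<and> phi f \<in> X}"
  have rep: "rep X \<in> D \<and> phi (rep X) \<in> X" if "\<exists>f. f \<in> D \<and> phi f \<in> X" for X
    unfolding rep_def using that by (rule someI_ex)
  show "\<exists>F. finite F \<and> F \<subseteq> L2 M \<and>
     (\<forall>f\<in>L2 M. (AE x in M. cmod (f x) \<le> u x) \<longrightarrow> (\<exists>g\<in>F. l2_norm M (\<lambda>x. ?K f x - g x) \<le> e))"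
  proof (intro exI[of _ N] conjI ballI impI)
    show "finite N" unfolding N_def using C(1) by simp
    show "N \<subseteq> L2 M"
    proof
      fix k assume "k \<in> N"
      then obtain X where X: "k = ?K (rep X)" "\<exists>f. f \<in> D \<and> phi f \<in> X" by (auto simp: N_def)
      then have "rep X \<in> L2 M" using rep[OF X(2)] by (auto simp: D_def)
      then show "k \<in> L2 M" unfolding X(1) by (rule bounded_op_L2[OF pos_opD(1)[OF pK]])
    qed
    fix f assume "f \<in> L2 M" "AE x in M. cmod (f x) \<le> u x"
    then have f: "f \<in> D" by (simp add: D_def)
    obtain X where X: "X \<in> \<C>" "phi f \<in> X" using C(2) phi(1)[OF f] by auto
    then have ex: "\<exists>f. f \<in> D \<and> phi f \<in> X" using f by blast
    have "l2_norm M (\<lambda>x. ?K f x - ?K (rep X) x) \<le> e"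
      using rep[OF ex] by (intro close[OF X(1) f X(2)]) auto
    moreover have "?K (rep X) \<in> N" unfolding N_def using X(1) ex by blast
    ultimately show "\<exists>g\<in>N. l2_norm M (\<lambda>x. ?K f x - g x) \<le> e" by blast
  qed
qed

end

section \<open>Geometric means of kernels\<close>

lemma rpow_nonneg: "0 \<le> rpow x s"
  by (simp add: rpow_def)

lemma rpow_exponent_0: "0 \<le> x \<Longrightarrow> rpow x 0 = 1"
  by (simp add: rpow_def)

lemma rpow_exponent_1: "0 \<le> x \<Longrightarrow> rpow x 1 = x"
  by (simp add: rpow_def)

lemma rpow_add:
  assumes "0 \<le> x" "0 \<le> s" "0 \<le> t"
  shows "rpow x (s + t) = rpow x s * rpow x t"
  using assms by (auto simp: rpow_def powr_add)

lemma rpow_powr: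
  assumes "0 \<le> x" "0 < \<theta>"
  shows "rpow x s powr \<theta> = rpow x (s * \<theta>)"
  using assms by (auto simp: rpow_def powr_powr)

lemma rpow_Young:
  assumes "0 \<le> x" "0 \<le> y" "0 \<le> \<alpha>" "\<alpha> \<le> 1"
  shows "rpow x \<alpha> * rpow y (1-\<alpha>) \<le> \<alpha> * x + (1-\<alpha>) * y"
proof -
  consider "\<alpha> = 0" | "\<alpha> = 1" | "0 < \<alpha>" "\<alpha> < 1" using assms by linarith
  then show ?thesis
  proof cases
    case 3
    then show ?thesis
      using Youngs_inequality_0[of \<alpha> "1-\<alpha>" x y] assms by (cases "x = 0 \<or> y = 0") (auto simp: rpow_def)
  qed (use assms in \<open>simp_all add: rpow_exponent_0 rpow_exponent_1\<close>)
qed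

text \<open>The exponents split as \<alpha> = \<beta>\<theta> + (1-\<beta>)(1-\<theta>) and
  1-\<alpha> = (1-\<beta>)\<theta> + \<beta>(1-\<theta>); collecting the powers with \<theta> and
  with 1-\<theta> gives the two brackets.\<close>

lemma rpow_interpolation:
  assumes "0 \<le> x" "0 \<le> y" "0 \<le> \<beta>" "\<beta> \<le> 1" "0 < \<theta>" "\<theta> < 1" and \<alpha>: "\<alpha> = \<theta> * \<beta> + (1-\<theta>) * (1-\<beta>)"
  shows "rpow x \<alpha> * rpow y (1-\<alpha>)
    = (rpow x \<beta> * rpow y (1-\<beta>)) powr \<theta> * (rpow y \<beta> * rpow x (1-\<beta>)) powr (1-\<theta>)"
proof -
  have \<alpha>1: "\<alpha> = \<beta> * \<theta> + (1-\<beta>) * (1-\<theta>)" and \<alpha>2: "1 - \<alpha> = (1-\<beta>) * \<theta> + \<beta> * (1-\<theta>)"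
    unfolding \<alpha> by (simp_all add: algebra_simps)
  have "rpow x \<alpha> = rpow x (\<beta> * \<theta>) * rpow x ((1-\<beta>) * (1-\<theta>))"
    unfolding \<alpha>1 by (rule rpow_add) (use assms in auto)
  moreover have "rpow y (1-\<alpha>) = rpow y ((1-\<beta>) * \<theta>) * rpow y (\<beta> * (1-\<theta>))"
    unfolding \<alpha>2 by (rule rpow_add) (use assms in auto)
  ultimately show ?thesis
    using assms by (simp add: powr_mult rpow_nonneg rpow_powr mult_ac)
qed

lemma borel_measurable_rpow [measurable (raw)]:
  "f \<in> borel_measurable N \<Longrightarrow> (\<lambda>x. rpow (f x) s) \<in> borel_measurable N"
  by (cases "s = 0") (simp_all add: rpow_def)

context sigma_finite_measure
begin

interpretation P: pair_sigma_finite M M ..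

text \<open>Young's inequality under the integral gives only the maximum of the two bounds, but it
  includes the endpoints 0 and 1 of \<alpha>, and boundedness is all that is wanted here.\<close>

lemma bker_geometric_mean:
  assumes a: "bker C a" and b: "bker C' b" and \<alpha>: "0 \<le> \<alpha>" "\<alpha> \<le> 1"
  shows "bker (max C C') (\<lambda>z. rpow (a z) \<alpha> * rpow (b z) (1-\<alpha>))"
  unfolding bker_def
proof (intro conjI ballI allI)
  note [measurable] = bkerD(1)[OF a] bkerD(1)[OF b]
  note a0 = bkerD(2)[OF a] and b0 = bkerD(2)[OF b]
  show "(\<lambda>z. rpow (a z) \<alpha> * rpow (b z) (1-\<alpha>)) \<in> borel_measurable (M \<Otimes>\<^sub>M M)" by measurable
  show "0 \<le> rpow (a z) \<alpha> * rpow (b z) (1-\<alpha>)" for z by (simp add: rpow_nonneg)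
  show "0 \<le> max C C'" using bkerD(3)[OF a] by simp
  fix u v assume u: "u \<in> pL M" and v: "v \<in> pL M"
  have [measurable]: "u \<in> borel_measurable M" "v \<in> borel_measurable M" using u v by (auto simp: pL_def)
  note u0 = pLD(2)[OF u] and v0 = pLD(2)[OF v]
  let ?N = "l2_norm M (cr u) * l2_norm M (cr v)"
  let ?I = "\<lambda>a. \<integral>\<^sup>+x. (\<integral>\<^sup>+y. ennreal (a (x, y) * u y * v x) \<partial>M) \<partial>M"
  have "?I (\<lambda>z. rpow (a z) \<alpha> * rpow (b z) (1-\<alpha>))
      \<le> (\<integral>\<^sup>+x. (\<integral>\<^sup>+y. ennreal \<alpha> * ennreal (a (x, y) * u y * v x) + ennreal (1-\<alpha>) * ennreal (b (x, y) * u y * v x) \<partial>M) \<partial>M)"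
  proof (intro nn_integral_mono)
    fix x y
    have "rpow (a (x, y)) \<alpha> * rpow (b (x, y)) (1-\<alpha>) * u y * v x \<le> (\<alpha> * a (x, y) + (1-\<alpha>) * b (x, y)) * u y * v x"
      using rpow_Young[OF a0 b0 \<alpha>] u0 v0 by (intro mult_right_mono) auto
    then have "ennreal (rpow (a (x, y)) \<alpha> * rpow (b (x, y)) (1-\<alpha>) * u y * v x)
        \<le> ennreal (\<alpha> * (a (x, y) * u y * v x) + (1-\<alpha>) * (b (x, y) * u y * v x))"
      by (intro ennreal_leI) (simp add: algebra_simps)
    also have "\<dots> = ennreal \<alpha> * ennreal (a (x, y) * u y * v x) + ennreal (1-\<alpha>) * ennreal (b (x, y) * u y * v x)"
      using \<alpha> a0 b0 u0 v0 by (simp add: ennreal_mult)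
    finally show "ennreal (rpow (a (x, y)) \<alpha> * rpow (b (x, y)) (1-\<alpha>) * u y * v x)
        \<le> ennreal \<alpha> * ennreal (a (x, y) * u y * v x) + ennreal (1-\<alpha>) * ennreal (b (x, y) * u y * v x)" .
  qed
  also have "\<dots> = ennreal \<alpha> * ?I a + ennreal (1-\<alpha>) * ?I b"
  proof -
    have "(\<integral>\<^sup>+y. ennreal \<alpha> * ennreal (a (x, y) * u y * v x) + ennreal (1-\<alpha>) * ennreal (b (x, y) * u y * v x) \<partial>M)
      = ennreal \<alpha> * (\<integral>\<^sup>+y. ennreal (a (x, y) * u y * v x) \<partial>M) + ennreal (1-\<alpha>) * (\<integral>\<^sup>+y. ennreal (b (x, y) * u y * v x) \<partial>M)"
      if "x \<in> space M" for x
      using that by (simp add: nn_integral_add nn_integral_cmult)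
    then have "(\<integral>\<^sup>+x. (\<integral>\<^sup>+y. ennreal \<alpha> * ennreal (a (x, y) * u y * v x) + ennreal (1-\<alpha>) * ennreal (b (x, y) * u y * v x) \<partial>M) \<partial>M)
      = (\<integral>\<^sup>+x. ennreal \<alpha> * (\<integral>\<^sup>+y. ennreal (a (x, y) * u y * v x) \<partial>M) + ennreal (1-\<alpha>) * (\<integral>\<^sup>+y. ennreal (b (x, y) * u y * v x) \<partial>M) \<partial>M)"
      by (rule nn_integral_cong)
    then show ?thesis by (simp add: nn_integral_add nn_integral_cmult)
  qed
  also have "\<dots> \<le> ennreal \<alpha> * ennreal (C * ?N) + ennreal (1-\<alpha>) * ennreal (C' * ?N)"
    by (intro add_mono mult_left_mono bkerD(4)[OF a u v] bkerD(4)[OF b u v]) auto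
  also have "\<dots> = ennreal (\<alpha> * (C * ?N) + (1-\<alpha>) * (C' * ?N))"
    using \<alpha> bkerD(3)[OF a] bkerD(3)[OF b] by (simp add: ennreal_mult)
  also have "\<dots> \<le> ennreal (max C C' * ?N)"
  proof (rule ennreal_leI)
    have "\<alpha> * (C * ?N) + (1-\<alpha>) * (C' * ?N) \<le> \<alpha> * (max C C' * ?N) + (1-\<alpha>) * (max C C' * ?N)"
      using \<alpha> by (intro add_mono mult_left_mono mult_right_mono) auto
    then show "\<alpha> * (C * ?N) + (1-\<alpha>) * (C' * ?N) \<le> max C C' * ?N" by (simp add: algebra_simps)
  qed
  finally show "?I (\<lambda>z. rpow (a z) \<alpha> * rpow (b z) (1-\<alpha>)) \<le> ennreal (max C C' * ?N)" .
qed

text \<open>Hoelder's inequality in the second variable, on almost every section.\<close>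

lemma mdom_kernel:
  assumes \<theta>: "0 < \<theta>" "\<theta> < 1" and t: "bker C\<^sub>t t" and c: "bker C\<^sub>c c" and d: "bker C\<^sub>d d"
    and le: "AE z in M \<Otimes>\<^sub>M M. t z \<le> c z powr \<theta> * d z powr (1-\<theta>)"
  shows "mdom M \<theta> (kernel_integral M (cr t)) (kernel_integral M (cr c)) (kernel_integral M (cr d))"
  unfolding mdom_def
proof (intro ballI)
  fix u v assume u: "u \<in> pL M" and v: "v \<in> pL M"
  note u0 = pLD(2)[OF u] and v0 = pLD(2)[OF v] and t0 = bkerD(2)[OF t] and c0 = bkerD(2)[OF c] and d0 = bkerD(2)[OF d]
  note w = pL_interpolate(1)[OF \<theta> u v]
  have w0: "0 \<le> u y powr \<theta> * v y powr (1-\<theta>)" for y by simp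
  show "AE x in M. absop (kernel_integral M (cr t)) (\<lambda>x. u x powr \<theta> * v x powr (1-\<theta>)) x
      \<le> absop (kernel_integral M (cr c)) u x powr \<theta> * absop (kernel_integral M (cr d)) v x powr (1-\<theta>)"
    using bker_integrable[OF t w] bker_integrable[OF c u] bker_integrable[OF d v] P.AE_pair[OF le]
  proof eventually_elim
    case (elim x)
    have cu: "0 \<le> c (x, y) * u y" "0 \<le> d (x, y) * v y" for y using c0 d0 u0 v0 by auto
    note H = Hoelder_integral[OF \<theta> elim(2,3) cu]
    have "(\<integral>y. t (x, y) * (u y powr \<theta> * v y powr (1-\<theta>)) \<partial>M)
        \<le> (\<integral>y. (c (x, y) * u y) powr \<theta> * (d (x, y) * v y) powr (1-\<theta>) \<partial>M)"
    proof (rule integral_mono_AE[OF elim(1) H(1)])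
      show "AE y in M. t (x, y) * (u y powr \<theta> * v y powr (1-\<theta>)) \<le> (c (x, y) * u y) powr \<theta> * (d (x, y) * v y) powr (1-\<theta>)"
        using elim(4)
      proof eventually_elim
        case (elim y)
        have "t (x, y) * (u y powr \<theta> * v y powr (1-\<theta>))
            \<le> (c (x, y) powr \<theta> * d (x, y) powr (1-\<theta>)) * (u y powr \<theta> * v y powr (1-\<theta>))"
          using elim by (rule mult_right_mono) simp
        then show ?case using c0 d0 u0 v0 by (simp add: powr_mult mult_ac)
      qed
    qed
    also note H(2)
    finally show ?case
      unfolding absop_kernel(2)[of t, OF t0 w0] absop_kernel(2)[of c, OF c0 u0] absop_kernel(2)[of d, OF d0 v0] .
  qed
qed

lemma kernel_adjoint_of:
  assumes A: "bounded_op M A" and k: "has_kernel M A (cr a)" and a0: "\<And>z. 0 \<le> a z"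
  shows "adjoint_of M A (kernel_integral M (cr (flip a)))"
  unfolding adjoint_of_def
proof (intro conjI ballI)
  note a = has_kernel_bker[OF A k a0]
  show "bounded_op M (kernel_integral M (cr (flip a)))"
    by (rule pos_opD(1)[OF bker_pos_op(1)[OF bker_flip[OF a]]])
  fix f g assume f: "f \<in> L2 M" and g: "g \<in> L2 M"
  have "l2_inner M (A f) g = l2_inner M (kernel_integral M (cr a) f) g"
    using L2D(1)[OF bounded_op_L2[OF A f]] L2D(1)[OF bounded_op_L2[OF pos_opD(1)[OF bker_pos_op(1)[OF a]] f]]
      L2D(1)[OF g] has_kernelD(3)[OF k f]
    by (intro l2_inner_cong_AE) auto
  also note adjoint_ofD(2)[OF bker_adjoint[OF a] f g]
  finally show "l2_inner M (A f) g = l2_inner M f (kernel_integral M (cr (flip a)) g)" .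
qed

text \<open>Any adjoint agrees a.e., function by function, with the operator of the transposed
  kernel, and therefore has that kernel.\<close>

lemma has_kernel_adjoint:
  assumes A: "bounded_op M A" and k: "has_kernel M A (cr a)" and a0: "\<And>z. 0 \<le> a z"
    and B: "adjoint_of M A B"
  shows "has_kernel M B (cr (flip a))"
proof -
  note K = bker_pos_op(3)[OF bker_flip[OF has_kernel_bker[OF A k a0]]]
  show ?thesis
    by (rule has_kernelI[OF has_kernelD(1)[OF K] has_kernelD(2)[OF K]
          adjoint_of_unique[OF A B kernel_adjoint_of[OF A k a0]]])
qed

lemma adj_adjoint_of:
  assumes A: "bounded_op M A" "positive_kernel_op M A"
  shows "adjoint_of M A (adj M A)"
  unfolding adj_def
  by (rule someI[of "adjoint_of M A", OF kernel_adjoint_of[OF A(1) nonneg_kernel(2,1)[OF A(2)]]])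

lemma has_nonneg_kernel_positive_op:
  assumes k: "has_kernel M B (cr b)" and b0: "\<And>z. 0 \<le> b z"
  shows "positive_op M B"
  unfolding positive_op_def
proof (intro ballI impI)
  fix f assume f: "f \<in> L2 M" and nn: "AE x in M. f x \<in> \<real>\<^sub>\<ge>\<^sub>0"
  have int: "kernel_integral M (cr b) f x \<in> \<real>\<^sub>\<ge>\<^sub>0" for x
    unfolding kernel_integral_def
    by (rule integral_nonneg_Reals) (use nn b0 in \<open>auto intro: nonneg_Reals_mult_I elim!: eventually_mono\<close>)
  show "AE x in M. B f x \<in> \<real>\<^sub>\<ge>\<^sub>0"
    using has_kernelD(3)[OF k f] by (rule eventually_mono) (simp add: int)
qed

text \<open>The kernel identity is given in both orientations. The second one comes from viewing
  \<open>A\<close> as the adjoint of \<open>adj M A\<close>, instead of transporting a null set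
  under the exchange of variables.\<close>

lemma adj_properties:
  assumes A: "bounded_op M A" "positive_kernel_op M A"
  shows "bounded_op M (adj M A)" "positive_kernel_op M (adj M A)" "op_norm M (adj M A) = op_norm M A"
    and "AE z in M \<Otimes>\<^sub>M M. nonneg_kernel M (adj M A) z = nonneg_kernel M A (snd z, fst z)"
    and "AE z in M \<Otimes>\<^sub>M M. nonneg_kernel M (adj M A) (snd z, fst z) = nonneg_kernel M A z"
proof -
  note ad = adj_adjoint_of[OF A]
  note k = nonneg_kernel[OF A(2)]
  note ka = has_kernel_adjoint[OF A(1) k(2,1) ad]
  show b: "bounded_op M (adj M A)" by (rule adjoint_ofD(1)[OF ad])
  show p: "positive_kernel_op M (adj M A)"
    unfolding positive_kernel_op_def
    using bounded_op_linear[OF b] ka has_nonneg_kernel_positive_op[OF ka] k(1) by blast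
  show "op_norm M (adj M A) = op_norm M A" by (rule op_norm_adjoint[OF A(1) ad])
  note k' = nonneg_kernel[OF p]
  show "AE z in M \<Otimes>\<^sub>M M. nonneg_kernel M (adj M A) z = nonneg_kernel M A (snd z, fst z)"
    using kernel_unique[OF k'(2) ka] by simp
  show "AE z in M \<Otimes>\<^sub>M M. nonneg_kernel M (adj M A) (snd z, fst z) = nonneg_kernel M A z"
    using kernel_unique[OF has_kernel_adjoint[OF b k'(2,1) adjoint_of_sym[OF A(1) ad]] k(2)] by simp
qed

lemma bker_hadamard:
  assumes A: "bounded_op M A" "positive_kernel_op M A" and B: "bounded_op M B" "positive_kernel_op M B"
    and \<alpha>: "0 \<le> \<alpha>" "\<alpha> \<le> 1"
  shows "bker (max (op_norm M A) (op_norm M B)) (\<lambda>z. rpow (nonneg_kernel M A z) \<alpha> * rpow (nonneg_kernel M B z) (1-\<alpha>))"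
  by (rule bker_geometric_mean[OF has_kernel_bker[OF A(1) nonneg_kernel(2,1)[OF A(2)]]
        has_kernel_bker[OF B(1) nonneg_kernel(2,1)[OF B(2)]] \<alpha>])

text \<open>Transposing the kernel of \<open>hadamard M \<beta> B (adj M A)\<close> turns
  \<open>b\<close> into the kernel of the adjoint of \<open>B\<close> and \<open>a'\<close> into
  \<open>a\<close>, a.e. The domination then holds with equality of kernels, by
  \<open>rpow_interpolation\<close>.\<close>

lemma hadamard_interp:
  assumes A: "bounded_op M A" "positive_kernel_op M A" and B: "bounded_op M B" "positive_kernel_op M B"
    and \<beta>: "0 \<le> \<beta>" "\<beta> \<le> 1" and \<theta>: "0 < \<theta>" "\<theta> < 1" and \<alpha>: "\<alpha> = \<theta> * \<beta> + (1-\<theta>) * (1-\<beta>)"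
  shows "interp M \<theta> (hadamard M \<alpha> A (adj M B)) (hadamard M \<beta> A (adj M B)) (hadamard M \<beta> B (adj M A))"
proof -
  note A' = adj_properties[OF A] and B' = adj_properties[OF B]
  define a b a' b' where "a = nonneg_kernel M A" and "b = nonneg_kernel M B"
    and "a' = nonneg_kernel M (adj M A)" and "b' = nonneg_kernel M (adj M B)"
  have a0: "0 \<le> a z" and b0: "0 \<le> b' z" for z
    unfolding a_def b'_def using nonneg_kernel(1) A(2) B'(2) by auto
  have \<alpha>01: "0 \<le> \<alpha>" "\<alpha> \<le> 1"
  proof -
    show "0 \<le> \<alpha>" unfolding \<alpha> using \<beta> \<theta> by simp
    have "\<theta> * \<beta> + (1-\<theta>) * (1-\<beta>) \<le> \<theta> * 1 + (1-\<theta>) * 1"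
      using \<beta> \<theta> by (intro add_mono mult_left_mono) auto
    then show "\<alpha> \<le> 1" unfolding \<alpha> by simp
  qed
  note t = bker_hadamard[OF A B'(1,2) \<alpha>01, folded a_def b'_def]
    and c = bker_hadamard[OF A B'(1,2) \<beta>, folded a_def b'_def]
    and d = bker_hadamard[OF B A'(1,2) \<beta>, folded b_def a'_def]
  have le: "AE z in M \<Otimes>\<^sub>M M. rpow (a z) \<alpha> * rpow (b' z) (1-\<alpha>)
      \<le> (rpow (a z) \<beta> * rpow (b' z) (1-\<beta>)) powr \<theta> *
        (rpow (b (snd z, fst z)) \<beta> * rpow (a' (snd z, fst z)) (1-\<beta>)) powr (1-\<theta>)"
    using A'(5)[folded a_def a'_def] B'(4)[folded b_def b'_def]
  proof eventually_elim
    case (elim z)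
    show ?case
      unfolding elim(1) elim(2)[symmetric]
      using rpow_interpolation[OF a0 b0 \<beta> \<theta> \<alpha>] by simp
  qed
  show ?thesis
    unfolding interp_def hadamard_def a_def[symmetric] b_def[symmetric] a'_def[symmetric] b'_def[symmetric]
    using bker_pos_op(1)[OF t] bker_pos_op(1)[OF c] bker_pos_op(1)[OF d] bker_adjoint[OF c] bker_adjoint[OF d]
      bker_pos_op(1)[OF bker_flip[OF d]] mdom_kernel[OF \<theta> t c bker_flip[OF d] le]
    by blast
qed

lemma S_mean_properties:
  assumes \<Psi>: "\<And>A. A \<in> \<Psi> \<Longrightarrow> positive_kernel_op M A" "bounded_ops M \<Psi>" and \<alpha>: "0 \<le> \<alpha>" "\<alpha> \<le> 1"
  shows "pos_ops M (S_mean M \<alpha> \<Psi>)" "T \<in> S_mean M \<alpha> \<Psi> \<Longrightarrow> am_compact M T"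
proof -
  have b: "bounded_op M A" if "A \<in> \<Psi>" for A using \<Psi>(2) that by (simp add: bounded_ops_def)
  obtain K where K: "\<And>A. A \<in> \<Psi> \<Longrightarrow> op_norm M A \<le> K"
    using \<Psi>(2) by (auto simp: bounded_ops_def bdd_above_def)
  have had: "pos_op M T \<and> op_norm M T \<le> K \<and> am_compact M T" if T: "T \<in> S_mean M \<alpha> \<Psi>" for T
  proof -
    obtain A B where AB: "A \<in> \<Psi>" "B \<in> \<Psi>" "T = hadamard M \<alpha> A (adj M B)"
      using T by (auto simp: S_mean_def)
    note B' = adj_properties[OF b[OF AB(2)] \<Psi>(1)[OF AB(2)]]
    note t = bker_hadamard[OF b[OF AB(1)] \<Psi>(1)[OF AB(1)] B'(1,2) \<alpha>]
    have "max (op_norm M A) (op_norm M (adj M B)) \<le> K" using K AB B'(3) by simp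
    then show ?thesis
      unfolding AB(3) hadamard_def
      using bker_pos_op(1,2)[OF t] bker_am_compact[OF t] by linarith
  qed
  show "pos_ops M (S_mean M \<alpha> \<Psi>)"
    unfolding pos_ops_def using had by (auto intro!: bdd_aboveI[of _ K])
  show "T \<in> S_mean M \<alpha> \<Psi> \<Longrightarrow> am_compact M T" using had by blast
qed

lemma S_mean_interp:
  assumes \<Psi>: "\<And>A. A \<in> \<Psi> \<Longrightarrow> positive_kernel_op M A" "bounded_ops M \<Psi>"
    and \<beta>: "0 \<le> \<beta>" "\<beta> \<le> 1" and \<theta>: "0 < \<theta>" "\<theta> < 1" and \<alpha>: "\<alpha> = \<theta> * \<beta> + (1-\<theta>) * (1-\<beta>)"
  shows "interp_set M \<theta> (S_mean M \<alpha> \<Psi>) (S_mean M \<beta> \<Psi>) (S_mean M \<beta> \<Psi>)"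
  unfolding interp_set_def
proof
  fix T assume "T \<in> S_mean M \<alpha> \<Psi>"
  then obtain A B where AB: "A \<in> \<Psi>" "B \<in> \<Psi>" "T = hadamard M \<alpha> A (adj M B)"
    by (auto simp: S_mean_def)
  have b: "bounded_op M A" "bounded_op M B" using \<Psi>(2) AB by (auto simp: bounded_ops_def)
  have "interp M \<theta> T (hadamard M \<beta> A (adj M B)) (hadamard M \<beta> B (adj M A))"
    unfolding AB(3) by (rule hadamard_interp[OF b(1) \<Psi>(1)[OF AB(1)] b(2) \<Psi>(1)[OF AB(2)] \<beta> \<theta> \<alpha>])
  moreover have "hadamard M \<beta> A (adj M B) \<in> S_mean M \<beta> \<Psi>" "hadamard M \<beta> B (adj M A) \<in> S_mean M \<beta> \<Psi>"
    using AB by (auto simp: S_mean_def)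
  ultimately show "\<exists>C\<in>S_mean M \<beta> \<Psi>. \<exists>D\<in>S_mean M \<beta> \<Psi>. interp M \<theta> T C D" by blast
qed

lemma rho_n_interpolation:
  fixes \<Psi> :: "nat \<Rightarrow> 'a l2op set"
  assumes n: "n \<ge> 1"
    and \<Psi>: "\<And>i A. i \<in> {1..n} \<Longrightarrow> A \<in> \<Psi> i \<Longrightarrow> positive_kernel_op M A"
      "\<And>i. i \<in> {1..n} \<Longrightarrow> bounded_ops M (\<Psi> i)"
    and \<rho>: "\<rho> \<in> {gen_spectral_rad M, joint_spectral_rad M,
               gen_ess_spectral_rad M, joint_ess_spectral_rad M,
               set_norm M, set_mnc M, set_numerical_radius M}"
    and \<beta>: "0 \<le> \<beta>" "\<beta> \<le> 1" and \<theta>: "0 < \<theta>" "\<theta> < 1" and \<alpha>: "\<alpha> = \<theta> * \<beta> + (1-\<theta>) * (1-\<beta>)"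
    and \<alpha>01: "0 \<le> \<alpha>" "\<alpha> \<le> 1"
  shows "rho_n M \<rho> \<Psi> n \<alpha> \<le> rho_n M \<rho> \<Psi> n \<beta>"
proof -
  obtain h where h: "weight M h" by (rule obtain_weight)
  define L where "L = [1..<n+1]"
  have L: "set L = {1..n}" "L \<noteq> []" "rev L \<noteq> []" unfolding L_def using n by auto
  define S where "S = (\<lambda>\<gamma> L. ops_prod (map (\<lambda>i. S_mean M \<gamma> (\<Psi> i)) L))"
  have pos: "pos_ops M (S \<gamma> L')" if L': "set L' = {1..n}" and \<gamma>: "0 \<le> \<gamma>" "\<gamma> \<le> 1" for \<gamma> L'
    unfolding S_def
  proof (rule pos_ops_prod)
    fix X assume "X \<in> set (map (\<lambda>i. S_mean M \<gamma> (\<Psi> i)) L')"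
    then obtain i where i: "i \<in> {1..n}" "X = S_mean M \<gamma> (\<Psi> i)" using L' by auto
    show "pos_ops M X" unfolding i(2) by (rule S_mean_properties(1)[OF \<Psi>(1)[OF i(1)] \<Psi>(2)[OF i(1)] \<gamma>])
  qed
  have am: "am_compact M T" if L': "set L' = {1..n}" "L' \<noteq> []" and T: "T \<in> S \<alpha> L'" for T L'
  proof (rule am_compact_prod[OF _ _ _ T[unfolded S_def]])
    show "map (\<lambda>i. S_mean M \<alpha> (\<Psi> i)) L' \<noteq> []" using L'(2) by simp
    fix X assume "X \<in> set (map (\<lambda>i. S_mean M \<alpha> (\<Psi> i)) L')"
    then obtain i where i: "i \<in> {1..n}" "X = S_mean M \<alpha> (\<Psi> i)" using L'(1) by auto
    note p = S_mean_properties[OF \<Psi>(1)[OF i(1)] \<Psi>(2)[OF i(1)] \<alpha>01]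
    show "pos_ops M X" unfolding i(2) by (rule p(1))
    show "A \<in> X \<Longrightarrow> am_compact M A" for A unfolding i(2) by (rule p(2))
  qed
  have rel: "interp_set M \<theta> (S \<alpha> L') (S \<beta> L') (S \<beta> (rev L'))" if "set L' = {1..n}" for L'
    unfolding S_def
  proof (rule interp_set_prod[OF \<theta>])
    fix i assume "i \<in> set L'"
    then have i: "i \<in> {1..n}" using that by simp
    show "interp_set M \<theta> (S_mean M \<alpha> (\<Psi> i)) (S_mean M \<beta> (\<Psi> i)) (S_mean M \<beta> (\<Psi> i))"
      by (rule S_mean_interp[OF \<Psi>(1)[OF i] \<Psi>(2)[OF i] \<beta> \<theta> \<alpha>])
  qed
  have Lr: "set (rev L) = {1..n}" using L(1) by simp
  note rel1 = rel[OF L(1)] and rel2 = rel[OF Lr, unfolded rev_rev_ident]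
  note F1 = functional_interp[OF \<theta> h rel1 pos[OF L(1) \<alpha>01] am[OF L(1,2)] pos[OF L(1) \<beta>] pos[OF Lr \<beta>] \<rho>]
  note F2 = functional_interp[OF \<theta> h rel2 pos[OF Lr \<alpha>01] am[OF Lr L(3)] pos[OF Lr \<beta>] pos[OF L(1) \<beta>] \<rho>]
  \<comment> \<open>The nonnegativity part of \<open>functional_interp\<close> concerns only its
    second set, so it is applied with an empty first set, for which the relation holds
    vacuously.\<close>
  have nn: "0 \<le> \<rho> (S \<alpha> (rev L))"
  proof -
    have e: "pos_ops M {}" by (simp add: pos_ops_def)
    have "interp_set M \<theta> {} (S \<alpha> (rev L)) {}" by (simp add: interp_set_def)
    from functional_interp(2)[OF \<theta> h this e _ pos[OF Lr \<alpha>01] e \<rho>] show ?thesis by simp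
  qed
  let ?p = "\<rho> (S \<beta> L)" and ?q = "\<rho> (S \<beta> (rev L))"
  have "\<rho> (S \<alpha> L) * \<rho> (S \<alpha> (rev L)) \<le> (?p powr \<theta> * ?q powr (1-\<theta>)) * (?q powr \<theta> * ?p powr (1-\<theta>))"
    by (rule mult_mono[OF F1(1) F2(1) _ nn]) (auto intro!: mult_nonneg_nonneg)
  also have "\<dots> = (?p powr \<theta> * ?p powr (1-\<theta>)) * (?q powr \<theta> * ?q powr (1-\<theta>))" by (simp add: mult_ac)
  also have "\<dots> = ?p * ?q" by (simp only: powr_split[OF F1(2)] powr_split[OF F2(2)])
  finally have "\<rho> (S \<alpha> L) * \<rho> (S \<alpha> (rev L)) \<le> ?p * ?q" .
  from real_sqrt_le_mono[OF this[unfolded S_def]] show ?thesis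
    unfolding rho_n_def L_def[symmetric] .
qed

end

theorem theorem3p4:
  fixes M :: "'a measure"
    and \<Psi> :: "nat \<Rightarrow> 'a l2op set"
    and n :: nat
    and \<rho> :: "'a l2op set \<Rightarrow> real"
  assumes "sigma_finite_measure M"
    and "space M \<noteq> {}"
    and "n \<ge> 1"
    and "\<And>i A. i \<in> {1..n} \<Longrightarrow> A \<in> \<Psi> i \<Longrightarrow> positive_kernel_op M A"
    and "\<And>i. i \<in> {1..n} \<Longrightarrow> bounded_ops M (\<Psi> i)"
    and "\<rho> \<in> {gen_spectral_rad M, joint_spectral_rad M,
               gen_ess_spectral_rad M, joint_ess_spectral_rad M,
               set_norm M, set_mnc M, set_numerical_radius M}"
  shows "antimono_on {0..1/2} (rho_n M \<rho> \<Psi> n) \<and>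
         mono_on {1/2..1} (rho_n M \<rho> \<Psi> n) \<and>
         (\<forall>\<alpha>\<in>{0..1}. rho_n M \<rho> \<Psi> n \<alpha> \<ge> rho_n M \<rho> \<Psi> n (1/2))"
proof -
  interpret sigma_finite_measure M by fact
  let ?r = "rho_n M \<rho> \<Psi> n"
  have le: "?r \<alpha> \<le> ?r \<beta>"
    if \<beta>: "0 \<le> \<beta>" "\<beta> \<le> 1" and between: "\<beta> \<le> \<alpha> \<and> \<alpha> \<le> 1/2 \<or> 1/2 \<le> \<alpha> \<and> \<alpha> \<le> \<beta>" for \<alpha> \<beta>
  proof (cases "\<alpha> = \<beta>")
    case False
    \<comment> \<open>The solution of \<alpha> = \<theta>\<beta> + (1-\<theta>)(1-\<beta>). The
      denominator is nonzero, since \<alpha> differs from \<beta> and lies between \<beta> and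
      1/2.\<close>
    define \<theta> where "\<theta> = (1 - \<beta> - \<alpha>) / (1 - 2 * \<beta>)"
    have ne: "1 - 2 * \<beta> \<noteq> 0" using between False by auto
    have \<theta>: "0 < \<theta>" "\<theta> < 1"
    proof -
      have "(0 < 1 - 2 * \<beta> \<and> 0 < 1 - \<beta> - \<alpha> \<and> 1 - \<beta> - \<alpha> < 1 - 2 * \<beta>) \<or>
            (1 - 2 * \<beta> < 0 \<and> 1 - \<beta> - \<alpha> < 0 \<and> 1 - 2 * \<beta> < 1 - \<beta> - \<alpha>)"
        using between False by auto
      then show "0 < \<theta>" "\<theta> < 1" unfolding \<theta>_def by (auto simp: zero_less_divide_iff divide_less_eq)
    qed
    have "\<theta> * (1 - 2 * \<beta>) = 1 - \<beta> - \<alpha>" unfolding \<theta>_def using ne by simp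
    then have \<alpha>: "\<alpha> = \<theta> * \<beta> + (1-\<theta>) * (1-\<beta>)" by (simp add: algebra_simps)
    have "0 \<le> \<alpha>" "\<alpha> \<le> 1" using between \<beta> by auto
    then show ?thesis
      by (intro rho_n_interpolation[OF assms(3,4,5,6) \<beta> \<theta> \<alpha>])
  qed simp
  have "antimono_on {0..1/2} ?r" by (rule monotone_onI) (use le in auto)
  moreover have "mono_on {1/2..1} ?r" by (rule monotone_onI) (use le in auto)
  moreover have "?r \<alpha> \<ge> ?r (1/2)" if "\<alpha> \<in> {0..1}" for \<alpha>
    by (rule le) (use that in auto)
  ultimately show ?thesis by blast
qed

end
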